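(* Let $\Gamma$ be a group and $(\mathfrak a,\theta,f)$ a $\Gamma$-Lie bialgebra. Let $A=(S(\mathfrak a)\otimes\mathbf k\Gamma)[[\hbar]]$, write $[x|\gamma]:=x\otimes\gamma$ and $[x\otimes x'|\gamma,\gamma']:=(x\otimes\gamma)\otimes(x'\otimes\gamma')\in A^{\otimes2}$, and define $\mathbf k[[\hbar]]$-linear maps $m:A^{\otimes2}\to A$ and $\Delta:A\to A^{\otimes2}$ by $$m:[x|\gamma]\otimes[x'|\gamma']\mapsto\Big[x*\mathrm i(\mathfrak a,f_\gamma)^{-1}(\theta_\gamma(x'))*\mathrm v\big(\mathfrak a,f_\gamma,\wedge^2(\theta_\gamma)(f_{\gamma'})\big)^{-1}\Big|\gamma\gamma'\Big],$$ $$\Delta:[x|\gamma]\mapsto\big[\Delta(\mathfrak a)(x)*\mathrm F(\mathfrak a,f_\gamma)^{-1}\big|\gamma,\gamma\big].$$ Then $m$ and $\Delta$, together with the unit $[1|e]$ and the counit $[x|\gamma]\mapsto\varepsilon(x)$, define a bialgebra structure on $A$, and this bialgebra is a quantization of the co-Poisson bialgebra $U(\mathfrak a)\rtimes\Gamma$ associated with $(\mathfrak a,\theta,f)$.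
   Context: $\mathbf k$ is a field of characteristic $0$; tensor products of $\mathbf k[[\hbar]]$-modules are $\hbar$-adically completed. **$\Gamma$-Lie bialgebras.** A $\Gamma$-Lie bialgebra $(\mathfrak a,\theta,f)$ consists of a Lie bialgebra $\mathfrak a=(\mathfrak a,\mu_{\mathfrak a},\delta_{\mathfrak a})$, a group morphism $\theta:\Gamma\to\mathrm{Aut}(\mathfrak a,\mu_{\mathfrak a})$, $\gamma\mapsto\theta_\gamma$, into Lie algebra automorphisms, and a map $f:\Gamma\to\wedge^2(\mathfrak a)\subset\mathfrak a^{\otimes 2}$, $\gamma\mapsto f_\gamma$, with: (a) $\wedge^2(\theta_\gamma)\circ\delta_{\mathfrak a}\circ\theta_\gamma^{-1}(x)=\delta_{\mathfrak a}(x)+[f_\gamma,x\otimes1+1\otimes x]$ for $x\in\mathfrak a$; (b) $f_{\gamma\gamma'}=f_\gamma+\wedge^2(\theta_\gamma)(f_{\gamma'})$; (c) $(\delta_{\mathfrak a}\otimes\mathrm{id})(f_\gamma)+[f_\gamma^{1,3},f_\gamma^{2,3}]+\text{cyclic permutations}=0$. **Associated co-Poisson bialgebra.** A co-Poisson bialgebra is a cocommutative bialgebra $(U,m_0,\Delta_0)$ with a map $\delta:U\to\wedge^2(U)$ that is a derivation for $m_0$ (i.e. $\delta(ab)=\delta(a)\Delta_0(b)+\Delta_0(a)\delta(b)$), a coderivation for $\Delta_0$, and satisfies co-Jacobi. $U(\mathfrak a)\rtimes\Gamma$ is the cocommutative bialgebra generated by primitive elements $[x]$ ($x\in\mathfrak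 a$, linear in $x$, $[x][x']-[x'][x]=[[x,x']]$) and group-like elements $[\gamma]$ ($[\gamma][\gamma']=[\gamma\gamma']$, $[e]=1$) with $[\gamma][x][\gamma]^{-1}=[\theta_\gamma(x)]$. Its co-Poisson structure is $\delta([x])=[\delta_{\mathfrak a}(x)]$, $\delta([\gamma])=-[f_\gamma]([\gamma]\otimes[\gamma])$. A quantization of $(U,m_0,\Delta_0,\delta)$ is a bialgebra $(U_\hbar,m_\hbar,\Delta_\hbar)$ over $\mathbf k[[\hbar]]$ with $U_\hbar\simeq U[[\hbar]]$, $m_\hbar=m_0+O(\hbar)$, $\Delta_\hbar=\Delta_0+O(\hbar)$, $\Delta_\hbar(a)-\Delta_\hbar^{\mathrm{op}}(a)=\hbar\delta(a)+O(\hbar^2)$. Here $S(\mathfrak a)$ is identified with $U(\mathfrak a)$ by symmetrization, and $S(\mathfrak a)\otimes\mathbf k\Gamma$ with $U(\mathfrak a)\rtimes\Gamma$ by $x\otimes\gamma\mapsto[x][\gamma]$. **Quantization data.** A twist of a Lie bialgebra $\mathfrak a$ is $f_{\mathfrak a}\in\wedge^2(\mathfrak a)$ with $(\delta_{\mathfrak a}\otimes\mathrm{id})(f_{\mathfrak a})+[f_{\mathfrak a}^{13},f_{\mathfrak a}^{23}]+\text{cyclic permutations}=0$; then $\mathfrak a_{f_{\mathfrak a}}:=(\mathfrak a,\mu_{\mathfrak a},\delta_{\mathfrak a}+\mathrm{ad}(f_{\mathfrak a}))$, with $\mathrm{ad}(f_{\mathfrak a})(x)=[f_{\mathfrak a},x\otimes1+1\otimes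 x]$, is a Lie bialgebra. An Etingof--Kazhdan quantization functor is fixed, together with its quantization of twists and of compositions of twists. They assign to each Lie bialgebra $\mathfrak a$ a quantization $Q(\mathfrak a)=(S(\mathfrak a)[[\hbar]],m(\mathfrak a),\Delta(\mathfrak a))$ of $U(\mathfrak a)$ with co-Poisson structure extending $\delta_{\mathfrak a}$, with the usual unit $1\in S^0(\mathfrak a)$ and the usual counit $\varepsilon:S(\mathfrak a)[[\hbar]]\to\mathbf k[[\hbar]]$; to each twist $f_{\mathfrak a}$ of $\mathfrak a$ an invertible $\mathrm F(\mathfrak a,f_{\mathfrak a})\in Q(\mathfrak a)^{\otimes2}$ and an invertible linear map $\mathrm i(\mathfrak a,f_{\mathfrak a}):Q(\mathfrak a)\to Q(\mathfrak a_{f_{\mathfrak a}})$; and to each pair ($f_{\mathfrak a}$ a twist of $\mathfrak a$, $f'_{\mathfrak a}$ a twist of $\mathfrak a_{f_{\mathfrak a}}$) an invertible $\mathrm v(\mathfrak a,f_{\mathfrak a},f'_{\mathfrak a})\in Q(\mathfrak a)$. All these are given by universal formulas, i.e. obtained by evaluating at $(\mu_{\mathfrak a},\hbar\delta_{\mathfrak a},\hbar f_{\mathfrak a},\hbar f'_{\mathfrak a})$ fixed elements of the completed props of Lie bialgebras, of Lie bialgebras with a twist, and of Lie bialgebras with two composable twists (grading: bracket of degree $0$; cobracket and twists of degree $1$). These elements have leading terms $1$ (for $\mathrm F$, $\mathrm v$) and $\mathrm{id}$ (for $\mathrm i$), up to terms of positive degree. In particular everything is natural under Lie bialgebra isomorphisms,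 $\mathrm F(\mathfrak a,0)=1$, $\mathrm i(\mathfrak a,0)=\mathrm{id}$, $\mathrm v(\mathfrak a,0,f_{\mathfrak a})=\mathrm v(\mathfrak a,f_{\mathfrak a},0)=1$, all are equal to $1$ or $\mathrm{id}$ modulo $\hbar$, and $\mathrm F(\mathfrak a,f_{\mathfrak a})-\mathrm F(\mathfrak a,f_{\mathfrak a})^{2,1}=\hbar f_{\mathfrak a}+O(\hbar^2)$. Write $*$ for the product $m(\mathfrak a)$ and its tensor powers, and $\mathrm{Ad}(u)(x)=u*x*u^{-1}$. The data satisfy (with $f=f_{\mathfrak a}$, $f'=f'_{\mathfrak a}$, and $f''$ a twist of $\mathfrak a_{f+f'}$): - $m(\mathfrak a_f)=\mathrm i(\mathfrak a,f)\circ m(\mathfrak a)\circ(\mathrm i(\mathfrak a,f)^{\otimes2})^{-1}$ and $\Delta(\mathfrak a_f)=\mathrm i(\mathfrak a,f)^{\otimes2}\circ\mathrm{Ad}(\mathrm F(\mathfrak a,f))\circ\Delta(\mathfrak a)\circ\mathrm i(\mathfrak a,f)^{-1}$; - $(\mathrm F(\mathfrak a,f)\otimes1)*(\Delta(\mathfrak a)\otimes\mathrm{id})(\mathrm F(\mathfrak a,f))=(1\otimes\mathrm F(\mathfrak a,f))*(\mathrm{id}\otimes\Delta(\mathfrak a))(\mathrm F(\mathfrak a,f))$ and $(\varepsilon\otimes\mathrm{id})(\mathrm F(\mathfrak a,f))=(\mathrm{id}\otimes\varepsilon)(\mathrm F(\mathfrak a,f))=1$; - $\mathrm F(\mathfrak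 a,f+f')=\mathrm v(\mathfrak a,f,f')^{\otimes2}*(\mathrm i(\mathfrak a,f)^{\otimes2})^{-1}(\mathrm F(\mathfrak a_f,f'))*\mathrm F(\mathfrak a,f)*\Delta(\mathfrak a)(\mathrm v(\mathfrak a,f,f'))^{-1}$; - $\mathrm i(\mathfrak a,f+f')=\mathrm i(\mathfrak a_f,f')\circ\mathrm i(\mathfrak a,f)\circ\mathrm{Ad}(\mathrm v(\mathfrak a,f,f')^{-1})$; - $\mathrm v(\mathfrak a,f+f',f'')*\mathrm v(\mathfrak a,f,f')=\mathrm v(\mathfrak a,f,f'+f'')*\mathrm i(\mathfrak a,f)^{-1}(\mathrm v(\mathfrak a_f,f',f''))$. In the claim, $\theta_\gamma$ also denotes the extension of $\theta_\gamma$ to $S(\mathfrak a)[[\hbar]]$, which is a bialgebra isomorphism $Q(\mathfrak a)\to Q(\mathfrak a_{f_\gamma})$. Each $f_\gamma$ is a twist of $\mathfrak a$ and each $\wedge^2(\theta_\gamma)(f_{\gamma'})$ is a twist of $\mathfrak a_{f_\gamma}$. *)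

theory Defs
  imports
    "HOL-Library.Poly_Mapping"
    "HOL-Library.Multiset"
    "HOL-Computational_Algebra.Formal_Power_Series"
    "HOL-Combinatorics.Multiset_Permutations"
begin

text \<open>
  Conventions.  A vector space over the field \<open>'k\<close> is given with a basis indexed by a type
  \<open>'x\<close>, that is, as the type \<open>'x \<Rightarrow>\<^sub>0 'k\<close> of finitely supported functions; every vector space is of
  this form up to isomorphism, of any dimension.  Then \<open>V \<otimes> W\<close> is \<open>'x \<times> 'y \<Rightarrow>\<^sub>0 'k\<close>, the tensor algebra of \<open>V\<close> (which is
  the free algebra on \<open>'x\<close>) is \<open>'x list \<Rightarrow>\<^sub>0 'k\<close>, the symmetric algebra \<open>S(V)\<close> is the polynomial ring
  \<open>'x multiset \<Rightarrow>\<^sub>0 'k\<close>, and \<open>S(V) \<otimes> k\<Gamma>\<close> is \<open>'x multiset \<times> 'g \<Rightarrow>\<^sub>0 'k\<close>.  The module \<open>V[[h]]\<close> is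
  \<open>('x \<Rightarrow>\<^sub>0 'k) fps\<close> (a module over \<open>'k fps\<close>), and the \<open>h\<close>-adically completed tensor product of
  \<open>V[[h]]\<close> and \<open>W[[h]]\<close> is \<open>(V \<otimes> W)[[h]]\<close>.  The group \<open>\<Gamma>\<close> is a type of class \<open>group_add\<close> (not
  necessarily commutative), so its product is written \<open>+\<close> and its unit \<open>0\<close>.
\<close>

section \<open>Linear algebra over the field\<close>

definition scl :: "'k::field_char_0 \<Rightarrow> ('x \<Rightarrow>\<^sub>0 'k) \<Rightarrow> ('x \<Rightarrow>\<^sub>0 'k)" where
  "scl c p = Poly_Mapping.map ((*) c) p"

definition bas :: "'x \<Rightarrow> ('x \<Rightarrow>\<^sub>0 'k::field_char_0)" where
  "bas x = Poly_Mapping.single x 1"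

text \<open>\<open>lext g\<close> is the linear map with value \<open>g x\<close> on the basis vector \<open>x\<close>; \<open>rename h\<close> is the linear
  map induced by a map \<open>h\<close> of basis indices.\<close>

definition lext :: "('x \<Rightarrow> ('y \<Rightarrow>\<^sub>0 'k::field_char_0)) \<Rightarrow> ('x \<Rightarrow>\<^sub>0 'k) \<Rightarrow> ('y \<Rightarrow>\<^sub>0 'k)" where
  "lext g p = (\<Sum>x\<in>Poly_Mapping.keys p. scl (Poly_Mapping.lookup p x) (g x))"

definition rename :: "('x \<Rightarrow> 'y) \<Rightarrow> ('x \<Rightarrow>\<^sub>0 'k::field_char_0) \<Rightarrow> ('y \<Rightarrow>\<^sub>0 'k)" where
  "rename h = lext (\<lambda>x. bas (h x))"

definition tens :: "('x \<Rightarrow>\<^sub>0 'k::field_char_0) \<Rightarrow> ('y \<Rightarrow>\<^sub>0 'k) \<Rightarrow> ('x \<times> 'y \<Rightarrow>\<^sub>0 'k)" where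
  "tens p q = lext (\<lambda>x. rename (Pair x) q) p"

definition tmap :: "(('x \<Rightarrow>\<^sub>0 'k::field_char_0) \<Rightarrow> ('u \<Rightarrow>\<^sub>0 'k)) \<Rightarrow> (('y \<Rightarrow>\<^sub>0 'k) \<Rightarrow> ('v \<Rightarrow>\<^sub>0 'k))
    \<Rightarrow> ('x \<times> 'y \<Rightarrow>\<^sub>0 'k) \<Rightarrow> ('u \<times> 'v \<Rightarrow>\<^sub>0 'k)" where
  "tmap f g = lext (\<lambda>(x, y). tens (f (bas x)) (g (bas y)))"

definition assoc :: "('x \<times> 'y) \<times> 'z \<Rightarrow> 'x \<times> 'y \<times> 'z" where
  "assoc = (\<lambda>((x, y), z). (x, y, z))"

definition unassoc :: "'x \<times> 'y \<times> 'z \<Rightarrow> ('x \<times> 'y) \<times> 'z" where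
  "unassoc = (\<lambda>(x, y, z). ((x, y), z))"

definition middle_swap :: "('x \<times> 'y) \<times> ('u \<times> 'v) \<Rightarrow> ('x \<times> 'u) \<times> ('y \<times> 'v)" where
  "middle_swap = (\<lambda>((x, y), (u, v)). ((x, u), (y, v)))"

definition swap_tens :: "('x \<times> 'x \<Rightarrow>\<^sub>0 'k::field_char_0) \<Rightarrow> ('x \<times> 'x \<Rightarrow>\<^sub>0 'k)" where
  "swap_tens = rename prod.swap"

text \<open>The sum of a tensor of order three and its cyclic permutations.\<close>

definition cyc_sum :: "(('x \<times> 'x) \<times> 'x \<Rightarrow>\<^sub>0 'k::field_char_0) \<Rightarrow> (('x \<times> 'x) \<times> 'x \<Rightarrow>\<^sub>0 'k)" where
  "cyc_sum t = t + rename (\<lambda>((x, y), z). ((y, z), x)) t + rename (\<lambda>((x, y), z). ((z, x), y)) t"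

section \<open>Topologically free modules over formal power series\<close>

definition hscl :: "'k::field_char_0 fps \<Rightarrow> ('x \<Rightarrow>\<^sub>0 'k) fps \<Rightarrow> ('x \<Rightarrow>\<^sub>0 'k) fps" where
  "hscl c v = Abs_fps (\<lambda>n. \<Sum>i\<le>n. scl (fps_nth c i) (fps_nth v (n - i)))"

definition hbas :: "'x \<Rightarrow> ('x \<Rightarrow>\<^sub>0 'k::field_char_0) fps" where
  "hbas x = fps_const (bas x)"

text \<open>\<open>hlext\<close> and \<open>hfext\<close> extend maps given on the basis to \<open>k[[h]]\<close>-linear maps with values in
  \<open>W[[h]]\<close> and \<open>k[[h]]\<close>; \<open>hmap f\<close> is the \<open>k[[h]]\<close>-linear extension of a \<open>k\<close>-linear map \<open>f\<close>.\<close>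

definition hlext :: "('x \<Rightarrow> ('y \<Rightarrow>\<^sub>0 'k::field_char_0) fps) \<Rightarrow> ('x \<Rightarrow>\<^sub>0 'k) fps \<Rightarrow> ('y \<Rightarrow>\<^sub>0 'k) fps" where
  "hlext G v = Abs_fps (\<lambda>n. \<Sum>i\<le>n. lext (\<lambda>x. fps_nth (G x) (n - i)) (fps_nth v i))"

definition hfext :: "('x \<Rightarrow> 'k::field_char_0 fps) \<Rightarrow> ('x \<Rightarrow>\<^sub>0 'k) fps \<Rightarrow> 'k fps" where
  "hfext e v = Abs_fps (\<lambda>n. \<Sum>i\<le>n. \<Sum>x\<in>Poly_Mapping.keys (fps_nth v i).
      Poly_Mapping.lookup (fps_nth v i) x * fps_nth (e x) (n - i))"

definition hmap :: "(('x \<Rightarrow>\<^sub>0 'k::field_char_0) \<Rightarrow> ('y \<Rightarrow>\<^sub>0 'k)) \<Rightarrow> ('x \<Rightarrow>\<^sub>0 'k) fps \<Rightarrow> ('y \<Rightarrow>\<^sub>0 'k) fps" where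
  "hmap f v = Abs_fps (\<lambda>n. f (fps_nth v n))"

definition htens :: "('x \<Rightarrow>\<^sub>0 'k::field_char_0) fps \<Rightarrow> ('y \<Rightarrow>\<^sub>0 'k) fps \<Rightarrow> ('x \<times> 'y \<Rightarrow>\<^sub>0 'k) fps" where
  "htens v w = Abs_fps (\<lambda>n. \<Sum>i\<le>n. tens (fps_nth v i) (fps_nth w (n - i)))"

definition htmap :: "(('x \<Rightarrow>\<^sub>0 'k::field_char_0) fps \<Rightarrow> ('u \<Rightarrow>\<^sub>0 'k) fps)
    \<Rightarrow> (('y \<Rightarrow>\<^sub>0 'k) fps \<Rightarrow> ('v \<Rightarrow>\<^sub>0 'k) fps) \<Rightarrow> ('x \<times> 'y \<Rightarrow>\<^sub>0 'k) fps \<Rightarrow> ('u \<times> 'v \<Rightarrow>\<^sub>0 'k) fps" where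
  "htmap f g = hlext (\<lambda>(x, y). htens (f (hbas x)) (g (hbas y)))"

text \<open>\<open>\<epsilon> \<otimes> id\<close> and \<open>id \<otimes> \<epsilon>\<close> for a functional \<open>\<epsilon>\<close>.\<close>

definition hcontract_left :: "(('x \<Rightarrow>\<^sub>0 'k::field_char_0) fps \<Rightarrow> 'k fps)
    \<Rightarrow> ('x \<times> 'y \<Rightarrow>\<^sub>0 'k) fps \<Rightarrow> ('y \<Rightarrow>\<^sub>0 'k) fps" where
  "hcontract_left e = hlext (\<lambda>(x, y). hscl (e (hbas x)) (hbas y))"

definition hcontract_right :: "(('y \<Rightarrow>\<^sub>0 'k::field_char_0) fps \<Rightarrow> 'k fps)
    \<Rightarrow> ('x \<times> 'y \<Rightarrow>\<^sub>0 'k) fps \<Rightarrow> ('x \<Rightarrow>\<^sub>0 'k) fps" where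
  "hcontract_right e = hlext (\<lambda>(x, y). hscl (e (hbas y)) (hbas x))"

section \<open>Bialgebras over formal power series\<close>

text \<open>Products are given as linear maps on (completed) tensor products.\<close>

record (overloaded) ('x, 'k) hbialg =
  hmult :: "('x \<times> 'x \<Rightarrow>\<^sub>0 'k) fps \<Rightarrow> ('x \<Rightarrow>\<^sub>0 'k) fps"
  hunit :: "('x \<Rightarrow>\<^sub>0 'k) fps"
  hcomult :: "('x \<Rightarrow>\<^sub>0 'k) fps \<Rightarrow> ('x \<times> 'x \<Rightarrow>\<^sub>0 'k) fps"
  hcounit :: "('x \<Rightarrow>\<^sub>0 'k) fps \<Rightarrow> 'k fps"

text \<open>The product of the tensor product of two algebras.\<close>

definition prod_mult :: "(('x \<times> 'x \<Rightarrow>\<^sub>0 'k::field_char_0) fps \<Rightarrow> ('x \<Rightarrow>\<^sub>0 'k) fps)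
    \<Rightarrow> (('y \<times> 'y \<Rightarrow>\<^sub>0 'k) fps \<Rightarrow> ('y \<Rightarrow>\<^sub>0 'k) fps)
    \<Rightarrow> (('x \<times> 'y) \<times> ('x \<times> 'y) \<Rightarrow>\<^sub>0 'k) fps \<Rightarrow> ('x \<times> 'y \<Rightarrow>\<^sub>0 'k) fps" where
  "prod_mult m n = htmap m n \<circ> hmap (rename middle_swap)"

definition hmul :: "('x, 'k::field_char_0) hbialg
    \<Rightarrow> ('x \<Rightarrow>\<^sub>0 'k) fps \<Rightarrow> ('x \<Rightarrow>\<^sub>0 'k) fps \<Rightarrow> ('x \<Rightarrow>\<^sub>0 'k) fps" where
  "hmul B x y = hmult B (htens x y)"

definition hmul2 :: "('x, 'k::field_char_0) hbialg
    \<Rightarrow> ('x \<times> 'x \<Rightarrow>\<^sub>0 'k) fps \<Rightarrow> ('x \<times> 'x \<Rightarrow>\<^sub>0 'k) fps \<Rightarrow> ('x \<times> 'x \<Rightarrow>\<^sub>0 'k) fps" where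
  "hmul2 B s t = prod_mult (hmult B) (hmult B) (htens s t)"

definition hmul3 :: "('x, 'k::field_char_0) hbialg
    \<Rightarrow> (('x \<times> 'x) \<times> 'x \<Rightarrow>\<^sub>0 'k) fps \<Rightarrow> (('x \<times> 'x) \<times> 'x \<Rightarrow>\<^sub>0 'k) fps \<Rightarrow> (('x \<times> 'x) \<times> 'x \<Rightarrow>\<^sub>0 'k) fps" where
  "hmul3 B s t = prod_mult (prod_mult (hmult B) (hmult B)) (hmult B) (htens s t)"

definition hunit2 :: "('x, 'k::field_char_0) hbialg \<Rightarrow> ('x \<times> 'x \<Rightarrow>\<^sub>0 'k) fps" where
  "hunit2 B = htens (hunit B) (hunit B)"

definition is_inverse :: "('v \<Rightarrow> 'v \<Rightarrow> 'v) \<Rightarrow> 'v \<Rightarrow> 'v \<Rightarrow> 'v \<Rightarrow> bool" where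
  "is_inverse mul one x y \<longleftrightarrow> mul x y = one \<and> mul y x = one"

definition hinv :: "('x, 'k::field_char_0) hbialg \<Rightarrow> ('x \<Rightarrow>\<^sub>0 'k) fps \<Rightarrow> ('x \<Rightarrow>\<^sub>0 'k) fps" where
  "hinv B x = (THE y. is_inverse (hmul B) (hunit B) x y)"

definition hinv2 :: "('x, 'k::field_char_0) hbialg \<Rightarrow> ('x \<times> 'x \<Rightarrow>\<^sub>0 'k) fps \<Rightarrow> ('x \<times> 'x \<Rightarrow>\<^sub>0 'k) fps" where
  "hinv2 B x = (THE y. is_inverse (hmul2 B) (hunit2 B) x y)"

definition hAd :: "('x, 'k::field_char_0) hbialg
    \<Rightarrow> ('x \<Rightarrow>\<^sub>0 'k) fps \<Rightarrow> ('x \<Rightarrow>\<^sub>0 'k) fps \<Rightarrow> ('x \<Rightarrow>\<^sub>0 'k) fps" where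
  "hAd B u x = hmul B (hmul B u x) (hinv B u)"

definition hAd2 :: "('x, 'k::field_char_0) hbialg
    \<Rightarrow> ('x \<times> 'x \<Rightarrow>\<^sub>0 'k) fps \<Rightarrow> ('x \<times> 'x \<Rightarrow>\<^sub>0 'k) fps \<Rightarrow> ('x \<times> 'x \<Rightarrow>\<^sub>0 'k) fps" where
  "hAd2 B u x = hmul2 B (hmul2 B u x) (hinv2 B u)"

definition hbialgebra :: "('x, 'k::field_char_0) hbialg \<Rightarrow> bool" where
  "hbialgebra B \<longleftrightarrow>
    module_hom hscl hscl (hmult B) \<and> module_hom hscl hscl (hcomult B) \<and>
    module_hom hscl (*) (hcounit B) \<and>
    (\<forall>x y z. hmul B (hmul B x y) z = hmul B x (hmul B y z)) \<and>
    (\<forall>x. hmul B (hunit B) x = x \<and> hmul B x (hunit B) = x) \<and>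
    (\<forall>x. hmap (rename assoc) (htmap (hcomult B) id (hcomult B x)) = htmap id (hcomult B) (hcomult B x)) \<and>
    (\<forall>x. hcontract_left (hcounit B) (hcomult B x) = x \<and> hcontract_right (hcounit B) (hcomult B x) = x) \<and>
    (\<forall>x y. hcomult B (hmul B x y) = hmul2 B (hcomult B x) (hcomult B y)) \<and>
    hcomult B (hunit B) = hunit2 B \<and>
    (\<forall>x y. hcounit B (hmul B x y) = hcounit B x * hcounit B y) \<and>
    hcounit B (hunit B) = 1"

section \<open>Presented co-Poisson bialgebras and their quantizations\<close>

text \<open>
  A co-Poisson bialgebra \<open>U\<close> presented by generators \<open>'x\<close> and relations: \<open>U = T / I\<close>, where \<open>T\<close> is
  the free algebra on \<open>'x\<close> and \<open>I\<close> the two-sided ideal generated by the relations.  The coproduct,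
  counit and co-Poisson map are given on generators and extended to \<open>T\<close> as algebra morphisms,
  respectively as a derivation along the coproduct.  Elements of \<open>U\<close> are represented in \<open>T\<close> and
  compared modulo \<open>I\<close>; elements of \<open>U \<otimes> U = (T \<otimes> T) / (I \<otimes> T + T \<otimes> I)\<close> are represented in \<open>T \<otimes> T\<close>, and
  similarly for three factors.
\<close>

record (overloaded) ('x, 'k) presentation =
  rels :: "('x list \<Rightarrow>\<^sub>0 'k) set"
  gen_comult :: "'x \<Rightarrow> ('x list \<times> 'x list \<Rightarrow>\<^sub>0 'k)"
  gen_counit :: "'x \<Rightarrow> 'k"
  gen_cobracket :: "'x \<Rightarrow> ('x list \<times> 'x list \<Rightarrow>\<^sub>0 'k)"

definition fmul :: "('x list \<Rightarrow>\<^sub>0 'k::field_char_0) \<Rightarrow> ('x list \<Rightarrow>\<^sub>0 'k) \<Rightarrow> ('x list \<Rightarrow>\<^sub>0 'k)" where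
  "fmul p q = rename (\<lambda>(u, v). u @ v) (tens p q)"

definition fmul2 :: "('x list \<times> 'x list \<Rightarrow>\<^sub>0 'k::field_char_0) \<Rightarrow> ('x list \<times> 'x list \<Rightarrow>\<^sub>0 'k)
    \<Rightarrow> ('x list \<times> 'x list \<Rightarrow>\<^sub>0 'k)" where
  "fmul2 s t = rename (\<lambda>((u, v), (u', v')). (u @ u', v @ v')) (tens s t)"

definition pideal :: "('x, 'k::field_char_0) presentation \<Rightarrow> ('x list \<Rightarrow>\<^sub>0 'k) set" where
  "pideal P = module.span scl {fmul (fmul a r) b | a r b. r \<in> rels P}"

definition pnull2 :: "('x, 'k::field_char_0) presentation \<Rightarrow> ('x list \<times> 'x list \<Rightarrow>\<^sub>0 'k) set" where
  "pnull2 P = module.span scl {tens a b | a b. a \<in> pideal P \<or> b \<in> pideal P}"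

definition pnull3 :: "('x, 'k::field_char_0) presentation \<Rightarrow> (('x list \<times> 'x list) \<times> 'x list \<Rightarrow>\<^sub>0 'k) set" where
  "pnull3 P = module.span scl {tens (tens a b) c | a b c. a \<in> pideal P \<or> b \<in> pideal P \<or> c \<in> pideal P}"

fun word_comult :: "('x, 'k::field_char_0) presentation \<Rightarrow> 'x list \<Rightarrow> ('x list \<times> 'x list \<Rightarrow>\<^sub>0 'k)" where
  "word_comult P [] = bas ([], [])"
| "word_comult P (x # w) = fmul2 (gen_comult P x) (word_comult P w)"

fun word_cobracket :: "('x, 'k::field_char_0) presentation \<Rightarrow> 'x list \<Rightarrow> ('x list \<times> 'x list \<Rightarrow>\<^sub>0 'k)" where
  "word_cobracket P [] = 0"
| "word_cobracket P (x # w) =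
    fmul2 (gen_cobracket P x) (word_comult P w) + fmul2 (gen_comult P x) (word_cobracket P w)"

definition pcomult :: "('x, 'k::field_char_0) presentation \<Rightarrow> ('x list \<Rightarrow>\<^sub>0 'k) \<Rightarrow> ('x list \<times> 'x list \<Rightarrow>\<^sub>0 'k)" where
  "pcomult P = lext (word_comult P)"

definition pcobracket :: "('x, 'k::field_char_0) presentation \<Rightarrow> ('x list \<Rightarrow>\<^sub>0 'k) \<Rightarrow> ('x list \<times> 'x list \<Rightarrow>\<^sub>0 'k)" where
  "pcobracket P = lext (word_cobracket P)"

definition pcounit_left :: "('x, 'k::field_char_0) presentation \<Rightarrow> ('x list \<times> 'x list \<Rightarrow>\<^sub>0 'k) \<Rightarrow> ('x list \<Rightarrow>\<^sub>0 'k)" where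
  "pcounit_left P = lext (\<lambda>(u, v). scl (prod_list (map (gen_counit P) u)) (bas v))"

definition pcounit :: "('x, 'k::field_char_0) presentation \<Rightarrow> ('x list \<Rightarrow>\<^sub>0 'k) \<Rightarrow> 'k" where
  "pcounit P p = (\<Sum>u\<in>Poly_Mapping.keys p. Poly_Mapping.lookup p u * prod_list (map (gen_counit P) u))"

text \<open>The right counit law follows from the left one by cocommutativity, and multiplicativity of the
  coproduct and counit hold in \<open>T\<close> by construction.\<close>

definition co_Poisson_bialgebra :: "('x, 'k::field_char_0) presentation \<Rightarrow> bool" where
  "co_Poisson_bialgebra P \<longleftrightarrow>
    (\<forall>t\<in>pideal P. pcomult P t \<in> pnull2 P \<and> pcounit P t = 0 \<and> pcobracket P t \<in> pnull2 P) \<and>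
    (\<forall>t. tmap (pcomult P) id (pcomult P t) - rename unassoc (tmap id (pcomult P) (pcomult P t)) \<in> pnull3 P) \<and>
    (\<forall>t. pcounit_left P (pcomult P t) - t \<in> pideal P) \<and>
    (\<forall>t. swap_tens (pcomult P t) - pcomult P t \<in> pnull2 P) \<and>
    (\<forall>t. swap_tens (pcobracket P t) + pcobracket P t \<in> pnull2 P) \<and>
    (\<forall>s t. pcobracket P (fmul s t)
       - (fmul2 (pcobracket P s) (pcomult P t) + fmul2 (pcomult P s) (pcobracket P t)) \<in> pnull2 P) \<and>
    (\<forall>t. rename unassoc (tmap id (pcomult P) (pcobracket P t))
       - (tmap (pcobracket P) id (pcomult P t)
          + rename (\<lambda>(x, y, z). ((y, x), z)) (tmap id (pcobracket P) (pcomult P t))) \<in> pnull3 P) \<and>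
    (\<forall>t. cyc_sum (tmap (pcobracket P) id (pcobracket P t)) \<in> pnull3 P)"

text \<open>\<open>B\<close> is a quantization of \<open>U = T / I\<close>, where \<open>V[[h]]\<close> (the module underlying \<open>B\<close>) is
  identified with \<open>U[[h]]\<close> by means of a linear map \<open>\<phi> : V \<rightarrow> T\<close> inducing an isomorphism \<open>V \<rightarrow> U\<close>.\<close>

definition quantization ::
  "('x, 'k::field_char_0) presentation \<Rightarrow> (('s \<Rightarrow>\<^sub>0 'k) \<Rightarrow> ('x list \<Rightarrow>\<^sub>0 'k)) \<Rightarrow> ('s, 'k) hbialg \<Rightarrow> bool" where
  "quantization P \<phi> B \<longleftrightarrow>
    co_Poisson_bialgebra P \<and> hbialgebra B \<and>
    Vector_Spaces.linear scl scl \<phi> \<and>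
    (\<forall>x. \<phi> x \<in> pideal P \<longrightarrow> x = 0) \<and> (\<forall>t. \<exists>x. \<phi> x - t \<in> pideal P) \<and>
    (\<forall>x y. \<phi> (fps_nth (hmul B (fps_const x) (fps_const y)) 0) - fmul (\<phi> x) (\<phi> y) \<in> pideal P) \<and>
    (\<forall>x. tmap \<phi> \<phi> (fps_nth (hcomult B (fps_const x)) 0) - pcomult P (\<phi> x) \<in> pnull2 P) \<and>
    (\<forall>x. let d = hcomult B (fps_const x) - hmap swap_tens (hcomult B (fps_const x)) in
       fps_nth d 0 = 0 \<and> tmap \<phi> \<phi> (fps_nth d 1) - pcobracket P (\<phi> x) \<in> pnull2 P)"

section \<open>Lie bialgebras, twists and \<open>\<Gamma>\<close>-Lie bialgebras\<close>

record (overloaded) ('b, 'k) lie_bialg =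
  lbr :: "('b \<Rightarrow>\<^sub>0 'k) \<Rightarrow> ('b \<Rightarrow>\<^sub>0 'k) \<Rightarrow> ('b \<Rightarrow>\<^sub>0 'k)"
  lcob :: "('b \<Rightarrow>\<^sub>0 'k) \<Rightarrow> ('b \<times> 'b \<Rightarrow>\<^sub>0 'k)"

text \<open>\<open>tens_bracket L t x\<close> is \<open>[t, x \<otimes> 1 + 1 \<otimes> x]\<close>, and \<open>bracket_13_23 L t\<close> is \<open>[t\<^sup>1\<^sup>3, t\<^sup>2\<^sup>3]\<close>.\<close>

definition tens_bracket :: "('b, 'k::field_char_0) lie_bialg
    \<Rightarrow> ('b \<times> 'b \<Rightarrow>\<^sub>0 'k) \<Rightarrow> ('b \<Rightarrow>\<^sub>0 'k) \<Rightarrow> ('b \<times> 'b \<Rightarrow>\<^sub>0 'k)" where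
  "tens_bracket L t x =
    lext (\<lambda>(b, c). tens (lbr L (bas b) x) (bas c) + tens (bas b) (lbr L (bas c) x)) t"

definition bracket_13_23 :: "('b, 'k::field_char_0) lie_bialg
    \<Rightarrow> ('b \<times> 'b \<Rightarrow>\<^sub>0 'k) \<Rightarrow> (('b \<times> 'b) \<times> 'b \<Rightarrow>\<^sub>0 'k)" where
  "bracket_13_23 L t =
    lext (\<lambda>((a, b), (c, d)). tens (bas (a, c)) (lbr L (bas b) (bas d))) (tens t t)"

definition lie_bialgebra :: "('b, 'k::field_char_0) lie_bialg \<Rightarrow> bool" where
  "lie_bialgebra L \<longleftrightarrow>
    (\<forall>x. Vector_Spaces.linear scl scl (lbr L x)) \<and>
    (\<forall>y. Vector_Spaces.linear scl scl (\<lambda>x. lbr L x y)) \<and>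
    (\<forall>x. lbr L x x = 0) \<and>
    (\<forall>x y z. lbr L x (lbr L y z) + lbr L y (lbr L z x) + lbr L z (lbr L x y) = 0) \<and>
    Vector_Spaces.linear scl scl (lcob L) \<and>
    (\<forall>x. swap_tens (lcob L x) = - lcob L x) \<and>
    (\<forall>x. cyc_sum (tmap (lcob L) id (lcob L x)) = 0) \<and>
    (\<forall>x y. lcob L (lbr L x y) = tens_bracket L (lcob L x) y - tens_bracket L (lcob L y) x)"

definition is_twist :: "('b, 'k::field_char_0) lie_bialg \<Rightarrow> ('b \<times> 'b \<Rightarrow>\<^sub>0 'k) \<Rightarrow> bool" where
  "is_twist L f \<longleftrightarrow> swap_tens f = - f \<and> cyc_sum (tmap (lcob L) id f + bracket_13_23 L f) = 0"

definition twisted :: "('b, 'k::field_char_0) lie_bialg \<Rightarrow> ('b \<times> 'b \<Rightarrow>\<^sub>0 'k) \<Rightarrow> ('b, 'k) lie_bialg" where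
  "twisted L f = \<lparr>lbr = lbr L, lcob = (\<lambda>x. lcob L x + tens_bracket L f x)\<rparr>"

definition lie_automorphism :: "('b, 'k::field_char_0) lie_bialg \<Rightarrow> (('b \<Rightarrow>\<^sub>0 'k) \<Rightarrow> ('b \<Rightarrow>\<^sub>0 'k)) \<Rightarrow> bool" where
  "lie_automorphism L \<phi> \<longleftrightarrow> Vector_Spaces.linear scl scl \<phi> \<and> bij \<phi> \<and>
    (\<forall>x y. \<phi> (lbr L x y) = lbr L (\<phi> x) (\<phi> y))"

definition lie_bialg_iso :: "('b, 'k::field_char_0) lie_bialg \<Rightarrow> ('b, 'k) lie_bialg
    \<Rightarrow> (('b \<Rightarrow>\<^sub>0 'k) \<Rightarrow> ('b \<Rightarrow>\<^sub>0 'k)) \<Rightarrow> bool" where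
  "lie_bialg_iso L L' \<phi> \<longleftrightarrow> Vector_Spaces.linear scl scl \<phi> \<and> bij \<phi> \<and>
    (\<forall>x y. \<phi> (lbr L x y) = lbr L' (\<phi> x) (\<phi> y)) \<and>
    (\<forall>x. tmap \<phi> \<phi> (lcob L x) = lcob L' (\<phi> x))"

definition Gamma_lie_bialgebra :: "('b, 'k::field_char_0) lie_bialg
    \<Rightarrow> ('g::group_add \<Rightarrow> ('b \<Rightarrow>\<^sub>0 'k) \<Rightarrow> ('b \<Rightarrow>\<^sub>0 'k)) \<Rightarrow> ('g \<Rightarrow> ('b \<times> 'b \<Rightarrow>\<^sub>0 'k)) \<Rightarrow> bool" where
  "Gamma_lie_bialgebra L \<theta> f \<longleftrightarrow>
    lie_bialgebra L \<and>
    (\<forall>g. lie_automorphism L (\<theta> g)) \<and> (\<forall>g h. \<theta> (g + h) = \<theta> g \<circ> \<theta> h) \<and>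
    (\<forall>g. swap_tens (f g) = - f g) \<and>
    (\<forall>g x. tmap (\<theta> g) (\<theta> g) (lcob L (inv (\<theta> g) x)) = lcob L x + tens_bracket L (f g) x) \<and>
    (\<forall>g h. f (g + h) = f g + tmap (\<theta> g) (\<theta> g) (f h)) \<and>
    (\<forall>g. cyc_sum (tmap (lcob L) id (f g) + bracket_13_23 L (f g)) = 0)"

section \<open>The co-Poisson bialgebras \<open>U(a)\<close> and \<open>U(a) \<rtimes> \<Gamma>\<close>\<close>

definition U_presentation :: "('b, 'k::field_char_0) lie_bialg \<Rightarrow> ('b \<Rightarrow>\<^sub>0 'k, 'k) presentation" where
  "U_presentation L =
    \<lparr>rels = {bas [x + y] - bas [x] - bas [y] | x y. True}
          \<union> {bas [scl c x] - scl c (bas [x]) | c x. True}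
          \<union> {bas [x, y] - bas [y, x] - bas [lbr L x y] | x y. True},
     gen_comult = (\<lambda>x. bas ([x], []) + bas ([], [x])),
     gen_counit = (\<lambda>x. 0),
     gen_cobracket = (\<lambda>x. rename (\<lambda>(b, c). ([bas b], [bas c])) (lcob L x))\<rparr>"

datatype ('a, 'g) cross_gen = Prim 'a | Grp 'g

definition cross_presentation :: "('b, 'k::field_char_0) lie_bialg
    \<Rightarrow> ('g::group_add \<Rightarrow> ('b \<Rightarrow>\<^sub>0 'k) \<Rightarrow> ('b \<Rightarrow>\<^sub>0 'k)) \<Rightarrow> ('g \<Rightarrow> ('b \<times> 'b \<Rightarrow>\<^sub>0 'k))
    \<Rightarrow> (('b \<Rightarrow>\<^sub>0 'k, 'g) cross_gen, 'k) presentation" where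
  "cross_presentation L \<theta> f =
    \<lparr>rels = {bas [Prim (x + y)] - bas [Prim x] - bas [Prim y] | x y. True}
          \<union> {bas [Prim (scl c x)] - scl c (bas [Prim x]) | c x. True}
          \<union> {bas [Prim x, Prim y] - bas [Prim y, Prim x] - bas [Prim (lbr L x y)] | x y. True}
          \<union> {bas [Grp g, Grp h] - bas [Grp (g + h)] | g h. True}
          \<union> {bas [Grp 0] - bas []}
          \<union> {bas [Grp g, Prim x, Grp (- g)] - bas [Prim (\<theta> g x)] | g x. True},
     gen_comult = (\<lambda>s. case s of Prim x \<Rightarrow> bas ([Prim x], []) + bas ([], [Prim x])
                               | Grp g \<Rightarrow> bas ([Grp g], [Grp g])),
     gen_counit = (\<lambda>s. case s of Prim x \<Rightarrow> 0 | Grp g \<Rightarrow> 1),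
     gen_cobracket = (\<lambda>s. case s of
         Prim x \<Rightarrow> rename (\<lambda>(b, c). ([Prim (bas b)], [Prim (bas c)])) (lcob L x)
       | Grp g \<Rightarrow> - rename (\<lambda>(b, c). ([Prim (bas b), Grp g], [Prim (bas c), Grp g])) (f g))\<rparr>"

text \<open>Symmetrization, from the symmetric algebra to the tensor algebra: the average of all orderings
  of a monomial.\<close>

definition symmetrize :: "'b multiset \<Rightarrow> ('b list \<Rightarrow>\<^sub>0 'k::field_char_0)" where
  "symmetrize M = scl (1 / of_nat (card (permutations_of_multiset M))) (\<Sum>w\<in>permutations_of_multiset M. bas w)"

definition U_identification :: "('b multiset \<Rightarrow>\<^sub>0 'k::field_char_0) \<Rightarrow> (('b \<Rightarrow>\<^sub>0 'k) list \<Rightarrow>\<^sub>0 'k)" where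
  "U_identification = lext (\<lambda>M. rename (map bas) (symmetrize M))"

definition cross_identification ::
  "('b multiset \<times> 'g \<Rightarrow>\<^sub>0 'k::field_char_0) \<Rightarrow> (('b \<Rightarrow>\<^sub>0 'k, 'g) cross_gen list \<Rightarrow>\<^sub>0 'k)" where
  "cross_identification =
    lext (\<lambda>(M, g). rename (\<lambda>w. map (\<lambda>b. Prim (bas b)) w @ [Grp g]) (symmetrize M))"

section \<open>Universal formulas\<close>

text \<open>
  Diagrams built from the generators of the prop of Lie bialgebras with twists.  A homogeneous element
  of degree \<open>d\<close> of this prop between tensor powers is the class of a linear combination of diagrams;
  since evaluation in a Lie bialgebra only depends on the class, no quotient is taken.
\<close>

datatype diagram =
    Ident nat
  | Flip
  | Bracket
  | Cobracket
  | Twist nat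
  | Comp diagram diagram
  | Par diagram diagram

fun dsource :: "diagram \<Rightarrow> nat" where
  "dsource (Ident n) = n"
| "dsource Flip = 2"
| "dsource Bracket = 2"
| "dsource Cobracket = 1"
| "dsource (Twist i) = 0"
| "dsource (Comp D E) = dsource E"
| "dsource (Par D E) = dsource D + dsource E"

fun dtarget :: "diagram \<Rightarrow> nat" where
  "dtarget (Ident n) = n"
| "dtarget Flip = 2"
| "dtarget Bracket = 1"
| "dtarget Cobracket = 2"
| "dtarget (Twist i) = 2"
| "dtarget (Comp D E) = dtarget D"
| "dtarget (Par D E) = dtarget D + dtarget E"

text \<open>Well-formed diagrams that only use the first \<open>n\<close> twists.\<close>

fun diagram_ok :: "nat \<Rightarrow> diagram \<Rightarrow> bool" where
  "diagram_ok n (Twist i) \<longleftrightarrow> i < n"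
| "diagram_ok n (Comp D E) \<longleftrightarrow> diagram_ok n D \<and> diagram_ok n E \<and> dsource D = dtarget E"
| "diagram_ok n (Par D E) \<longleftrightarrow> diagram_ok n D \<and> diagram_ok n E"
| "diagram_ok n _ \<longleftrightarrow> True"

fun ddegree :: "diagram \<Rightarrow> nat" where
  "ddegree Cobracket = 1"
| "ddegree (Twist i) = 1"
| "ddegree (Comp D E) = ddegree D + ddegree E"
| "ddegree (Par D E) = ddegree D + ddegree E"
| "ddegree _ = 0"

fun deval :: "('b, 'k::field_char_0) lie_bialg \<Rightarrow> ('b \<times> 'b \<Rightarrow>\<^sub>0 'k) list \<Rightarrow> diagram
    \<Rightarrow> 'b list \<Rightarrow> ('b list \<Rightarrow>\<^sub>0 'k)" where
  "deval L fs (Ident n) w = bas w"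
| "deval L fs Flip w = bas [w ! 1, w ! 0]"
| "deval L fs Bracket w = rename (\<lambda>b. [b]) (lbr L (bas (w ! 0)) (bas (w ! 1)))"
| "deval L fs Cobracket w = rename (\<lambda>(b, c). [b, c]) (lcob L (bas (w ! 0)))"
| "deval L fs (Twist i) w = rename (\<lambda>(b, c). [b, c]) (fs ! i)"
| "deval L fs (Comp D E) w = lext (deval L fs D) (deval L fs E w)"
| "deval L fs (Par D E) w =
    fmul (deval L fs D (take (dsource D) w)) (deval L fs E (drop (dsource D) w))"

text \<open>
  An element \<open>U\<close> of the completed prop from \<open>S\<^sup>\<otimes>\<^sup>r\<close> to \<open>S\<^sup>\<otimes>\<^sup>s\<close>: \<open>U ps qs d\<close> represents its component of
  degree \<open>d\<close> from \<open>S\<^sup>p\<^sup>1 \<otimes> \<dots> \<otimes> S\<^sup>p\<^sup>r\<close> to \<open>S\<^sup>q\<^sup>1 \<otimes> \<dots> \<otimes> S\<^sup>q\<^sup>s\<close>, the Schur functor \<open>S\<^sup>p\<close> being viewed as a direct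
  summand of the \<open>p\<close>-th tensor power by symmetrization.
\<close>

type_synonym 'k universal = "nat list \<Rightarrow> nat list \<Rightarrow> nat \<Rightarrow> (diagram \<Rightarrow>\<^sub>0 'k)"

definition universal_ok :: "nat \<Rightarrow> 'k::field_char_0 universal \<Rightarrow> bool" where
  "universal_ok n U \<longleftrightarrow> (\<forall>ps qs d. \<forall>D\<in>Poly_Mapping.keys (U ps qs d).
    diagram_ok n D \<and> dsource D = sum_list ps \<and> dtarget D = sum_list qs \<and> ddegree D = d)"

fun sym_tensor :: "'b multiset list \<Rightarrow> ('b list \<Rightarrow>\<^sub>0 'k::field_char_0)" where
  "sym_tensor [] = bas []"
| "sym_tensor (M # Ms) = fmul (symmetrize M) (sym_tensor Ms)"

fun split_word :: "nat list \<Rightarrow> 'b list \<Rightarrow> 'b multiset list" where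
  "split_word [] w = []"
| "split_word (q # qs) w = mset (take q w) # split_word qs (drop q w)"

text \<open>
  Evaluation of \<open>U\<close> at the bracket, \<open>h\<close> times the cobracket and \<open>h\<close> times the twists \<open>fs\<close>: the component
  of degree \<open>d\<close> contributes to the coefficient of \<open>h\<^sup>d\<close>.  The bound on \<open>qs\<close> makes the sum finite and
  omits only zero terms, as a diagram of degree \<open>d\<close> raises the tensor power by at most \<open>2 d\<close>.
\<close>

definition ueval :: "('b, 'k::field_char_0) lie_bialg \<Rightarrow> ('b \<times> 'b \<Rightarrow>\<^sub>0 'k) list \<Rightarrow> 'k universal
    \<Rightarrow> nat \<Rightarrow> 'b multiset list \<Rightarrow> ('b multiset list \<Rightarrow>\<^sub>0 'k) fps" where
  "ueval L fs U s Ms = Abs_fps (\<lambda>d.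
    \<Sum>qs\<in>{qs. length qs = s \<and> sum_list qs \<le> sum_list (map size Ms) + 2 * d}.
      rename (split_word qs)
        (lext (\<lambda>D. lext (deval L fs D) (sym_tensor Ms)) (U (map size Ms) qs d)))"

section \<open>Etingof--Kazhdan quantization of Lie bialgebras and twists\<close>

record (overloaded) 'k ek_data =
  ek_m :: "'k universal"
  ek_Delta :: "'k universal"
  ek_F :: "'k universal"
  ek_i :: "'k universal"
  ek_v :: "'k universal"

definition ek_Q :: "'k::field_char_0 ek_data \<Rightarrow> ('b, 'k) lie_bialg \<Rightarrow> ('b multiset, 'k) hbialg" where
  "ek_Q E L =
    \<lparr>hmult = hlext (\<lambda>(M, N). hmap (rename (\<lambda>l. l ! 0)) (ueval L [] (ek_m E) 1 [M, N])),
     hunit = hbas {#},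
     hcomult = hlext (\<lambda>M. hmap (rename (\<lambda>l. (l ! 0, l ! 1))) (ueval L [] (ek_Delta E) 2 [M])),
     hcounit = hfext (\<lambda>M. if M = {#} then 1 else 0)\<rparr>"

definition Ftw :: "'k::field_char_0 ek_data \<Rightarrow> ('b, 'k) lie_bialg \<Rightarrow> ('b \<times> 'b \<Rightarrow>\<^sub>0 'k)
    \<Rightarrow> ('b multiset \<times> 'b multiset \<Rightarrow>\<^sub>0 'k) fps" where
  "Ftw E L f = hmap (rename (\<lambda>l. (l ! 0, l ! 1))) (ueval L [f] (ek_F E) 2 [])"

definition itw :: "'k::field_char_0 ek_data \<Rightarrow> ('b, 'k) lie_bialg \<Rightarrow> ('b \<times> 'b \<Rightarrow>\<^sub>0 'k)
    \<Rightarrow> ('b multiset \<Rightarrow>\<^sub>0 'k) fps \<Rightarrow> ('b multiset \<Rightarrow>\<^sub>0 'k) fps" where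
  "itw E L f = hlext (\<lambda>M. hmap (rename (\<lambda>l. l ! 0)) (ueval L [f] (ek_i E) 1 [M]))"

definition vtw :: "'k::field_char_0 ek_data \<Rightarrow> ('b, 'k) lie_bialg \<Rightarrow> ('b \<times> 'b \<Rightarrow>\<^sub>0 'k) \<Rightarrow> ('b \<times> 'b \<Rightarrow>\<^sub>0 'k)
    \<Rightarrow> ('b multiset \<Rightarrow>\<^sub>0 'k) fps" where
  "vtw E L f f' = hmap (rename (\<lambda>l. l ! 0)) (ueval L [f, f'] (ek_v E) 1 [])"

text \<open>The extension of a linear map to the symmetric algebra; the product is that of the polynomial
  ring \<open>'b multiset \<Rightarrow>\<^sub>0 'k\<close>.\<close>

definition S_map :: "(('b \<Rightarrow>\<^sub>0 'k::field_char_0) \<Rightarrow> ('b \<Rightarrow>\<^sub>0 'k))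
    \<Rightarrow> ('b multiset \<Rightarrow>\<^sub>0 'k) \<Rightarrow> ('b multiset \<Rightarrow>\<^sub>0 'k)" where
  "S_map \<phi> = lext (\<lambda>M. \<Prod>b\<in>#M. rename (\<lambda>c. {#c#}) (\<phi> (bas b)))"

definition ek_invertible :: "'b itself \<Rightarrow> 'k::field_char_0 ek_data \<Rightarrow> bool" where
  "ek_invertible _ E \<longleftrightarrow> (\<forall>(L :: ('b, 'k) lie_bialg) f f'.
    lie_bialgebra L \<longrightarrow> is_twist L f \<longrightarrow> is_twist (twisted L f) f' \<longrightarrow>
      (\<exists>G. is_inverse (hmul2 (ek_Q E L)) (hunit2 (ek_Q E L)) (Ftw E L f) G) \<and>
      bij (itw E L f) \<and>
      (\<exists>w. is_inverse (hmul (ek_Q E L)) (hunit (ek_Q E L)) (vtw E L f f') w))"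

definition ek_normalized :: "'b itself \<Rightarrow> 'k::field_char_0 ek_data \<Rightarrow> bool" where
  "ek_normalized _ E \<longleftrightarrow> (\<forall>(L :: ('b, 'k) lie_bialg) f f'.
    lie_bialgebra L \<longrightarrow> is_twist L f \<longrightarrow> is_twist (twisted L f) f' \<longrightarrow>
      Ftw E L 0 = hunit2 (ek_Q E L) \<and> itw E L 0 = id \<and>
      vtw E L 0 f = hunit (ek_Q E L) \<and> vtw E L f 0 = hunit (ek_Q E L) \<and>
      fps_nth (Ftw E L f) 0 = fps_nth (hunit2 (ek_Q E L)) 0 \<and>
      (\<forall>x. fps_nth (itw E L f x) 0 = fps_nth x 0) \<and>
      fps_nth (vtw E L f f') 0 = fps_nth (hunit (ek_Q E L)) 0 \<and>
      fps_nth (Ftw E L f - hmap swap_tens (Ftw E L f)) 1 = rename (\<lambda>(b, c). ({#b#}, {#c#})) f)"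

definition ek_natural :: "'b itself \<Rightarrow> 'k::field_char_0 ek_data \<Rightarrow> bool" where
  "ek_natural _ E \<longleftrightarrow> (\<forall>(L :: ('b, 'k) lie_bialg) L' \<phi> f f'.
    lie_bialgebra L \<longrightarrow> lie_bialgebra L' \<longrightarrow> lie_bialg_iso L L' \<phi> \<longrightarrow>
    is_twist L f \<longrightarrow> is_twist (twisted L f) f' \<longrightarrow>
      (let \<Phi> = hmap (S_map \<phi>); \<Phi>2 = htmap \<Phi> \<Phi>; \<phi>2 = tmap \<phi> \<phi> in
        \<Phi> \<circ> hmult (ek_Q E L) = hmult (ek_Q E L') \<circ> \<Phi>2 \<and>
        \<Phi>2 \<circ> hcomult (ek_Q E L) = hcomult (ek_Q E L') \<circ> \<Phi> \<and>
        \<Phi>2 (Ftw E L f) = Ftw E L' (\<phi>2 f) \<and>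
        \<Phi> \<circ> itw E L f = itw E L' (\<phi>2 f) \<circ> \<Phi> \<and>
        \<Phi> (vtw E L f f') = vtw E L' (\<phi>2 f) (\<phi>2 f')))"

definition ek_twist_identities :: "'b itself \<Rightarrow> 'k::field_char_0 ek_data \<Rightarrow> bool" where
  "ek_twist_identities _ E \<longleftrightarrow> (\<forall>(L :: ('b, 'k) lie_bialg) f.
    lie_bialgebra L \<longrightarrow> is_twist L f \<longrightarrow>
      (let Q = ek_Q E L; Q' = ek_Q E (twisted L f); F = Ftw E L f; i = itw E L f; i2 = htmap i i in
        hmult Q' = i \<circ> hmult Q \<circ> inv i2 \<and>
        hcomult Q' = i2 \<circ> hAd2 Q F \<circ> hcomult Q \<circ> inv i \<and>
        hmul3 Q (htens F (hunit Q)) (htmap (hcomult Q) id F)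
          = hmul3 Q (hmap (rename unassoc) (htens (hunit Q) F))
                    (hmap (rename unassoc) (htmap id (hcomult Q) F)) \<and>
        hcontract_left (hcounit Q) F = hunit Q \<and> hcontract_right (hcounit Q) F = hunit Q))"

definition ek_composition_identities :: "'b itself \<Rightarrow> 'k::field_char_0 ek_data \<Rightarrow> bool" where
  "ek_composition_identities _ E \<longleftrightarrow> (\<forall>(L :: ('b, 'k) lie_bialg) f f'.
    lie_bialgebra L \<longrightarrow> is_twist L f \<longrightarrow> is_twist (twisted L f) f' \<longrightarrow>
      (let Q = ek_Q E L; v = vtw E L f f'; i = itw E L f; i2 = htmap i i in
        Ftw E L (f + f') =
          hmul2 Q (hmul2 Q (hmul2 Q (htens v v) (inv i2 (Ftw E (twisted L f) f'))) (Ftw E L f))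
            (hinv2 Q (hcomult Q v)) \<and>
        itw E L (f + f') = itw E (twisted L f) f' \<circ> i \<circ> hAd Q (hinv Q v) \<and>
        (\<forall>f''. is_twist (twisted L (f + f')) f'' \<longrightarrow>
          hmul Q (vtw E L (f + f') f'') v
            = hmul Q (vtw E L f (f' + f'')) (inv i (vtw E (twisted L f) f' f'')))))"

text \<open>Etingof--Kazhdan quantization functor with quantization of twists and of their compositions,
  on the Lie bialgebras whose underlying vector space has a basis indexed by \<open>'b\<close>.\<close>

definition ek_quantization :: "'b itself \<Rightarrow> 'k::field_char_0 ek_data \<Rightarrow> bool" where
  "ek_quantization T E \<longleftrightarrow>
    universal_ok 0 (ek_m E) \<and> universal_ok 0 (ek_Delta E) \<and>
    universal_ok 1 (ek_F E) \<and> universal_ok 1 (ek_i E) \<and> universal_ok 2 (ek_v E) \<and>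
    (\<forall>L :: ('b, 'k) lie_bialg. lie_bialgebra L \<longrightarrow>
      quantization (U_presentation L) U_identification (ek_Q E L)) \<and>
    ek_invertible T E \<and> ek_normalized T E \<and> ek_natural T E \<and>
    ek_twist_identities T E \<and> ek_composition_identities T E"

section \<open>The bialgebra \<open>A = (S(a) \<otimes> k\<Gamma>)[[h]]\<close>\<close>

text \<open>\<open>at_group g x\<close> is \<open>[x|g]\<close> and \<open>at_group2 g h t\<close> is \<open>[t|g, h]\<close>.\<close>

definition at_group :: "'g \<Rightarrow> ('b multiset \<Rightarrow>\<^sub>0 'k::field_char_0) fps \<Rightarrow> ('b multiset \<times> 'g \<Rightarrow>\<^sub>0 'k) fps" where
  "at_group g = hmap (rename (\<lambda>M. (M, g)))"

definition at_group2 :: "'g \<Rightarrow> 'g \<Rightarrow> ('b multiset \<times> 'b multiset \<Rightarrow>\<^sub>0 'k::field_char_0) fps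
    \<Rightarrow> (('b multiset \<times> 'g) \<times> ('b multiset \<times> 'g) \<Rightarrow>\<^sub>0 'k) fps" where
  "at_group2 g h = hmap (rename (\<lambda>(M, N). ((M, g), (N, h))))"

definition cross_quantization :: "'k::field_char_0 ek_data \<Rightarrow> ('b, 'k) lie_bialg
    \<Rightarrow> ('g::group_add \<Rightarrow> ('b \<Rightarrow>\<^sub>0 'k) \<Rightarrow> ('b \<Rightarrow>\<^sub>0 'k)) \<Rightarrow> ('g \<Rightarrow> ('b \<times> 'b \<Rightarrow>\<^sub>0 'k))
    \<Rightarrow> ('b multiset \<times> 'g, 'k) hbialg" where
  "cross_quantization E L \<theta> f = (let Q = ek_Q E L in
    \<lparr>hmult = hlext (\<lambda>((M, g), (N, h)). at_group (g + h)
        (hmul Q (hmul Q (hbas M) (inv (itw E L (f g)) (hmap (S_map (\<theta> g)) (hbas N))))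
                (hinv Q (vtw E L (f g) (tmap (\<theta> g) (\<theta> g) (f h)))))),
     hunit = at_group 0 (hunit Q),
     hcomult = hlext (\<lambda>(M, g). at_group2 g g
        (hmul2 Q (hcomult Q (hbas M)) (hinv2 Q (Ftw E L (f g))))),
     hcounit = hfext (\<lambda>(M, g). hcounit Q (hbas M))\<rparr>)"

end

theory Submission
  imports Defs
begin

text \<open>
  Write \<open>\<alpha>\<^sub>g = i(a,f\<^sub>g)\<^sup>-\<^sup>1 \<circ> \<theta>\<^sub>g\<close>, an algebra automorphism of \<open>Q = Q(a)\<close>, \<open>v\<^sub>g\<^sub>h = v(a, f\<^sub>g, \<theta>\<^sub>g f\<^sub>h)\<close> and
  \<open>F\<^sub>g = F(a, f\<^sub>g)\<close>.  Naturality and the composition identities say that \<open>\<alpha>\<^sub>g\<^sub>h = Ad(v\<^sub>g\<^sub>h) \<alpha>\<^sub>g \<alpha>\<^sub>h\<close>, that \<open>v\<close>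
  is a cocycle for \<open>\<alpha>\<close>, and that \<open>\<alpha>\<^sub>g\<close> carries \<open>\<Delta>\<close> to its twist by \<open>F\<^sub>g\<close>; these are exactly the identities
  making the crossed product of \<open>Q\<close> and \<open>\<Gamma>\<close> a bialgebra.

  A bialgebra over \<open>k[[h]]\<close> that is cocommutative modulo \<open>h\<close> has a co-Poisson bialgebra as classical
  limit.  So the co-Poisson axioms of \<open>U(a) \<rtimes> \<Gamma>\<close> need not be checked on the presentation: it suffices to
  identify the presented algebra with the classical limit of the crossed product, and to compare the
  coproduct and the cobracket on generators.
\<close>

section \<open>Free vector spaces\<close>

text \<open>The PBW theorem is never proved. It is contained in the hypothesis that
  \<open>Q(a)\<close> quantizes \<open>U(a)\<close>, which includes the bijectivity of
  symmetrization onto \<open>U(a)\<close>. For the crossed product, spanning is a rewriting argument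
  that moves group letters to the right. Independence comes from evaluating words in the classical
  limit of \<open>A\<close>: the evaluation kills the relations and undoes the identification of
  \<open>S(a) \<otimes> k\<Gamma>\<close> with normal forms. The same evaluation reduces membership
  in the null spaces of \<open>T\<close>, \<open>T \<otimes> T\<close> and
  \<open>T \<otimes> T \<otimes> T\<close> to equations in the classical limit.

  The product of \<open>A\<close> contains \<open>v\<close> inversely and its coproduct contains
  \<open>F\<close> inversely. The calculations therefore use \<open>w = v^{-1}\<close> and
  \<open>G = F^{-1}\<close>, whose identities are obtained by inverting those of \<open>v\<close>
  and \<open>F\<close>. The inverse of \<open>F\<close> is also the source of the minus sign in the
  cobracket of a group element.\<close>

abbreviation "klinear \<equiv> Vector_Spaces.linear scl scl"

lemma lookup_scl [simp]: "Poly_Mapping.lookup (scl c p) x = c * Poly_Mapping.lookup p x"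
  by (simp add: scl_def Poly_Mapping.map.rep_eq when_def)

lemma lookup_bas: "Poly_Mapping.lookup (bas x) y = (if x = y then 1 else 0)"
  by (simp add: bas_def lookup_single when_def)

lemma vector_space_scl: "vector_space scl"
  by unfold_locales (auto intro!: poly_mapping_eqI simp: lookup_add algebra_simps)

interpretation scl: vector_space scl
  by (rule vector_space_scl)

lemma klinearI:
  assumes "\<And>x y. f (x + y) = f x + f y" "\<And>c x. f (scl c x) = scl c (f x)"
  shows "klinear f"
  using assms by (simp add: Vector_Spaces.linear_iff vector_space_scl)

lemma
  assumes "klinear f"
  shows klinear_add: "f (x + y) = f x + f y"
    and klinear_scl: "f (scl c x) = scl c (f x)"
    and klinear_0: "f 0 = 0"
    and klinear_neg: "f (- x) = - f x"
    and klinear_diff: "f (x - y) = f x - f y"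
    and klinear_sum: "f (sum g A) = (\<Sum>a\<in>A. f (g a))"
proof -
  interpret Vector_Spaces.linear scl scl f by fact
  show "f (x + y) = f x + f y" "f (scl c x) = scl c (f x)" "f 0 = 0" "f (- x) = - f x"
    "f (x - y) = f x - f y" "f (sum g A) = (\<Sum>a\<in>A. f (g a))"
    by (simp_all add: add scale neg diff sum)
qed

lemma klinear_id: "klinear (\<lambda>x. x)"
  by (rule klinearI) simp_all

lemma klinear_compose: "klinear f \<Longrightarrow> klinear g \<Longrightarrow> klinear (\<lambda>x. f (g x))"
  by (rule klinearI) (simp_all add: klinear_add klinear_scl)

lemma klinear_plus: "klinear f \<Longrightarrow> klinear g \<Longrightarrow> klinear (\<lambda>x. f x + g x)"
  by (rule klinearI) (simp_all add: klinear_add klinear_scl scl.scale_right_distrib)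

lemma klinear_minus: "klinear f \<Longrightarrow> klinear g \<Longrightarrow> klinear (\<lambda>x. f x - g x)"
  by (rule klinearI) (simp_all add: klinear_add klinear_scl scl.scale_right_diff_distrib)

lemma klinear_uminus: "klinear f \<Longrightarrow> klinear (\<lambda>x. - f x)"
  by (rule klinearI) (simp_all add: klinear_add klinear_scl)

text \<open>Cancellation can make the support of \<open>p + q\<close> smaller than the union of the
  supports; linearity of \<open>lext\<close> needs one index set for all terms.\<close>

lemma lext_superset:
  assumes "finite A" "Poly_Mapping.keys p \<subseteq> A"
  shows "lext g p = (\<Sum>x\<in>A. scl (Poly_Mapping.lookup p x) (g x))"
  unfolding lext_def using assms
  by (intro sum.mono_neutral_left) (auto simp: in_keys_iff)

lemma klinear_lext [simp]:
  fixes g :: "'x \<Rightarrow> ('y \<Rightarrow>\<^sub>0 'k::field_char_0)"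
  shows "klinear (lext g)"
proof (rule klinearI)
  fix p q :: "'x \<Rightarrow>\<^sub>0 'k" and c
  let ?A = "Poly_Mapping.keys p \<union> Poly_Mapping.keys q"
  have "Poly_Mapping.keys (p + q) \<subseteq> ?A" by (rule Poly_Mapping.keys_add)
  then show "lext g (p + q) = lext g p + lext g q"
    by (simp add: lext_superset[of ?A] lookup_add scl.scale_left_distrib sum.distrib)
  have "Poly_Mapping.keys (scl c p) \<subseteq> Poly_Mapping.keys p"
    by (auto simp: in_keys_iff)
  then show "lext g (scl c p) = scl c (lext g p)"
    by (simp add: lext_superset[of "Poly_Mapping.keys p"] scl.scale_sum_right)
qed

lemma keys_bas [simp]: "Poly_Mapping.keys (bas x :: _ \<Rightarrow>\<^sub>0 'k::field_char_0) = {x}"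
  by (simp add: bas_def)

lemma lext_bas [simp]: "lext g (bas x) = g x"
  by (simp add: lext_def lookup_bas)

lemma lext_basis: "lext bas p = p"
  by (rule poly_mapping_eqI)
    (auto simp: lext_def lookup_sum lookup_bas if_distrib sum.delta in_keys_iff cong: if_cong)

lemma klinear_eq_lext: "klinear f \<Longrightarrow> f p = lext (\<lambda>x. f (bas x)) p"
  using arg_cong[OF lext_basis[of p], of f]
  by (simp add: lext_def klinear_sum klinear_scl)

lemma klinear_ext:
  assumes "klinear f" "klinear g" "\<And>x. f (bas x) = g (bas x)"
  shows "f p = g p"
  by (simp add: klinear_eq_lext[OF assms(1), of p] klinear_eq_lext[OF assms(2), of p] assms(3))

lemma klinear_rename [simp]: "klinear (rename h)"
  by (simp add: rename_def)

lemma rename_bas [simp]: "rename h (bas x) = bas (h x)"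
  by (simp add: rename_def)

lemma rename_rename: "rename h (rename h' p) = rename (\<lambda>x. h (h' x)) p"
  by (rule klinear_ext) (simp_all add: klinear_compose)

lemma tens_left: "klinear (\<lambda>p. tens p q)"
  by (simp add: tens_def)

lemma tens_right: "klinear (\<lambda>q. tens p q)"
  unfolding tens_def lext_def
  by (rule klinearI) (simp_all add: klinear_add[OF klinear_rename] klinear_scl[OF klinear_rename]
      scl.scale_right_distrib sum.distrib scl.scale_sum_right mult.commute)

lemma tens_bas [simp]: "tens (bas x) (bas y) = bas (x, y)"
  by (simp add: tens_def)

lemmas klinear_intros = klinear_id klinear_lext klinear_rename klinear_plus klinear_minus
  klinear_uminus klinear_compose[OF klinear_lext] klinear_compose[OF klinear_rename]
  klinear_compose[OF tens_left] klinear_compose[OF tens_right] tens_left tens_right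

lemmas tens_simps =
  klinear_add[OF tens_left] klinear_add[OF tens_right]
  klinear_scl[OF tens_left] klinear_scl[OF tens_right]
  klinear_0[OF tens_left] klinear_0[OF tens_right]
  klinear_neg[OF tens_left] klinear_neg[OF tens_right]
  klinear_diff[OF tens_left] klinear_diff[OF tens_right]

lemma bilinear_ext:
  assumes "\<And>q. klinear (\<lambda>p. F p q)" "\<And>p. klinear (F p)"
    and "\<And>q. klinear (\<lambda>p. G p q)" "\<And>p. klinear (G p)"
    and "\<And>x y. F (bas x) (bas y) = G (bas x) (bas y)"
  shows "F p q = G p q"
proof (rule klinear_ext[where f = "\<lambda>p. F p q" and g = "\<lambda>p. G p q"])
  show "F (bas x) q = G (bas x) q" for x
    by (rule klinear_ext) (use assms in auto)
qed (use assms in auto)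

lemma tens_ext:
  assumes "klinear F" "klinear G" "\<And>p q. F (tens p q) = G (tens p q)"
  shows "F t = G t"
  using assms(1,2)
proof (rule klinear_ext)
  show "F (bas x) = G (bas x)" for x
    using assms(3)[of "bas (fst x)" "bas (snd x)"] by simp
qed

lemma tens_ext3:
  assumes "klinear F" "klinear G" "\<And>p q r. F (tens (tens p q) r) = G (tens (tens p q) r)"
  shows "F t = G t"
  using assms(1,2)
proof (rule klinear_ext)
  show "F (bas x) = G (bas x)" for x
    using assms(3)[of "bas (fst (fst x))" "bas (snd (fst x))" "bas (snd x)"] by simp
qed

lemma klinear_tmap [simp]: "klinear (tmap f g)"
  by (simp add: tmap_def)

lemma tmap_tens:
  assumes "klinear f" "klinear g"
  shows "tmap f g (tens p q) = tens (f p) (g q)"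
  by (rule bilinear_ext[of "\<lambda>p q. tmap f g (tens p q)" "\<lambda>p q. tens (f p) (g q)"])
    (auto simp: tmap_def intro!: klinear_intros klinear_compose[OF tens_left] klinear_compose[OF tens_right] assms)

lemma tmap_tmap:
  assumes "klinear f" "klinear g" "klinear f'" "klinear g'"
  shows "tmap f g (tmap f' g' t) = tmap (\<lambda>x. f (f' x)) (\<lambda>x. g (g' x)) t"
  by (rule tens_ext) (simp_all add: tmap_tens klinear_compose assms)

lemma tmap_id [simp]: "tmap (\<lambda>x. x) (\<lambda>x. x) t = t" "tmap id id t = t"
  by (rule tens_ext; simp add: tmap_tens klinear_id id_def)+

lemma rename_tens_map: "rename (\<lambda>(x, y). (h x, k y)) (tens p q) = tens (rename h p) (rename k q)"
  by (rule bilinear_ext[of "\<lambda>p q. rename (\<lambda>(x, y). (h x, k y)) (tens p q)"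
        "\<lambda>p q. tens (rename h p) (rename k q)"])
    (auto intro!: klinear_intros)

lemma swap_tens_tens: "swap_tens (tens p q) = tens q p"
  by (rule bilinear_ext[of "\<lambda>p q. swap_tens (tens p q)" "\<lambda>p q. tens q p"])
    (auto simp: swap_tens_def intro!: klinear_intros)

lemma klinear_swap_tens [simp]: "klinear swap_tens"
  by (simp add: swap_tens_def)

lemma swap_tens_tmap: "swap_tens (tmap f f t) = tmap f f (swap_tens t)"
  if "klinear f"
  by (rule tens_ext) (simp_all add: klinear_compose that tmap_tens swap_tens_tens)

lemma trilinear_ext:
  assumes "\<And>q r. klinear (\<lambda>p. F p q r)" "\<And>p r. klinear (\<lambda>q. F p q r)" "\<And>p q. klinear (F p q)"
    and "\<And>q r. klinear (\<lambda>p. G p q r)" "\<And>p r. klinear (\<lambda>q. G p q r)" "\<And>p q. klinear (G p q)"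
    and "\<And>x y z. F (bas x) (bas y) (bas z) = G (bas x) (bas y) (bas z)"
  shows "F p q r = G p q r"
proof (rule klinear_ext[where f = "\<lambda>p. F p q r" and g = "\<lambda>p. G p q r"])
  show "F (bas x) q r = G (bas x) q r" for x
    by (rule bilinear_ext[of "F (bas x)"]) (use assms in auto)
qed (use assms in auto)

section \<open>Topologically free modules\<close>

abbreviation "hlinear \<equiv> module_hom hscl hscl"

text \<open>Coordinates are power series, and infinitely many of them may be nonzero. They turn the
  module axioms and the action of \<open>hscl\<close> into identities in the ring
  \<open>k[[h]]\<close>.\<close>

definition hcoord :: "('x \<Rightarrow>\<^sub>0 'k::field_char_0) fps \<Rightarrow> 'x \<Rightarrow> 'k fps" where
  "hcoord v x = Abs_fps (\<lambda>n. Poly_Mapping.lookup (fps_nth v n) x)"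

lemma hcoord_eqI: "(\<And>x. hcoord v x = hcoord w x) \<Longrightarrow> v = w"
  by (auto intro!: fps_ext poly_mapping_eqI simp: hcoord_def fps_eq_iff)

lemma hcoord_add: "hcoord (v + w) x = hcoord v x + hcoord w x"
  by (auto intro!: fps_ext simp: hcoord_def lookup_add)

lemma hcoord_hscl: "hcoord (hscl c v) x = c * hcoord v x"
  by (auto intro!: fps_ext simp: hcoord_def hscl_def fps_mult_nth lookup_sum atLeast0AtMost)

lemma module_hscl: "module hscl"
  by unfold_locales
    (auto intro!: hcoord_eqI simp: hcoord_add hcoord_hscl algebra_simps)

interpretation hscl: module hscl
  by (rule module_hscl)

lemma hlinearI:
  assumes "\<And>x y. f (x + y) = f x + f y" "\<And>c x. f (hscl c x) = hscl c (f x)"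
  shows "hlinear f"
  using assms by (simp add: module_hom_iff module_hscl)

lemma
  assumes "hlinear f"
  shows hlinear_add: "f (x + y) = f x + f y"
    and hlinear_hscl: "f (hscl c x) = hscl c (f x)"
    and hlinear_0: "f 0 = 0"
    and hlinear_neg: "f (- x) = - f x"
    and hlinear_diff: "f (x - y) = f x - f y"
    and hlinear_sum: "f (sum g A) = (\<Sum>a\<in>A. f (g a))"
proof -
  interpret module_hom hscl hscl f by fact
  show "f (x + y) = f x + f y" "f (hscl c x) = hscl c (f x)" "f 0 = 0" "f (- x) = - f x"
    "f (x - y) = f x - f y" "f (sum g A) = (\<Sum>a\<in>A. f (g a))"
    by (simp_all add: add scale neg diff sum)
qed

lemma hlinear_id: "hlinear (\<lambda>x. x)"
  by (rule hlinearI) simp_all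

lemma hlinear_compose: "hlinear f \<Longrightarrow> hlinear g \<Longrightarrow> hlinear (\<lambda>x. f (g x))"
  by (rule hlinearI) (simp_all add: hlinear_add hlinear_hscl)

lemma hlinear_plus: "hlinear f \<Longrightarrow> hlinear g \<Longrightarrow> hlinear (\<lambda>x. f x + g x)"
  by (rule hlinearI) (simp_all add: hlinear_add hlinear_hscl hscl.scale_right_distrib)

lemma hlinear_minus: "hlinear f \<Longrightarrow> hlinear g \<Longrightarrow> hlinear (\<lambda>x. f x - g x)"
  by (rule hlinearI) (simp_all add: hlinear_add hlinear_diff hlinear_hscl hscl.scale_right_diff_distrib)

lemma hlinear_scale: "hlinear f \<Longrightarrow> hlinear (\<lambda>x. hscl c (f x))"
  by (rule hlinearI) (simp_all add: hlinear_add hlinear_hscl hscl.scale_right_distrib mult.commute)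

lemma lookup_eq_hcoord: "Poly_Mapping.lookup (fps_nth v n) x = fps_nth (hcoord v x) n"
  by (simp add: hcoord_def)

lemma hscl_const: "hscl (fps_const c) v = Abs_fps (\<lambda>n. scl c (fps_nth v n))"
  by (intro fps_ext poly_mapping_eqI) (simp add: lookup_eq_hcoord hcoord_hscl)

lemma hscl_X_nth: "fps_nth (hscl fps_X v) n = (if n = 0 then 0 else fps_nth v (n - 1))"
  by (intro poly_mapping_eqI) (simp add: lookup_eq_hcoord hcoord_hscl)

text \<open>\<open>V[[h]]\<close> has no \<open>h\<close>-torsion. This is what later allows
  identities for \<Delta> minus its opposite to be divided by \<open>h\<close>.\<close>

lemma hscl_X_cancel: "hscl fps_X v = hscl fps_X w \<longleftrightarrow> v = w"
proof
  assume "hscl fps_X v = hscl fps_X w"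
  then have "fps_nth v n = fps_nth w n" for n
    using hscl_X_nth[of v "Suc n"] hscl_X_nth[of w "Suc n"] by simp
  then show "v = w" by (rule fps_ext)
qed simp

lemma fps_split_const: "v = fps_const (fps_nth v 0) + hscl fps_X (fps_shift 1 v)"
  by (rule fps_ext) (auto simp: hscl_X_nth)

lemma fps_const_eq_sum:
  "fps_const p = (\<Sum>x\<in>Poly_Mapping.keys p. hscl (fps_const (Poly_Mapping.lookup p x)) (hbas x))"
proof (rule fps_ext)
  fix n
  have "p = (\<Sum>x\<in>Poly_Mapping.keys p. scl (Poly_Mapping.lookup p x) (bas x))"
    using lext_basis[of p] by (simp add: lext_def)
  then show "fps_nth (fps_const p) n =
      fps_nth (\<Sum>x\<in>Poly_Mapping.keys p. hscl (fps_const (Poly_Mapping.lookup p x)) (hbas x)) n"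
    by (simp add: fps_sum_nth hscl_const hbas_def)
qed

text \<open>A \<open>k[[h]]\<close>-linear map is automatically \<open>h\<close>-adically continuous, hence determined by its values
  on the basis.\<close>

lemma hlinear_ext:
  assumes "hlinear f" "hlinear g" "\<And>x. f (hbas x) = g (hbas x)"
  shows "f v = g v"
proof -
  define d where "d = (\<lambda>v. f v - g v)"
  have d: "hlinear d" unfolding d_def by (intro hlinear_minus assms)
  have "d (hbas x) = 0" for x by (simp add: d_def assms(3))
  then have "d (fps_const p) = 0" for p
    by (simp add: fps_const_eq_sum hlinear_sum[OF d] hlinear_hscl[OF d])
  \<comment> \<open>Since \<open>d\<close> vanishes on constant series, \<open>d v\<close> is
    \<open>h\<close> times the value of \<open>d\<close> at the shifted series. Iterating,
    \<open>d v\<close> is divisible by every power of \<open>h\<close>.\<close>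
  then have "d v = hscl fps_X (d (fps_shift 1 v))" for v
    using arg_cong[OF fps_split_const[of v], of d] by (simp add: hlinear_add[OF d] hlinear_hscl[OF d])
  then have step: "fps_nth (d v) n = (if n = 0 then 0 else fps_nth (d (fps_shift 1 v)) (n - 1))" for v n
    by (metis hscl_X_nth)
  have "fps_nth (d v) n = 0" for n
    by (induction n arbitrary: v) (simp_all add: step)
  then have "d v = 0" by (simp add: fps_eq_iff)
  then show ?thesis by (simp add: d_def)
qed

lemma hlinear_hlext [simp]:
  fixes G :: "'x \<Rightarrow> ('y \<Rightarrow>\<^sub>0 'k::field_char_0) fps"
  shows "hlinear (hlext G)"
proof (rule hlinearI)
  show "hlext G (v + w) = hlext G v + hlext G w" for v w
    by (rule fps_ext) (simp add: hlext_def klinear_add[OF klinear_lext] sum.distrib)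
  show "hlext G (hscl c v) = hscl c (hlext G v)" for c v
  proof (rule fps_ext)
    fix n
    define T where "T i j l = scl (fps_nth c i) (lext (\<lambda>x. fps_nth (G x) l) (fps_nth v j))" for i j l
    have "fps_nth (hlext G (hscl c v)) n = (\<Sum>j=0..n. \<Sum>i=0..j. T i (j - i) (n - j))"
      by (simp add: hlext_def hscl_def klinear_sum klinear_scl T_def atLeast0AtMost)
    \<comment> \<open>The regrouping of triples of indices with sum \<open>n\<close> that also
      proves associativity of the Cauchy product.\<close>
    also have "\<dots> = (\<Sum>j=0..n. \<Sum>i=0..n - j. T j i (n - j - i))"
      by (rule fps_mult_assoc_lemma)
    also have "\<dots> = fps_nth (hscl c (hlext G v)) n"
      by (simp add: hlext_def hscl_def scl.scale_sum_right T_def atLeast0AtMost)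
    finally show "fps_nth (hlext G (hscl c v)) n = fps_nth (hscl c (hlext G v)) n" .
  qed
qed

lemma hlext_const_nth: "fps_nth (hlext G (fps_const p)) n = lext (\<lambda>x. fps_nth (G x) n) p"
proof -
  have "fps_nth (hlext G (fps_const p)) n =
      (\<Sum>i\<in>{..n}. if i = 0 then lext (\<lambda>x. fps_nth (G x) n) p else 0)"
    unfolding hlext_def fps_nth_Abs_fps
    by (rule sum.cong) (auto simp: klinear_0[OF klinear_lext])
  then show ?thesis by simp
qed

lemma hlext_hbas [simp]: "hlext G (hbas x) = G x"
  by (rule fps_ext) (simp add: hbas_def hlext_const_nth)

lemma hmap_eq_hlext:
  assumes "klinear f"
  shows "hmap f v = hlext (\<lambda>x. fps_const (f (bas x))) v"
proof (rule fps_ext)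
  fix n
  have "fps_nth (hlext (\<lambda>x. fps_const (f (bas x))) v) n =
      (\<Sum>i\<in>{..n}. if i = n then f (fps_nth v n) else 0)"
    unfolding hlext_def fps_nth_Abs_fps
    by (rule sum.cong) (auto simp: klinear_eq_lext[OF assms, of "fps_nth v n"] lext_def)
  then show "fps_nth (hmap f v) n = fps_nth (hlext (\<lambda>x. fps_const (f (bas x))) v) n"
    by (simp add: hmap_def)
qed

lemma hlinear_hmap: "klinear f \<Longrightarrow> hlinear (hmap f)"
  by (subst ext[of "hmap f", OF hmap_eq_hlext]) simp_all

lemma hmap_hbas: "klinear f \<Longrightarrow> hmap f (hbas x) = fps_const (f (bas x))"
  by (simp add: hmap_eq_hlext)

lemma hlinear_rename [simp]: "hlinear (hmap (rename h))"
  by (simp add: hlinear_hmap)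

lemma hmap_rename_hbas [simp]: "hmap (rename h) (hbas x) = hbas (h x)"
  by (subst hmap_hbas) (simp_all add: hbas_def)

lemma hmap_nth [simp]: "fps_nth (hmap f v) n = f (fps_nth v n)"
  by (simp add: hmap_def)

lemma hmap_rename_rename: "hmap (rename h) (hmap (rename h') v) = hmap (rename (\<lambda>x. h (h' x))) v"
  by (rule hlinear_ext) (simp_all add: hlinear_compose)

lemma htens_nth_0 [simp]: "fps_nth (htens v w) 0 = tens (fps_nth v 0) (fps_nth w 0)"
  by (simp add: htens_def)

lemma htens_eq_hlext:
  fixes v :: "('x \<Rightarrow>\<^sub>0 'k::field_char_0) fps" and w :: "('y \<Rightarrow>\<^sub>0 'k) fps"
  shows "htens v w = hlext (\<lambda>x. hmap (tens (bas x)) w) v"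
proof (rule fps_ext)
  have *: "tens p q = lext (\<lambda>x. tens (bas x) q) p" for p :: "'x \<Rightarrow>\<^sub>0 'k" and q :: "'y \<Rightarrow>\<^sub>0 'k"
    by (rule klinear_eq_lext[OF tens_left])
  show "fps_nth (htens v w) n = fps_nth (hlext (\<lambda>x. hmap (tens (bas x)) w) v) n" for n
    by (simp add: htens_def hlext_def *[of "fps_nth v _"])
qed

text \<open>Reversing the Cauchy sum expands along the second factor, which gives linearity in
  \<open>w\<close>.\<close>

lemma htens_eq_hlext':
  fixes v :: "('x \<Rightarrow>\<^sub>0 'k::field_char_0) fps" and w :: "('y \<Rightarrow>\<^sub>0 'k) fps"
  shows "htens v w = hlext (\<lambda>y. hmap (\<lambda>p. tens p (bas y)) v) w"
proof (rule fps_ext)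
  have *: "tens p q = lext (\<lambda>y. tens p (bas y)) q" for p :: "'x \<Rightarrow>\<^sub>0 'k" and q :: "'y \<Rightarrow>\<^sub>0 'k"
    by (rule klinear_eq_lext[OF tens_right])
  fix n
  have "fps_nth (htens v w) n = (\<Sum>i\<le>n. tens (fps_nth v (n - i)) (fps_nth w (n - (n - i))))"
    unfolding htens_def fps_nth_Abs_fps
    by (rule sum.reindex_bij_witness[of _ "\<lambda>i. n - i" "\<lambda>i. n - i"]) auto
  also have "\<dots> = fps_nth (hlext (\<lambda>y. hmap (\<lambda>p. tens p (bas y)) v) w) n"
    by (simp add: hlext_def *[of _ "fps_nth w _"])
  finally show "fps_nth (htens v w) n = fps_nth (hlext (\<lambda>y. hmap (\<lambda>p. tens p (bas y)) v) w) n" .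
qed

lemma htens_left: "hlinear (\<lambda>v. htens v w)"
  by (simp add: htens_eq_hlext)

lemma htens_right: "hlinear (\<lambda>w. htens v w)"
  by (simp add: htens_eq_hlext')

lemma htens_hbas [simp]: "htens (hbas x) (hbas y) = hbas (x, y)"
  by (simp add: htens_eq_hlext hmap_hbas[OF tens_right]) (simp add: hbas_def)

lemmas htens_simps =
  hlinear_add[OF htens_left] hlinear_add[OF htens_right]
  hlinear_hscl[OF htens_left] hlinear_hscl[OF htens_right]
  hlinear_0[OF htens_left] hlinear_0[OF htens_right]
  hlinear_neg[OF htens_left] hlinear_neg[OF htens_right]
  hlinear_diff[OF htens_left] hlinear_diff[OF htens_right]

lemma htens_const: "htens (fps_const p) (fps_const q) = fps_const (tens p q)"
proof (rule fps_ext)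
  fix n
  have "fps_nth (htens (fps_const p) (fps_const q)) n =
      (\<Sum>i\<in>{..n}. if i = 0 then if n = 0 then tens p q else 0 else 0)"
    unfolding htens_def fps_nth_Abs_fps by (rule sum.cong) (auto simp: tens_simps)
  then show "fps_nth (htens (fps_const p) (fps_const q)) n = fps_nth (fps_const (tens p q)) n"
    by simp
qed

lemmas hlinear_intros = hlinear_id hlinear_plus hlinear_minus hlinear_scale
  hlinear_compose[OF hlinear_hlext] hlinear_compose[OF hlinear_rename]
  hlinear_compose[OF htens_left] hlinear_compose[OF htens_right]

lemma hbilinear_ext:
  assumes "\<And>w. hlinear (\<lambda>v. F v w)" "\<And>v. hlinear (F v)"
    and "\<And>w. hlinear (\<lambda>v. G v w)" "\<And>v. hlinear (G v)"
    and "\<And>x y. F (hbas x) (hbas y) = G (hbas x) (hbas y)"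
  shows "F v w = G v w"
proof (rule hlinear_ext[where f = "\<lambda>v. F v w" and g = "\<lambda>v. G v w"])
  show "F (hbas x) w = G (hbas x) w" for x
    by (rule hlinear_ext) (use assms in auto)
qed (use assms in auto)

lemma htens_eqI:
  assumes "hlinear F" "\<And>w. hlinear (\<lambda>v. G v w)" "\<And>v. hlinear (G v)"
    and "\<And>x y. F (hbas (x, y)) = G (hbas x) (hbas y)"
  shows "F (htens v w) = G v w"
  by (rule hbilinear_ext[of "\<lambda>v w. F (htens v w)"])
    (use assms in \<open>auto intro: hlinear_compose[OF _ htens_left] hlinear_compose[OF _ htens_right]\<close>)

lemma htens_ext:
  assumes "hlinear F" "hlinear G" "\<And>v w. F (htens v w) = G (htens v w)"
  shows "F t = G t"
  using assms(1,2)
proof (rule hlinear_ext)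
  show "F (hbas x) = G (hbas x)" for x
    using assms(3)[of "hbas (fst x)" "hbas (snd x)"] by simp
qed

lemma hlinear_htmap [simp]: "hlinear (htmap f g)"
  by (simp add: htmap_def)

lemma htmap_htens:
  assumes "hlinear f" "hlinear g"
  shows "htmap f g (htens v w) = htens (f v) (g w)"
  by (rule htens_eqI)
    (auto simp: htmap_def assms intro!: hlinear_compose[OF htens_left] hlinear_compose[OF htens_right])

lemma htmap_htmap:
  assumes "hlinear f" "hlinear g" "hlinear f'" "hlinear g'"
  shows "htmap f g (htmap f' g' t) = htmap (\<lambda>x. f (f' x)) (\<lambda>x. g (g' x)) t"
  by (rule htens_ext) (simp_all add: htmap_htens hlinear_compose assms)

lemma htmap_id [simp]: "htmap (\<lambda>x. x) (\<lambda>x. x) t = t"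
  by (rule htens_ext) (simp_all add: htmap_htens hlinear_id)

text \<open>A functional is turned into a linear map by tensoring with a one-dimensional space.\<close>

lemma hfunctional_ext:
  fixes e e' :: "('x \<Rightarrow>\<^sub>0 'k::field_char_0) fps \<Rightarrow> 'k fps"
  assumes "module_hom hscl (*) e" "module_hom hscl (*) e'" "\<And>x. e (hbas x) = e' (hbas x)"
  shows "e v = e' v"
proof -
  have lin: "hlinear (\<lambda>v. hscl (e v) (hbas ()))" if "module_hom hscl (*) e"
    for e :: "('x \<Rightarrow>\<^sub>0 'k::field_char_0) fps \<Rightarrow> 'k fps"
    using that by (intro hlinearI) (simp_all add: module_hom_iff hscl.scale_left_distrib)
  have "hscl (e v) (hbas ()) = hscl (e' v) (hbas ())"
    by (rule hlinear_ext) (simp_all add: lin assms)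
  then have "hcoord (hscl (e v) (hbas ())) () = hcoord (hscl (e' v) (hbas ())) ()" by simp
  moreover have "hcoord (hbas ()) () = (1 :: 'k fps)"
    by (rule fps_ext) (simp add: hcoord_def hbas_def lookup_bas)
  ultimately show ?thesis by (simp add: hcoord_hscl)
qed

abbreviation hfunctional :: "(('x \<Rightarrow>\<^sub>0 'k::field_char_0) fps \<Rightarrow> 'k fps) \<Rightarrow> bool" where
  "hfunctional \<equiv> module_hom hscl (*)"

lemma hfunctionalI:
  fixes e :: "('x \<Rightarrow>\<^sub>0 'k::field_char_0) fps \<Rightarrow> 'k fps"
  assumes "\<And>x y. e (x + y) = e x + e y" "\<And>c x. e (hscl c x) = c * e x"
  shows "hfunctional e"
proof -
  have "module ((*) :: 'k fps \<Rightarrow> _)" by unfold_locales (simp_all add: algebra_simps)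
  then show ?thesis using assms by (simp add: module_hom_iff module_hscl)
qed

lemma
  assumes "hfunctional e"
  shows hfunctional_add: "e (x + y) = e x + e y"
    and hfunctional_hscl: "e (hscl c x) = c * e x"
  using assms by (simp_all add: module_hom_iff)

lemma hfunctional_compose: "hfunctional e \<Longrightarrow> hlinear g \<Longrightarrow> hfunctional (\<lambda>x. e (g x))"
  by (rule hfunctionalI) (simp_all add: hlinear_add hlinear_hscl hfunctional_add hfunctional_hscl)

lemma hfunctional_scale: "hfunctional e \<Longrightarrow> hlinear (\<lambda>x. hscl (e x) w)"
  by (rule hlinearI) (simp_all add: hfunctional_add hfunctional_hscl hscl.scale_left_distrib)

lemma hfunctional_hfext [simp]:
  fixes e :: "'x \<Rightarrow> 'k::field_char_0 fps"
  shows "hfunctional (hfext e)"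
    and hfext_hbas [simp]: "hfext e (hbas x) = e x"
proof -
  \<comment> \<open>The functional is again viewed as a map to a free module of rank one, so that
    its linearity follows from that of \<open>hlext\<close>.\<close>
  define E where "E = (\<lambda>v. hlext (\<lambda>x. Abs_fps (\<lambda>n. scl (fps_nth (e x) n) (bas ()))) v)"
  have E: "hlinear E" by (simp add: E_def)
  have eq: "hfext e = (\<lambda>v. hcoord (E v) ())"
    by (intro ext fps_ext)
      (simp add: E_def hfext_def hcoord_def hlext_def lookup_sum lext_def lookup_bas)
  show "hfunctional (hfext e)"
    by (rule hfunctionalI) (simp_all add: eq hlinear_add[OF E] hlinear_hscl[OF E] hcoord_add hcoord_hscl)
  show "hfext e (hbas x) = e x"
    by (rule fps_ext) (simp add: eq E_def hcoord_def lookup_bas)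
qed

lemma hlinear_contract [simp]: "hlinear (hcontract_left e)" "hlinear (hcontract_right e)"
  by (simp_all add: hcontract_left_def hcontract_right_def)

lemma hcontract_left_htens: "hfunctional e \<Longrightarrow> hcontract_left e (htens v w) = hscl (e v) w"
  by (rule htens_eqI)
    (auto simp: hcontract_left_def hfunctional_scale intro!: hlinear_scale hlinear_id)

lemma hcontract_right_htens: "hfunctional e \<Longrightarrow> hcontract_right e (htens v w) = hscl (e w) v"
  by (rule htens_eqI)
    (auto simp: hcontract_right_def hfunctional_scale intro!: hlinear_scale hlinear_id)

section \<open>Tensor products of algebras\<close>

text \<open>Together with \<open>is_inverse_mult\<close>, the device for inverting identities: if
  \<open>p = q\<close>, then any two products that invert \<open>p\<close> and \<open>q\<close>
  agree. The identities for \<open>w\<close> and \<open>G\<close> arise in this way.\<close>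

lemma is_inverse_unique:
  assumes "monoid mul one" "is_inverse mul one x y" "is_inverse mul one x z"
  shows "y = z"
proof -
  interpret monoid mul one by fact
  have "y = mul y (mul x z)" using assms(3) by (simp add: is_inverse_def)
  also have "\<dots> = mul (mul y x) z" by (rule assoc[symmetric])
  also have "\<dots> = z" using assms(2) by (simp add: is_inverse_def)
  finally show ?thesis .
qed

lemma is_inverse_mult:
  assumes "monoid mul one" "is_inverse mul one x x'" "is_inverse mul one y y'"
  shows "is_inverse mul one (mul x y) (mul y' x')"
proof -
  interpret monoid mul one by fact
  have "mul (mul a b) (mul b' a') = one" if "mul a a' = one" "mul b b' = one" for a a' b b'
  proof -
    have "mul (mul a b) (mul b' a') = mul a (mul (mul b b') a')" by (simp only: assoc)
    then show ?thesis by (simp add: that)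
  qed
  then show ?thesis using assms(2,3) by (simp add: is_inverse_def)
qed

lemma is_inverse_sym: "is_inverse mul one x y \<Longrightarrow> is_inverse mul one y x"
  by (simp add: is_inverse_def)

lemma is_inverse_the:
  assumes "monoid mul one" "is_inverse mul one x y"
  shows "(THE y. is_inverse mul one x y) = y"
proof (rule the_equality)
  show "z = y" if "is_inverse mul one x z" for z
    by (rule is_inverse_unique[OF assms(1) that assms(2)])
qed (rule assms(2))

text \<open>The product is kept as a map on the tensor square so that \<open>prod_mult\<close> can
  be iterated; the triple tensor power is then an algebra by two applications of one lemma.\<close>

definition halgebra ::
  "(('x \<times> 'x \<Rightarrow>\<^sub>0 'k::field_char_0) fps \<Rightarrow> ('x \<Rightarrow>\<^sub>0 'k) fps) \<Rightarrow> ('x \<Rightarrow>\<^sub>0 'k) fps \<Rightarrow> bool" where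
  "halgebra m u \<longleftrightarrow> hlinear m \<and> monoid (\<lambda>x y. m (htens x y)) u"

lemma middle_swap_htens:
  "hmap (rename middle_swap) (htens (htens a b) (htens c d)) = htens (htens a c) (htens b d)"
proof (rule hbilinear_ext[of "\<lambda>a b. hmap (rename middle_swap) (htens (htens a b) (htens c d))"
      "\<lambda>a b. htens (htens a c) (htens b d)"], goal_cases)
  case (5 a b)
  show ?case
    by (rule hbilinear_ext[of "\<lambda>c d. hmap (rename middle_swap) (htens (htens (hbas a) (hbas b)) (htens c d))"
      "\<lambda>c d. htens (htens (hbas a) c) (htens (hbas b) d)"])
      (intro hlinear_intros | simp add: middle_swap_def)+
qed (intro hlinear_intros)+

lemma hlinear_prod_mult [simp]: "hlinear (prod_mult m n)"
  unfolding prod_mult_def comp_def by (rule hlinear_compose[OF hlinear_htmap hlinear_rename])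

lemma prod_mult_htens:
  assumes "hlinear m" "hlinear n"
  shows "prod_mult m n (htens (htens a b) (htens c d)) = htens (m (htens a c)) (n (htens b d))"
  by (simp add: prod_mult_def middle_swap_htens htmap_htens assms)

lemma hlinear_compose_htens:
  assumes "hlinear f"
  shows "hlinear (\<lambda>v. f (htens v w))" "hlinear (\<lambda>w. f (htens v w))"
  by (intro hlinear_compose[OF assms] htens_left htens_right)+

lemma htens_ext2:
  assumes "\<And>t. hlinear (\<lambda>s. F s t)" "\<And>s. hlinear (F s)"
    and "\<And>t. hlinear (\<lambda>s. G s t)" "\<And>s. hlinear (G s)"
    and "\<And>a b c d. F (htens a b) (htens c d) = G (htens a b) (htens c d)"
  shows "F s t = G s t"
proof (rule htens_ext[where F = "\<lambda>s. F s t" and G = "\<lambda>s. G s t"])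
  show "F (htens a b) t = G (htens a b) t" for a b
    by (rule htens_ext[of "F (htens a b)"]) (use assms in auto)
qed (use assms in auto)

lemma prod_mult_left: "hlinear f \<Longrightarrow> hlinear (\<lambda>x. prod_mult m n (htens (f x) t))"
  by (rule hlinear_compose[OF hlinear_compose_htens(1)[OF hlinear_prod_mult]])

lemma prod_mult_right: "hlinear f \<Longrightarrow> hlinear (\<lambda>x. prod_mult m n (htens t (f x)))"
  by (rule hlinear_compose[OF hlinear_compose_htens(2)[OF hlinear_prod_mult]])

lemma halgebra_prod_mult:
  assumes "halgebra m u" "halgebra n u'"
  shows "halgebra (prod_mult m n) (htens u u')"
proof -
  have lin: "hlinear m" "hlinear n" using assms by (auto simp: halgebra_def)
  interpret m: monoid "\<lambda>x y. m (htens x y)" u using assms by (simp add: halgebra_def)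
  interpret n: monoid "\<lambda>x y. n (htens x y)" u' using assms by (simp add: halgebra_def)
  note [simp] = prod_mult_htens[OF lin]
  let ?p = "\<lambda>s t. prod_mult m n (htens s t)"
  have "?p (?p s t) r = ?p s (?p t r)" for s t r
  proof (rule htens_ext[of "\<lambda>r. ?p (?p s t) r" "\<lambda>r. ?p s (?p t r)"])
    show "?p (?p s t) (htens e f) = ?p s (?p t (htens e f))" for e f
      by (rule htens_ext2[of "\<lambda>s t. ?p (?p s t) (htens e f)"
            "\<lambda>s t. ?p s (?p t (htens e f))"])
        (intro prod_mult_left prod_mult_right hlinear_id | simp add: m.assoc n.assoc)+
  qed (intro prod_mult_left prod_mult_right hlinear_id)+
  moreover have "?p (htens u u') t = t" for t
    by (rule htens_ext[of "\<lambda>t. ?p (htens u u') t" "\<lambda>t. t"]) (intro prod_mult_left prod_mult_right hlinear_id | simp)+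
  moreover have "?p t (htens u u') = t" for t
    by (rule htens_ext[of "\<lambda>t. ?p t (htens u u')" "\<lambda>t. t"]) (intro prod_mult_left prod_mult_right hlinear_id | simp)+
  ultimately show ?thesis by (simp add: halgebra_def monoid_def semigroup_def monoid_axioms_def)
qed

lemma unassoc_htens: "hmap (rename unassoc) (htens a (htens b c)) = htens (htens a b) c"
proof (rule hbilinear_ext[of "\<lambda>b c. hmap (rename unassoc) (htens a (htens b c))"
      "\<lambda>b c. htens (htens a b) c"], goal_cases)
  case (5 b c)
  show ?case
    by (rule hlinear_ext[of "\<lambda>a. hmap (rename unassoc) (htens a (htens (hbas b) (hbas c)))"
          "\<lambda>a. htens (htens a (hbas b)) (hbas c)"])
      (intro hlinear_intros | simp add: unassoc_def)+
qed (intro hlinear_intros)+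

lemma assoc_unassoc [simp]: "hmap (rename assoc) (hmap (rename unassoc) t) = t"
  by (rule hlinear_ext) (auto simp: hmap_rename_rename assoc_def unassoc_def case_prod_beta hlinear_id)

lemma unassoc_assoc [simp]: "hmap (rename unassoc) (hmap (rename assoc) t) = t"
  by (rule hlinear_ext) (auto simp: hmap_rename_rename assoc_def unassoc_def case_prod_beta hlinear_id)

locale bialg =
  fixes Q :: "('x, 'k::field_char_0) hbialg"
  assumes hbialgebra: "hbialgebra Q"
begin

abbreviation mul (infixl "\<odot>" 70) where "x \<odot> y \<equiv> hmul Q x y"
abbreviation mul2 (infixl "\<odot>\<^sub>2" 70) where "x \<odot>\<^sub>2 y \<equiv> hmul2 Q x y"
abbreviation mul3 (infixl "\<odot>\<^sub>3" 70) where "x \<odot>\<^sub>3 y \<equiv> hmul3 Q x y"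
abbreviation "one \<equiv> hunit Q"
abbreviation "\<Delta> \<equiv> hcomult Q"
abbreviation "\<epsilon> \<equiv> hcounit Q"

lemma hlinear_mult: "hlinear (hmult Q)" and hlinear_comult: "hlinear \<Delta>"
  and hfunctional_counit: "hfunctional \<epsilon>"
  using hbialgebra unfolding hbialgebra_def by blast+

lemma coassoc: "hmap (rename unassoc) (htmap (\<lambda>x. x) \<Delta> (\<Delta> x)) = htmap \<Delta> (\<lambda>x. x) (\<Delta> x)"
proof -
  have "hmap (rename assoc) (htmap \<Delta> (\<lambda>x. x) (\<Delta> x)) = htmap (\<lambda>x. x) \<Delta> (\<Delta> x)"
    using hbialgebra unfolding hbialgebra_def id_def by blast
  then show ?thesis by (metis unassoc_assoc)
qed

lemma counit_left: "hcontract_left \<epsilon> (\<Delta> x) = x"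
  and counit_right: "hcontract_right \<epsilon> (\<Delta> x) = x"
  and comult_mul: "\<Delta> (x \<odot> y) = \<Delta> x \<odot>\<^sub>2 \<Delta> y"
  and comult_one: "\<Delta> one = hunit2 Q"
  and counit_mul: "\<epsilon> (x \<odot> y) = \<epsilon> x * \<epsilon> y"
  and counit_one: "\<epsilon> one = 1"
  using hbialgebra unfolding hbialgebra_def by blast+

lemma halgebra1: "halgebra (hmult Q) one"
  using hbialgebra
  unfolding hbialgebra_def halgebra_def hmul_def monoid_def semigroup_def monoid_axioms_def by blast

lemma halgebra2: "halgebra (prod_mult (hmult Q) (hmult Q)) (hunit2 Q)"
  unfolding hunit2_def by (rule halgebra_prod_mult[OF halgebra1 halgebra1])

lemma halgebra3: "halgebra (prod_mult (prod_mult (hmult Q) (hmult Q)) (hmult Q)) (htens (hunit2 Q) one)"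
  by (rule halgebra_prod_mult[OF halgebra2 halgebra1])

sublocale m1: monoid "hmul Q" "hunit Q"
  using halgebra1 by (simp add: halgebra_def hmul_def[abs_def])

sublocale m2: monoid "hmul2 Q" "hunit2 Q"
  using halgebra2 by (simp add: halgebra_def hmul2_def[abs_def])

sublocale m3: monoid "hmul3 Q" "htens (hunit2 Q) (hunit Q)"
  using halgebra3 by (simp add: halgebra_def hmul3_def[abs_def])

lemma mul_left: "hlinear f \<Longrightarrow> hlinear (\<lambda>x. f x \<odot> y)"
  and mul_right: "hlinear f \<Longrightarrow> hlinear (\<lambda>x. y \<odot> f x)"
  unfolding hmul_def by (intro hlinear_compose[OF hlinear_mult] hlinear_intros; assumption)+

lemma mul2_left: "hlinear f \<Longrightarrow> hlinear (\<lambda>x. f x \<odot>\<^sub>2 y)"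
  and mul2_right: "hlinear f \<Longrightarrow> hlinear (\<lambda>x. y \<odot>\<^sub>2 f x)"
  unfolding hmul2_def by (intro hlinear_compose[OF hlinear_prod_mult] hlinear_intros; assumption)+

lemma mul3_left: "hlinear f \<Longrightarrow> hlinear (\<lambda>x. f x \<odot>\<^sub>3 y)"
  and mul3_right: "hlinear f \<Longrightarrow> hlinear (\<lambda>x. y \<odot>\<^sub>3 f x)"
  unfolding hmul3_def by (intro hlinear_compose[OF hlinear_prod_mult] hlinear_intros; assumption)+

lemma comult_lin: "hlinear f \<Longrightarrow> hlinear (\<lambda>x. \<Delta> (f x))"
  by (rule hlinear_compose[OF hlinear_comult])

lemma htmap_lin: "hlinear f \<Longrightarrow> hlinear (\<lambda>x. htmap p q (f x))"
  by (rule hlinear_compose[OF hlinear_htmap])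

lemmas lin_intros = hlinear_intros mul_left mul_right mul2_left mul2_right mul3_left mul3_right
  comult_lin htmap_lin

lemma mul2_htens: "htens a b \<odot>\<^sub>2 htens c d = htens (a \<odot> c) (b \<odot> d)"
  by (simp add: hmul2_def hmul_def prod_mult_htens hlinear_mult)

lemma mul3_htens: "htens s a \<odot>\<^sub>3 htens t b = htens (s \<odot>\<^sub>2 t) (a \<odot> b)"
  by (simp add: hmul3_def hmul2_def hmul_def prod_mult_htens hlinear_mult)

lemma htmap_mul2:
  assumes "hlinear f" "\<And>x y. f (x \<odot> y) = f x \<odot> f y"
  shows "htmap f f (s \<odot>\<^sub>2 t) = htmap f f s \<odot>\<^sub>2 htmap f f t"
  by (rule htens_ext2[of "\<lambda>s t. htmap f f (s \<odot>\<^sub>2 t)"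
        "\<lambda>s t. htmap f f s \<odot>\<^sub>2 htmap f f t"])
    (intro lin_intros | simp add: mul2_htens htmap_htens assms)+

lemma comult_id_mul: "htmap \<Delta> (\<lambda>x. x) (s \<odot>\<^sub>2 t) = htmap \<Delta> (\<lambda>x. x) s \<odot>\<^sub>3 htmap \<Delta> (\<lambda>x. x) t"
  by (rule htens_ext2[of "\<lambda>s t. htmap \<Delta> (\<lambda>x. x) (s \<odot>\<^sub>2 t)"
        "\<lambda>s t. htmap \<Delta> (\<lambda>x. x) s \<odot>\<^sub>3 htmap \<Delta> (\<lambda>x. x) t"])
    (intro lin_intros | simp add: mul2_htens mul3_htens htmap_htens hlinear_comult hlinear_id comult_mul)+

lemma unassoc_mul3:
  "hmap (rename unassoc) (htens a s) \<odot>\<^sub>3 hmap (rename unassoc) (htens b t)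
    = hmap (rename unassoc) (htens (a \<odot> b) (s \<odot>\<^sub>2 t))"
  by (rule htens_ext2[of "\<lambda>s t. hmap (rename unassoc) (htens a s) \<odot>\<^sub>3 hmap (rename unassoc) (htens b t)"
        "\<lambda>s t. hmap (rename unassoc) (htens (a \<odot> b) (s \<odot>\<^sub>2 t))"])
    (intro lin_intros | simp add: unassoc_htens mul2_htens mul3_htens)+

lemma id_comult_mul:
  "hmap (rename unassoc) (htmap (\<lambda>x. x) \<Delta> (s \<odot>\<^sub>2 t))
    = hmap (rename unassoc) (htmap (\<lambda>x. x) \<Delta> s) \<odot>\<^sub>3 hmap (rename unassoc) (htmap (\<lambda>x. x) \<Delta> t)"
  by (rule htens_ext2[of "\<lambda>s t. hmap (rename unassoc) (htmap (\<lambda>x. x) \<Delta> (s \<odot>\<^sub>2 t))"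
        "\<lambda>s t. hmap (rename unassoc) (htmap (\<lambda>x. x) \<Delta> s) \<odot>\<^sub>3 hmap (rename unassoc) (htmap (\<lambda>x. x) \<Delta> t)"])
    (intro lin_intros | simp add: mul2_htens unassoc_mul3 htmap_htens hlinear_comult hlinear_id comult_mul)+

lemma mul_hscl: "hscl c x \<odot> hscl d y = hscl (c * d) (x \<odot> y)"
  using hlinear_hscl[OF mul_left[OF hlinear_id], of c x "hscl d y"]
    hlinear_hscl[OF mul_right[OF hlinear_id], of x d y] by simp

lemma contract_left_mul: "hcontract_left \<epsilon> (s \<odot>\<^sub>2 t) = hcontract_left \<epsilon> s \<odot> hcontract_left \<epsilon> t"
proof (rule htens_ext2[of "\<lambda>s t. hcontract_left \<epsilon> (s \<odot>\<^sub>2 t)"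
        "\<lambda>s t. hcontract_left \<epsilon> s \<odot> hcontract_left \<epsilon> t"], goal_cases)
  case 5
  then show ?case
    by (simp add: mul2_htens hcontract_left_htens hfunctional_counit counit_mul mul_hscl)
qed (intro hlinear_compose[OF hlinear_contract(1)] lin_intros)+

lemma contract_right_mul: "hcontract_right \<epsilon> (s \<odot>\<^sub>2 t) = hcontract_right \<epsilon> s \<odot> hcontract_right \<epsilon> t"
proof (rule htens_ext2[of "\<lambda>s t. hcontract_right \<epsilon> (s \<odot>\<^sub>2 t)"
        "\<lambda>s t. hcontract_right \<epsilon> s \<odot> hcontract_right \<epsilon> t"], goal_cases)
  case 5
  then show ?case
    by (simp add: mul2_htens hcontract_right_htens hfunctional_counit counit_mul mul_hscl)
qed (intro hlinear_compose[OF hlinear_contract(2)] lin_intros)+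

lemma hinv_eqI: "is_inverse mul one x y \<Longrightarrow> hinv Q x = y"
  unfolding hinv_def by (rule is_inverse_the[OF m1.monoid_axioms])

lemma hinv2_eqI: "is_inverse mul2 (hunit2 Q) x y \<Longrightarrow> hinv2 Q x = y"
  unfolding hinv2_def by (rule is_inverse_the[OF m2.monoid_axioms])

end

section \<open>Twisted crossed products\<close>

text \<open>A cocycle crossed product: \<alpha> is an action up to the inner automorphisms given by
  \<open>v\<close>, and \<open>F g\<close> measures the failure of \<open>\<alpha> g\<close> to
  respect \<Delta>. The identities are stated with inverses cleared, so that they can be used by
  cancellation in the monoids \<open>Q\<close>, its square and its cube.\<close>

locale crossed = bialg Q for Q :: "('b multiset, 'k::field_char_0) hbialg" +
  fixes \<alpha> :: "'g::group_add \<Rightarrow> ('b multiset \<Rightarrow>\<^sub>0 'k) fps \<Rightarrow> ('b multiset \<Rightarrow>\<^sub>0 'k) fps"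
    and v w :: "'g \<Rightarrow> 'g \<Rightarrow> ('b multiset \<Rightarrow>\<^sub>0 'k) fps"
    and F G :: "'g \<Rightarrow> ('b multiset \<times> 'b multiset \<Rightarrow>\<^sub>0 'k) fps"
  assumes \<alpha>_lin: "hlinear (\<alpha> g)"
    and \<alpha>_mul: "\<alpha> g (x \<odot> y) = \<alpha> g x \<odot> \<alpha> g y"
    and \<alpha>_zero: "\<alpha> 0 x = x"
    and v_inv: "is_inverse mul one (v g h) (w g h)"
    and F_inv: "is_inverse mul2 (hunit2 Q) (F g) (G g)"
    and \<alpha>_add: "\<alpha> (g + h) x \<odot> v g h = v g h \<odot> \<alpha> g (\<alpha> h x)"
    and v_cocycle: "v (g + h) k \<odot> v g h = v g (h + k) \<odot> \<alpha> g (v h k)"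
    and v_zero: "v 0 g = one" "v g 0 = one"
    and \<alpha>_comult: "htmap (\<alpha> g) (\<alpha> g) (\<Delta> x) \<odot>\<^sub>2 F g = F g \<odot>\<^sub>2 \<Delta> (\<alpha> g x)"
    and F_twist: "htens (F g) one \<odot>\<^sub>3 htmap \<Delta> (\<lambda>x. x) (F g) =
      hmap (rename unassoc) (htens one (F g)) \<odot>\<^sub>3 hmap (rename unassoc) (htmap (\<lambda>x. x) \<Delta> (F g))"
    and F_counit: "hcontract_left \<epsilon> (F g) = one" "hcontract_right \<epsilon> (F g) = one"
    and F_zero: "F 0 = hunit2 Q"
    and F_add: "F (g + h) \<odot>\<^sub>2 \<Delta> (v g h) =
      htens (v g h) (v g h) \<odot>\<^sub>2 htmap (\<alpha> g) (\<alpha> g) (F h) \<odot>\<^sub>2 F g"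
begin

definition A :: "('b multiset \<times> 'g, 'k) hbialg" where
  "A = \<lparr>hmult = hlext (\<lambda>((M, g), (N, h)). at_group (g + h) (hbas M \<odot> \<alpha> g (hbas N) \<odot> w g h)),
     hunit = at_group 0 one,
     hcomult = hlext (\<lambda>(M, g). at_group2 g g (\<Delta> (hbas M) \<odot>\<^sub>2 G g)),
     hcounit = hfext (\<lambda>(M, g). \<epsilon> (hbas M))\<rparr>"

section \<open>Bijectivity of \<alpha>, counits, and the identities for the inverses
  \<open>w\<close> and \<open>G\<close>\<close>

lemma vw: "v g h \<odot> w g h = one" "w g h \<odot> v g h = one"
  using v_inv by (auto simp: is_inverse_def)

lemma FG: "F g \<odot>\<^sub>2 G g = hunit2 Q" "G g \<odot>\<^sub>2 F g = hunit2 Q"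
  using F_inv by (auto simp: is_inverse_def)

text \<open>The case \<open>h = - g\<close> of \<open>\<alpha>_add\<close>: although \<alpha> is not
  an action, \<open>\<alpha> g\<close> composed with \<open>\<alpha> (- g)\<close> is inner, hence
  invertible. Injectivity and surjectivity follow.\<close>

lemma \<alpha>_conj: "x \<odot> v g (- g) = v g (- g) \<odot> \<alpha> g (\<alpha> (- g) x)"
  using \<alpha>_add[of g "- g" x] by (simp add: \<alpha>_zero)

lemma \<alpha>_inj: "\<alpha> g x = \<alpha> g y \<Longrightarrow> x = y"
proof -
  assume eq: "\<alpha> g x = \<alpha> g y"
  have "x \<odot> v (- g) g = y \<odot> v (- g) g"
    using \<alpha>_conj[of x "- g"] \<alpha>_conj[of y "- g"] eq by simp
  then have "x \<odot> v (- g) g \<odot> w (- g) g = y \<odot> v (- g) g \<odot> w (- g) g" by simp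
  then show "x = y" by (simp add: m1.assoc vw)
qed

lemma \<alpha>_surj: "\<exists>x. \<alpha> g x = y"
proof
  let ?v = "v g (- g)" and ?w = "w g (- g)"
  \<comment> \<open>\<open>y\<close> is conjugated by \<open>v\<close> beforehand to compensate for
    the conjugation hidden in \<open>\<alpha> g (\<alpha> (- g) ?x)\<close>.\<close>
  let ?x = "?v \<odot> y \<odot> ?w"
  have "y = ?w \<odot> (?x \<odot> ?v)"
    by (simp add: m1.assoc vw) (simp add: m1.assoc[symmetric] vw)
  also have "\<dots> = ?w \<odot> (?v \<odot> \<alpha> g (\<alpha> (- g) ?x))"
    by (simp only: \<alpha>_conj)
  also have "\<dots> = \<alpha> g (\<alpha> (- g) ?x)"
    by (simp only: m1.assoc[symmetric] vw m1.left_neutral)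
  finally show "\<alpha> g (\<alpha> (- g) ?x) = y" by (rule sym)
qed

text \<open>A surjective multiplicative map preserves the unit: its value at one is a left unit for
  its whole image.\<close>

lemma \<alpha>_one: "\<alpha> g one = one"
proof -
  obtain z where z: "\<alpha> g z = one" using \<alpha>_surj by blast
  have "\<alpha> g one = \<alpha> g one \<odot> \<alpha> g z" by (simp add: z)
  also have "\<dots> = \<alpha> g z" by (simp flip: \<alpha>_mul)
  finally show ?thesis by (simp add: z)
qed

lemma contract_htmap:
  assumes "hlinear f" "hlinear f'"
  shows "hcontract_left \<epsilon> (htmap f f' t) = f' (hcontract_left (\<lambda>x. \<epsilon> (f x)) t)"
proof (rule htens_ext[of "\<lambda>t. hcontract_left \<epsilon> (htmap f f' t)"
      "\<lambda>t. f' (hcontract_left (\<lambda>x. \<epsilon> (f x)) t)"])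
  show "hcontract_left \<epsilon> (htmap f f' (htens a b)) = f' (hcontract_left (\<lambda>x. \<epsilon> (f x)) (htens a b))" for a b
    by (simp add: htmap_htens assms hcontract_left_htens hfunctional_counit
        hfunctional_compose hlinear_hscl)
qed (intro hlinear_compose[OF hlinear_contract(1)] hlinear_compose[OF assms(2)] htmap_lin hlinear_id
    | simp)+

text \<open>Both sides are \<open>e \<otimes> e'\<close> applied to \<open>t\<close>.\<close>

lemma counit_contract:
  assumes "hfunctional e" "hfunctional e'"
  shows "e' (hcontract_left e t) = e (hcontract_right e' t)"
proof (rule hfunctional_ext[of "\<lambda>t. e' (hcontract_left e t)" "\<lambda>t. e (hcontract_right e' t)"])
  show "e' (hcontract_left e (hbas x)) = e (hcontract_right e' (hbas x))" for x
    using hcontract_left_htens[OF assms(1), of "hbas (fst x)" "hbas (snd x)"]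
      hcontract_right_htens[OF assms(2), of "hbas (fst x)" "hbas (snd x)"]
    by (simp add: hfunctional_hscl[OF assms(1)] hfunctional_hscl[OF assms(2)])
qed (intro hfunctional_compose[OF assms(1)] hfunctional_compose[OF assms(2)] hlinear_contract)+

text \<open>Uniqueness of the counit. Applying \<open>\<epsilon> \<otimes> id\<close> to
  \<open>\<alpha>_comult\<close> removes \<open>F\<close>, and injectivity of
  \<open>\<alpha> g\<close> then shows that \<epsilon> composed with \<open>\<alpha> g\<close> is a
  left counit; it is compared with the right counit \<epsilon>.\<close>

lemma counit_\<alpha>: "\<epsilon> (\<alpha> g x) = \<epsilon> x"
proof -
  let ?e = "\<lambda>x. \<epsilon> (\<alpha> g x)"
  have e: "hfunctional ?e" by (rule hfunctional_compose[OF hfunctional_counit \<alpha>_lin])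
  have "\<alpha> g (hcontract_left ?e (\<Delta> x)) = \<alpha> g x"
    using arg_cong[OF \<alpha>_comult[of g x], of "hcontract_left \<epsilon>"]
    by (simp add: contract_left_mul F_counit contract_htmap \<alpha>_lin counit_left)
  then have "hcontract_left ?e (\<Delta> x) = x" by (rule \<alpha>_inj)
  then have "\<epsilon> x = \<epsilon> (hcontract_left ?e (\<Delta> x))" by simp
  also have "\<dots> = \<epsilon> (\<alpha> g x)"
    by (simp add: counit_contract[OF e hfunctional_counit] counit_right)
  finally show ?thesis by simp
qed

text \<open>Applying \<open>\<epsilon> \<otimes> id\<close> to \<open>F_add\<close> leaves
  \<open>v = \<epsilon>(v) v\<close>, and the invertible factor \<open>v\<close> cancels.\<close>

lemma counit_v: "\<epsilon> (v g h) = 1"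
proof -
  have "v g h = hscl (\<epsilon> (v g h)) (v g h)"
    using arg_cong[OF F_add[of g h], of "hcontract_left \<epsilon>"]
    by (simp add: contract_left_mul F_counit contract_htmap \<alpha>_lin counit_left counit_\<alpha> \<alpha>_one
        hcontract_left_htens hfunctional_counit)
  then have "v g h \<odot> w g h = hscl (\<epsilon> (v g h)) (v g h) \<odot> w g h" by simp
  then have "one = hscl (\<epsilon> (v g h)) one"
    by (simp add: vw hlinear_hscl[OF mul_left[OF hlinear_id]])
  then have "\<epsilon> one = \<epsilon> (hscl (\<epsilon> (v g h)) one)" by simp
  then show ?thesis by (simp add: hfunctional_hscl[OF hfunctional_counit] counit_one)
qed

lemma counit_w: "\<epsilon> (w g h) = 1"
  using arg_cong[OF vw(1)[of g h], of \<epsilon>] by (simp add: counit_mul counit_v counit_one)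

lemma w_zero: "w 0 g = one" "w g 0 = one"
  using vw(1)[of 0 g] vw(1)[of g 0] by (simp_all add: v_zero)

lemma G_zero: "G 0 = hunit2 Q"
  using FG(1)[of 0] by (simp add: F_zero)

lemma G_counit: "hcontract_left \<epsilon> (G g) = one" "hcontract_right \<epsilon> (G g) = one"
  using arg_cong[OF FG(1)[of g], of "hcontract_left \<epsilon>"]
    arg_cong[OF FG(1)[of g], of "hcontract_right \<epsilon>"]
  by (simp_all add: contract_left_mul contract_right_mul F_counit hunit2_def counit_one
      hcontract_left_htens hcontract_right_htens hfunctional_counit)

lemma w_\<alpha>: "w g h \<odot> \<alpha> (g + h) x = \<alpha> g (\<alpha> h x) \<odot> w g h"
proof -
  have "w g h \<odot> (\<alpha> (g + h) x \<odot> v g h) \<odot> w g h = w g h \<odot> (v g h \<odot> \<alpha> g (\<alpha> h x)) \<odot> w g h"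
    by (simp only: \<alpha>_add)
  moreover have "w g h \<odot> (v g h \<odot> \<alpha> g (\<alpha> h x)) = \<alpha> g (\<alpha> h x)"
    by (simp add: m1.assoc[symmetric] vw)
  moreover have "w g h \<odot> (\<alpha> (g + h) x \<odot> v g h) \<odot> w g h = w g h \<odot> \<alpha> (g + h) x"
    by (simp add: m1.assoc vw)
  ultimately show ?thesis by simp
qed

lemma w_cocycle: "w g h \<odot> w (g + h) k = \<alpha> g (w h k) \<odot> w g (h + k)"
proof (rule is_inverse_unique[OF m1.monoid_axioms])
  have "is_inverse mul one (\<alpha> g (v h k)) (\<alpha> g (w h k))"
    by (simp add: is_inverse_def vw \<alpha>_one flip: \<alpha>_mul)
  \<comment> \<open>Both sides of the claim invert the two equal sides of
    \<open>v_cocycle\<close>.\<close>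
  then show "is_inverse mul one (v (g + h) k \<odot> v g h) (\<alpha> g (w h k) \<odot> w g (h + k))"
    unfolding v_cocycle by (intro is_inverse_mult[OF m1.monoid_axioms] v_inv)
qed (intro is_inverse_mult[OF m1.monoid_axioms] v_inv)

text \<open>The twist equation for \<open>F\<close>, inverted in the triple tensor power: each of
  its four factors has an inverse because the maps that produce it from \<open>F\<close> are
  multiplicative and unital.\<close>

lemma G_twist: "htmap \<Delta> (\<lambda>x. x) (G g) \<odot>\<^sub>3 htens (G g) one =
    hmap (rename unassoc) (htmap (\<lambda>x. x) \<Delta> (G g)) \<odot>\<^sub>3 hmap (rename unassoc) (htens one (G g))"
proof (rule is_inverse_unique[OF m3.monoid_axioms])
  let ?one = "htens (hunit2 Q) one"
  let ?R = "\<lambda>t. hmap (rename unassoc) (htmap (\<lambda>x. x) \<Delta> t)"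
  let ?L = "htmap \<Delta> (\<lambda>x. x)"
  have L1: "?L (hunit2 Q) = ?one"
    by (simp add: hunit2_def htmap_htens hlinear_comult hlinear_id comult_one)
  have R1: "?R (hunit2 Q) = ?one"
    by (simp add: hunit2_def htmap_htens hlinear_comult hlinear_id comult_one unassoc_htens)
  have U1: "hmap (rename unassoc) (htens one (hunit2 Q)) = ?one"
    by (simp add: hunit2_def unassoc_htens)
  have 1: "is_inverse mul3 ?one (htens (F g) one) (htens (G g) one)"
    by (simp add: is_inverse_def mul3_htens FG)
  have 2: "is_inverse mul3 ?one (?L (F g)) (?L (G g))"
    by (simp add: is_inverse_def FG L1 flip: comult_id_mul)
  have 3: "is_inverse mul3 ?one (hmap (rename unassoc) (htens one (F g))) (hmap (rename unassoc) (htens one (G g)))"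
    by (simp add: is_inverse_def unassoc_mul3 FG U1)
  have 4: "is_inverse mul3 ?one (?R (F g)) (?R (G g))"
    by (simp add: is_inverse_def FG R1 flip: id_comult_mul)
  show "is_inverse mul3 ?one (htens (F g) one \<odot>\<^sub>3 ?L (F g)) (?L (G g) \<odot>\<^sub>3 htens (G g) one)"
    by (rule is_inverse_mult[OF m3.monoid_axioms 1 2])
  show "is_inverse mul3 ?one (htens (F g) one \<odot>\<^sub>3 ?L (F g))
      (?R (G g) \<odot>\<^sub>3 hmap (rename unassoc) (htens one (G g)))"
    unfolding F_twist by (rule is_inverse_mult[OF m3.monoid_axioms 3 4])
qed

text \<open>\<open>F_add\<close> is inverted and the resulting factor
  \<open>\<Delta> (w g h)\<close> is moved to the other side as \<open>\<Delta> (v g h)\<close>.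
  This form lets it cancel against \<open>\<Delta> (w g h)\<close> when \<Delta> is shown to be
  multiplicative on \<open>A\<close>.\<close>

lemma G_add: "G (g + h) = \<Delta> (v g h) \<odot>\<^sub>2 (G g \<odot>\<^sub>2 htmap (\<alpha> g) (\<alpha> g) (G h) \<odot>\<^sub>2 htens (w g h) (w g h))"
proof -
  let ?vv = "htens (v g h) (v g h)" and ?ww = "htens (w g h) (w g h)"
  let ?\<alpha>2 = "htmap (\<alpha> g) (\<alpha> g)"
  have \<alpha>2: "?\<alpha>2 (s \<odot>\<^sub>2 t) = ?\<alpha>2 s \<odot>\<^sub>2 ?\<alpha>2 t" for s t
    by (rule htmap_mul2[OF \<alpha>_lin \<alpha>_mul])
  have \<alpha>2_one: "?\<alpha>2 (hunit2 Q) = hunit2 Q"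
    by (simp add: hunit2_def htmap_htens \<alpha>_lin \<alpha>_one)
  have 1: "is_inverse mul2 (hunit2 Q) ?vv ?ww"
    by (simp add: is_inverse_def mul2_htens vw hunit2_def)
  have 2: "is_inverse mul2 (hunit2 Q) (?\<alpha>2 (F h)) (?\<alpha>2 (G h))"
    by (simp add: is_inverse_def FG \<alpha>2_one flip: \<alpha>2)
  have "is_inverse mul2 (hunit2 Q) (F (g + h) \<odot>\<^sub>2 \<Delta> (v g h)) (G g \<odot>\<^sub>2 (?\<alpha>2 (G h) \<odot>\<^sub>2 ?ww))"
    unfolding F_add by (intro is_inverse_mult[OF m2.monoid_axioms] 1 2 F_inv)
  moreover have "is_inverse mul2 (hunit2 Q) (F (g + h) \<odot>\<^sub>2 \<Delta> (v g h)) (\<Delta> (w g h) \<odot>\<^sub>2 G (g + h))"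
    by (intro is_inverse_mult[OF m2.monoid_axioms] F_inv)
      (simp add: is_inverse_def vw comult_one flip: comult_mul)
  ultimately have "G g \<odot>\<^sub>2 (?\<alpha>2 (G h) \<odot>\<^sub>2 ?ww) = \<Delta> (w g h) \<odot>\<^sub>2 G (g + h)"
    by (rule is_inverse_unique[OF m2.monoid_axioms])
  then have "\<Delta> (v g h) \<odot>\<^sub>2 (G g \<odot>\<^sub>2 ?\<alpha>2 (G h) \<odot>\<^sub>2 ?ww) = \<Delta> (v g h) \<odot>\<^sub>2 \<Delta> (w g h) \<odot>\<^sub>2 G (g + h)"
    by (simp add: m2.assoc)
  also have "\<Delta> (v g h) \<odot>\<^sub>2 \<Delta> (w g h) = hunit2 Q"
    by (simp add: vw comult_one flip: comult_mul)
  finally show ?thesis by simp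
qed

section \<open>Structure maps of the crossed product on homogeneous elements\<close>

lemma at_group_lin: "hlinear f \<Longrightarrow> hlinear (\<lambda>x. at_group g (f x))"
  unfolding at_group_def by (rule hlinear_compose[OF hlinear_rename])

lemma at_group2_lin: "hlinear f \<Longrightarrow> hlinear (\<lambda>x. at_group2 g h (f x))"
  unfolding at_group2_def by (rule hlinear_compose[OF hlinear_rename])

lemma \<alpha>_lin': "hlinear f \<Longrightarrow> hlinear (\<lambda>x. \<alpha> g (f x))"
  by (rule hlinear_compose[OF \<alpha>_lin])

lemma at_group_hbas: "at_group g (hbas M) = hbas (M, g)"
  by (simp add: at_group_def)

lemma at_group2_hbas: "at_group2 g h (hbas (M, N)) = hbas ((M, g), (N, h))"
  by (simp add: at_group2_def)

lemma at_group_ext: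
  assumes "hlinear f" "hlinear f'" "\<And>g x. f (at_group g x) = f' (at_group g x)"
  shows "f a = f' a"
  using assms(1,2)
proof (rule hlinear_ext)
  show "f (hbas x) = f' (hbas x)" for x
    using assms(3)[of "snd x" "hbas (fst x)"] by (simp add: at_group_hbas)
qed

lemma htens_at_group: "htens (at_group g x) (at_group h y) = at_group2 g h (htens x y)"
  by (rule hbilinear_ext[of "\<lambda>x y. htens (at_group g x) (at_group h y)"
        "\<lambda>x y. at_group2 g h (htens x y)"])
    (intro hlinear_intros at_group_lin at_group2_lin | simp add: at_group_hbas at_group2_hbas)+

lemma hlinear_A_mult: "hlinear (hmult A)" and hlinear_A_comult: "hlinear (hcomult A)"
  and hfunctional_A_counit: "hfunctional (hcounit A)"
  by (simp_all add: A_def)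

lemma A_mult: "hmul A (at_group g x) (at_group h y) = at_group (g + h) (x \<odot> \<alpha> g y \<odot> w g h)"
  by (rule hbilinear_ext[of "\<lambda>x y. hmul A (at_group g x) (at_group h y)"
        "\<lambda>x y. at_group (g + h) (x \<odot> \<alpha> g y \<odot> w g h)"])
    (unfold hmul_def[of A], (intro lin_intros at_group_lin \<alpha>_lin' hlinear_compose[OF hlinear_A_mult]
      | simp add: at_group_hbas A_def)+)

lemma A_comult: "hcomult A (at_group g x) = at_group2 g g (\<Delta> x \<odot>\<^sub>2 G g)"
  by (rule hlinear_ext[of "\<lambda>x. hcomult A (at_group g x)" "\<lambda>x. at_group2 g g (\<Delta> x \<odot>\<^sub>2 G g)"])
    (intro lin_intros at_group_lin at_group2_lin hlinear_compose[OF hlinear_A_comult]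
      | simp add: at_group_hbas A_def)+

lemma A_counit: "hcounit A (at_group g x) = \<epsilon> x"
  by (rule hfunctional_ext[of "\<lambda>x. hcounit A (at_group g x)" \<epsilon>])
    (intro hfunctional_compose[OF hfunctional_A_counit] hfunctional_counit at_group_lin hlinear_id
      | simp add: at_group_hbas A_def)+

lemma A_unit: "hunit A = at_group 0 one"
  by (simp add: A_def)

text \<open>One label suffices for three legs, because the coproduct of \<open>A\<close> is diagonal
  in the group.\<close>

definition at_group3 ::
  "'g \<Rightarrow> (('b multiset \<times> 'b multiset) \<times> 'b multiset \<Rightarrow>\<^sub>0 'k) fps \<Rightarrow>
    ((('b multiset \<times> 'g) \<times> ('b multiset \<times> 'g)) \<times> ('b multiset \<times> 'g) \<Rightarrow>\<^sub>0 'k) fps" where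
  "at_group3 g = hmap (rename (\<lambda>((M, N), K). (((M, g), (N, g)), (K, g))))"

lemma at_group3_lin: "hlinear f \<Longrightarrow> hlinear (\<lambda>x. at_group3 g (f x))"
  unfolding at_group3_def by (rule hlinear_compose[OF hlinear_rename])

lemma htens_at_group2_left: "htens (at_group2 g g s) (at_group g c) = at_group3 g (htens s c)"
proof (rule htens_ext[of "\<lambda>s. htens (at_group2 g g s) (at_group g c)" "\<lambda>s. at_group3 g (htens s c)"])
  fix a b
  show "htens (at_group2 g g (htens a b)) (at_group g c) = at_group3 g (htens (htens a b) c)"
  proof (rule hbilinear_ext[of "\<lambda>a b. htens (at_group2 g g (htens a b)) (at_group g c)"
        "\<lambda>a b. at_group3 g (htens (htens a b) c)"])
    show "htens (at_group2 g g (htens (hbas M) (hbas N))) (at_group g c) =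
        at_group3 g (htens (htens (hbas M) (hbas N)) c)" for M N
      by (rule hlinear_ext[of "\<lambda>c. htens (at_group2 g g (htens (hbas M) (hbas N))) (at_group g c)"
            "\<lambda>c. at_group3 g (htens (htens (hbas M) (hbas N)) c)"])
        (intro lin_intros at_group_lin at_group3_lin
          | simp add: at_group_hbas at_group2_hbas at_group3_def)+
  qed (intro lin_intros at_group_lin at_group2_lin at_group3_lin)+
qed (intro lin_intros at_group2_lin at_group3_lin)+

lemma htens_at_group2_right:
  "hmap (rename unassoc) (htens (at_group g a) (at_group2 g g t)) =
    at_group3 g (hmap (rename unassoc) (htens a t))"
  by (rule htens_ext[of "\<lambda>t. hmap (rename unassoc) (htens (at_group g a) (at_group2 g g t))"
        "\<lambda>t. at_group3 g (hmap (rename unassoc) (htens a t))"])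
    (intro lin_intros at_group2_lin at_group3_lin
      | simp add: unassoc_htens flip: htens_at_group htens_at_group2_left)+

lemma A_mul2: "hmul2 A (at_group2 g g s) (at_group2 h h t) =
    at_group2 (g + h) (g + h) (s \<odot>\<^sub>2 htmap (\<alpha> g) (\<alpha> g) t \<odot>\<^sub>2 htens (w g h) (w g h))"
proof (rule htens_ext2[of "\<lambda>s t. hmul2 A (at_group2 g g s) (at_group2 h h t)"
      "\<lambda>s t. at_group2 (g + h) (g + h) (s \<odot>\<^sub>2 htmap (\<alpha> g) (\<alpha> g) t \<odot>\<^sub>2 htens (w g h) (w g h))"], goal_cases)
  case (5 a b c d)
  have "hmul2 A (at_group2 g g (htens a b)) (at_group2 h h (htens c d)) =
      htens (hmul A (at_group g a) (at_group h c)) (hmul A (at_group g b) (at_group h d))"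
    by (simp add: hmul2_def hmul_def prod_mult_htens hlinear_A_mult flip: htens_at_group)
  then show ?case
    by (simp add: A_mult htens_at_group mul2_htens htmap_htens \<alpha>_lin)
qed (unfold hmul2_def[of A], (intro lin_intros at_group2_lin prod_mult_left prod_mult_right)+)

lemma A_comult_left: "htmap (hcomult A) (\<lambda>x. x) (at_group2 g g s) =
    at_group3 g (htmap \<Delta> (\<lambda>x. x) s \<odot>\<^sub>3 htens (G g) one)"
  by (rule htens_ext[of "\<lambda>s. htmap (hcomult A) (\<lambda>x. x) (at_group2 g g s)"
        "\<lambda>s. at_group3 g (htmap \<Delta> (\<lambda>x. x) s \<odot>\<^sub>3 htens (G g) one)"])
    (intro lin_intros at_group2_lin at_group3_lin
      | simp add: htmap_htens hlinear_A_comult hlinear_comult hlinear_id mul3_htens A_comult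
          htens_at_group2_left flip: htens_at_group)+

lemma A_comult_right: "hmap (rename unassoc) (htmap (\<lambda>x. x) (hcomult A) (at_group2 g g s)) =
    at_group3 g (hmap (rename unassoc) (htmap (\<lambda>x. x) \<Delta> s) \<odot>\<^sub>3 hmap (rename unassoc) (htens one (G g)))"
  by (rule htens_ext[of "\<lambda>s. hmap (rename unassoc) (htmap (\<lambda>x. x) (hcomult A) (at_group2 g g s))"
        "\<lambda>s. at_group3 g (hmap (rename unassoc) (htmap (\<lambda>x. x) \<Delta> s) \<odot>\<^sub>3 hmap (rename unassoc) (htens one (G g)))"])
    (intro lin_intros at_group2_lin at_group3_lin
      | simp add: htmap_htens hlinear_A_comult hlinear_comult hlinear_id unassoc_mul3 A_comult
          htens_at_group2_right flip: htens_at_group)+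

text \<open>In degree \<open>g\<close> the coproduct is \<Delta> times \<open>G g\<close> on the
  right, so both sides are the common iterated coproduct times the two sides of
  \<open>G_twist\<close>.\<close>

lemma A_coassoc: "htmap (hcomult A) (\<lambda>x. x) (hcomult A a) =
    hmap (rename unassoc) (htmap (\<lambda>x. x) (hcomult A) (hcomult A a))"
proof (rule at_group_ext[of "\<lambda>a. htmap (hcomult A) (\<lambda>x. x) (hcomult A a)"
      "\<lambda>a. hmap (rename unassoc) (htmap (\<lambda>x. x) (hcomult A) (hcomult A a))"])
  show "htmap (hcomult A) (\<lambda>x. x) (hcomult A (at_group g x)) =
    hmap (rename unassoc) (htmap (\<lambda>x. x) (hcomult A) (hcomult A (at_group g x)))" for g x
    by (simp add: A_comult A_comult_left A_comult_right comult_id_mul id_comult_mul coassoc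
        m3.assoc G_twist)
qed (intro hlinear_compose[OF hlinear_htmap] hlinear_compose[OF hlinear_rename] hlinear_A_comult)+

text \<open>Three facts combine: \<open>G_add\<close> cancels the coproduct of \<open>w\<close>,
  \<open>\<alpha>_comult\<close> moves \<open>G g\<close> past the coproduct of
  \<open>\<alpha> g y\<close>, and \<open>\<alpha> g \<otimes> \<alpha> g\<close> is
  multiplicative.\<close>

lemma A_comult_mul: "hcomult A (hmul A a b) = hmul2 A (hcomult A a) (hcomult A b)"
proof (rule at_group_ext[of "\<lambda>a. hcomult A (hmul A a b)" "\<lambda>a. hmul2 A (hcomult A a) (hcomult A b)"])
  fix g x
  show "hcomult A (hmul A (at_group g x) b) = hmul2 A (hcomult A (at_group g x)) (hcomult A b)"
  proof (rule at_group_ext[of "\<lambda>b. hcomult A (hmul A (at_group g x) b)"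
        "\<lambda>b. hmul2 A (hcomult A (at_group g x)) (hcomult A b)"])
    fix h y
    let ?\<alpha>2 = "htmap (\<alpha> g) (\<alpha> g)" and ?ww = "htens (w g h) (w g h)"
    have \<alpha>2: "?\<alpha>2 (s \<odot>\<^sub>2 t) = ?\<alpha>2 s \<odot>\<^sub>2 ?\<alpha>2 t" for s t
      by (rule htmap_mul2[OF \<alpha>_lin \<alpha>_mul])
    \<comment> \<open>\<open>\<alpha>_comult\<close> multiplied by \<open>G g\<close> on both sides,
      the form suited to the coproduct of \<open>A\<close>.\<close>
    have *: "\<Delta> (\<alpha> g y) \<odot>\<^sub>2 G g = G g \<odot>\<^sub>2 ?\<alpha>2 (\<Delta> y)"
    proof -
      have "G g \<odot>\<^sub>2 (?\<alpha>2 (\<Delta> y) \<odot>\<^sub>2 F g) \<odot>\<^sub>2 G g = G g \<odot>\<^sub>2 (F g \<odot>\<^sub>2 \<Delta> (\<alpha> g y)) \<odot>\<^sub>2 G g"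
        by (simp only: \<alpha>_comult)
      moreover have "G g \<odot>\<^sub>2 (F g \<odot>\<^sub>2 \<Delta> (\<alpha> g y)) = \<Delta> (\<alpha> g y)"
        by (simp add: m2.assoc[symmetric] FG)
      ultimately show ?thesis by (simp add: m2.assoc FG)
    qed
    have "\<Delta> (x \<odot> \<alpha> g y \<odot> w g h) \<odot>\<^sub>2 G (g + h) =
        \<Delta> x \<odot>\<^sub>2 \<Delta> (\<alpha> g y) \<odot>\<^sub>2 (\<Delta> (w g h) \<odot>\<^sub>2 \<Delta> (v g h)) \<odot>\<^sub>2 (G g \<odot>\<^sub>2 ?\<alpha>2 (G h) \<odot>\<^sub>2 ?ww)"
      by (simp add: comult_mul G_add m2.assoc)
    also have "\<Delta> (w g h) \<odot>\<^sub>2 \<Delta> (v g h) = hunit2 Q"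
      by (simp add: vw comult_one flip: comult_mul)
    also have "\<Delta> x \<odot>\<^sub>2 \<Delta> (\<alpha> g y) \<odot>\<^sub>2 hunit2 Q \<odot>\<^sub>2 (G g \<odot>\<^sub>2 ?\<alpha>2 (G h) \<odot>\<^sub>2 ?ww) =
        \<Delta> x \<odot>\<^sub>2 (\<Delta> (\<alpha> g y) \<odot>\<^sub>2 G g) \<odot>\<^sub>2 (?\<alpha>2 (G h) \<odot>\<^sub>2 ?ww)"
      by (simp add: m2.assoc)
    also have "\<dots> = (\<Delta> x \<odot>\<^sub>2 G g) \<odot>\<^sub>2 ?\<alpha>2 (\<Delta> y \<odot>\<^sub>2 G h) \<odot>\<^sub>2 ?ww"
      by (simp add: * \<alpha>2 m2.assoc)
    finally show "hcomult A (hmul A (at_group g x) (at_group h y)) =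
        hmul2 A (hcomult A (at_group g x)) (hcomult A (at_group h y))"
      by (simp add: A_comult A_mult A_mul2)
  qed (unfold hmul2_def hmul_def, (intro hlinear_compose[OF hlinear_A_comult]
      hlinear_compose[OF hlinear_A_mult] prod_mult_right htens_right hlinear_A_comult)+)
qed (unfold hmul2_def hmul_def, (intro hlinear_compose[OF hlinear_A_comult]
      hlinear_compose[OF hlinear_A_mult] prod_mult_left htens_left hlinear_A_comult)+)

text \<open>\<open>w_\<alpha>\<close> moves the middle cocycle factor past the third argument, and
  \<open>w_cocycle\<close> then merges the two cocycle factors.\<close>

lemma A_assoc: "hmul A (hmul A a b) c = hmul A a (hmul A b c)"
proof -
  have lin: "hlinear (\<lambda>x. hmul A (f x) y)" "hlinear (\<lambda>x. hmul A y (f x))" if "hlinear f"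
    for f :: "('b multiset \<times> 'g \<Rightarrow>\<^sub>0 'k) fps \<Rightarrow> ('b multiset \<times> 'g \<Rightarrow>\<^sub>0 'k) fps" and y
    unfolding hmul_def
    by (intro hlinear_compose[OF hlinear_A_mult] hlinear_compose[OF htens_left]
        hlinear_compose[OF htens_right] that)+
  show ?thesis
  proof (rule at_group_ext[of "\<lambda>a. hmul A (hmul A a b) c" "\<lambda>a. hmul A a (hmul A b c)"])
    fix g x
    show "hmul A (hmul A (at_group g x) b) c = hmul A (at_group g x) (hmul A b c)"
    proof (rule at_group_ext[of "\<lambda>b. hmul A (hmul A (at_group g x) b) c"
          "\<lambda>b. hmul A (at_group g x) (hmul A b c)"])
      fix h y
      show "hmul A (hmul A (at_group g x) (at_group h y)) c = hmul A (at_group g x) (hmul A (at_group h y) c)"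
      proof (rule at_group_ext[of "\<lambda>c. hmul A (hmul A (at_group g x) (at_group h y)) c"
            "\<lambda>c. hmul A (at_group g x) (hmul A (at_group h y) c)"])
        fix k z
        have "x \<odot> \<alpha> g y \<odot> w g h \<odot> \<alpha> (g + h) z \<odot> w (g + h) k =
            x \<odot> \<alpha> g y \<odot> (w g h \<odot> \<alpha> (g + h) z) \<odot> w (g + h) k" by (simp add: m1.assoc)
        also have "\<dots> = x \<odot> \<alpha> g y \<odot> \<alpha> g (\<alpha> h z) \<odot> (w g h \<odot> w (g + h) k)"
          unfolding w_\<alpha> by (simp add: m1.assoc)
        also have "\<dots> = x \<odot> \<alpha> g (y \<odot> \<alpha> h z \<odot> w h k) \<odot> w g (h + k)"
          unfolding w_cocycle by (simp add: \<alpha>_mul m1.assoc)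
        finally show "hmul A (hmul A (at_group g x) (at_group h y)) (at_group k z) =
            hmul A (at_group g x) (hmul A (at_group h y) (at_group k z))"
          by (simp add: A_mult add.assoc)
      qed (intro lin hlinear_id)+
    qed (intro lin hlinear_id)+
  qed (intro lin hlinear_id)+
qed

lemma A_unit_left: "hmul A (hunit A) a = a"
proof (rule at_group_ext[of "\<lambda>a. hmul A (hunit A) a" "\<lambda>a. a"])
  show "hmul A (hunit A) (at_group g x) = at_group g x" for g x
    by (simp add: A_unit A_mult \<alpha>_zero w_zero)
qed (unfold hmul_def, (intro hlinear_compose[OF hlinear_A_mult] htens_right hlinear_id)+)

lemma A_unit_right: "hmul A a (hunit A) = a"
proof (rule at_group_ext[of "\<lambda>a. hmul A a (hunit A)" "\<lambda>a. a"])
  show "hmul A (at_group g x) (hunit A) = at_group g x" for g x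
    by (simp add: A_unit A_mult \<alpha>_one w_zero)
qed (unfold hmul_def, (intro hlinear_compose[OF hlinear_A_mult] htens_left hlinear_id)+)

lemma A_counit_left: "hcontract_left (hcounit A) (hcomult A a) = a"
proof (rule at_group_ext[of "\<lambda>a. hcontract_left (hcounit A) (hcomult A a)" "\<lambda>a. a"])
  have *: "hcontract_left (hcounit A) (at_group2 g g s) = at_group g (hcontract_left \<epsilon> s)" for g s
    by (rule htens_ext[of "\<lambda>s. hcontract_left (hcounit A) (at_group2 g g s)"
          "\<lambda>s. at_group g (hcontract_left \<epsilon> s)"])
      (intro hlinear_compose[OF hlinear_contract(1)] at_group_lin at_group2_lin hlinear_id hlinear_contract
        | simp add: hcontract_left_htens hfunctional_A_counit hfunctional_counit A_counit
            hlinear_hscl[OF at_group_lin[OF hlinear_id]] flip: htens_at_group)+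
  show "hcontract_left (hcounit A) (hcomult A (at_group g x)) = at_group g x" for g x
    by (simp add: A_comult * contract_left_mul G_counit counit_left)
qed (intro hlinear_compose[OF hlinear_contract(1)] hlinear_A_comult hlinear_id)+

lemma A_counit_right: "hcontract_right (hcounit A) (hcomult A a) = a"
proof (rule at_group_ext[of "\<lambda>a. hcontract_right (hcounit A) (hcomult A a)" "\<lambda>a. a"])
  have *: "hcontract_right (hcounit A) (at_group2 g g s) = at_group g (hcontract_right \<epsilon> s)" for g s
    by (rule htens_ext[of "\<lambda>s. hcontract_right (hcounit A) (at_group2 g g s)"
          "\<lambda>s. at_group g (hcontract_right \<epsilon> s)"])
      (intro hlinear_compose[OF hlinear_contract(2)] at_group_lin at_group2_lin hlinear_id hlinear_contract
        | simp add: hcontract_right_htens hfunctional_A_counit hfunctional_counit A_counit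
            hlinear_hscl[OF at_group_lin[OF hlinear_id]] flip: htens_at_group)+
  show "hcontract_right (hcounit A) (hcomult A (at_group g x)) = at_group g x" for g x
    by (simp add: A_comult * contract_right_mul G_counit counit_right)
qed (intro hlinear_compose[OF hlinear_contract(2)] hlinear_A_comult hlinear_id)+

lemma A_counit_mul: "hcounit A (hmul A a b) = hcounit A a * hcounit A b"
proof -
  have ext: "e a = e' a" if "hfunctional e" "hfunctional e'"
    "\<And>g x. e (at_group g x) = e' (at_group g x)"
    for e e' :: "('b multiset \<times> 'g \<Rightarrow>\<^sub>0 'k) fps \<Rightarrow> 'k fps" and a
    using that(1,2)
  proof (rule hfunctional_ext)
    show "e (hbas x) = e' (hbas x)" for x
      using that(3)[of "snd x" "hbas (fst x)"] by (simp add: at_group_hbas)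
  qed
  have scale: "hfunctional (\<lambda>a. hcounit A a * c)" "hfunctional (\<lambda>a. c * hcounit A a)" for c
    by (rule hfunctionalI; simp add: hfunctional_add[OF hfunctional_A_counit]
        hfunctional_hscl[OF hfunctional_A_counit] algebra_simps)+
  have lin: "hlinear (\<lambda>x. hmul A x y)" "hlinear (\<lambda>x. hmul A y x)" for y
    unfolding hmul_def
    by (intro hlinear_compose[OF hlinear_A_mult] htens_left htens_right)+
  show ?thesis
  proof (rule ext[of "\<lambda>a. hcounit A (hmul A a b)" "\<lambda>a. hcounit A a * hcounit A b"])
    fix g x
    show "hcounit A (hmul A (at_group g x) b) = hcounit A (at_group g x) * hcounit A b"
    proof (rule ext[of "\<lambda>b. hcounit A (hmul A (at_group g x) b)"
          "\<lambda>b. hcounit A (at_group g x) * hcounit A b"])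
      show "hcounit A (hmul A (at_group g x) (at_group h y)) =
          hcounit A (at_group g x) * hcounit A (at_group h y)" for h y
        by (simp add: A_mult A_counit counit_mul counit_\<alpha> counit_w)
    qed (intro scale hfunctional_compose[OF hfunctional_A_counit] lin)+
  qed (intro scale hfunctional_compose[OF hfunctional_A_counit] lin)+
qed

theorem hbialgebra_A: "hbialgebra A"
proof -
  have "hmap (rename assoc) (htmap (hcomult A) id (hcomult A a)) = htmap id (hcomult A) (hcomult A a)" for a
    by (simp add: id_def A_coassoc)
  moreover have "hcomult A (hunit A) = hunit2 A"
    by (simp add: A_unit A_comult G_zero comult_one hunit2_def mul2_htens htens_at_group)
  moreover have "hcounit A (hunit A) = 1"
    by (simp add: A_unit A_counit counit_one)
  ultimately show ?thesis
    unfolding hbialgebra_def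
    by (intro conjI allI hlinear_A_mult hlinear_A_comult hfunctional_A_counit A_assoc A_unit_left
        A_unit_right A_counit_left A_counit_right A_comult_mul A_counit_mul)
qed

end

section \<open>Symmetric algebras\<close>

text \<open>Scalars become constant polynomials, so bilinearity of the product of
  \<open>S(a)\<close> follows from the ring laws.\<close>

lemma scl_eq_mult:
  fixes p :: "'a::monoid_add \<Rightarrow>\<^sub>0 'k::field_char_0"
  shows "scl c p = Poly_Mapping.single 0 c * p"
proof -
  have scl_single: "scl c (Poly_Mapping.single x a) = Poly_Mapping.single x (c * a)" for x :: 'a and c a :: 'k
    by (rule poly_mapping_eqI) (simp add: lookup_single when_def)
  let ?m = "\<lambda>x. Poly_Mapping.single x (Poly_Mapping.lookup p x)"
  have p: "sum ?m (Poly_Mapping.keys p) = p"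
    using lext_basis[of p] by (simp add: lext_def bas_def scl_single)
  have "scl c (sum ?m (Poly_Mapping.keys p)) = Poly_Mapping.single 0 c * sum ?m (Poly_Mapping.keys p)"
    by (simp add: scl.scale_sum_right scl_single sum_distrib_left mult_single)
  then show ?thesis by (simp only: p)
qed

lemma klinear_mult_left: "klinear (\<lambda>p. p * (q :: 'b multiset \<Rightarrow>\<^sub>0 'k::field_char_0))"
  by (rule klinearI) (simp_all add: distrib_right scl_eq_mult mult.assoc)

lemma klinear_mult_right: "klinear (\<lambda>q. (p :: 'b multiset \<Rightarrow>\<^sub>0 'k::field_char_0) * q)"
  by (rule klinearI) (simp_all add: distrib_left scl_eq_mult mult.left_commute)

lemma bas_add: "bas M * bas N = (bas (M + N) :: 'b multiset \<Rightarrow>\<^sub>0 'k::field_char_0)"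
  by (simp add: bas_def mult_single)

lemma bas_empty: "bas {#} = (1 :: 'b multiset \<Rightarrow>\<^sub>0 'k::field_char_0)"
  by (simp add: bas_def)

lemma klinear_S_map [simp]: "klinear (S_map \<phi>)"
  by (simp add: S_map_def)

lemma S_map_mult: "S_map \<phi> (p * q) = S_map \<phi> p * S_map \<phi> q"
  by (rule bilinear_ext[of "\<lambda>p q. S_map \<phi> (p * q)" "\<lambda>p q. S_map \<phi> p * S_map \<phi> q"])
    (intro klinear_compose[OF klinear_S_map] klinear_mult_left klinear_mult_right
      klinear_compose[OF klinear_mult_left] klinear_compose[OF klinear_mult_right] klinear_S_map
      | simp add: bas_add S_map_def)+

lemma S_map_one: "S_map \<phi> 1 = 1"
proof -
  have "S_map \<phi> (bas {#}) = 1" unfolding S_map_def lext_bas by simp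
  then show ?thesis by (simp add: bas_empty)
qed

lemma S_map_gen: "klinear \<phi> \<Longrightarrow> S_map \<phi> (rename (\<lambda>b. {#b#}) x) = rename (\<lambda>b. {#b#}) (\<phi> x)"
  by (rule klinear_ext[of "\<lambda>x. S_map \<phi> (rename (\<lambda>b. {#b#}) x)" "\<lambda>x. rename (\<lambda>b. {#b#}) (\<phi> x)"])
    (intro klinear_compose[OF klinear_S_map] klinear_compose[OF klinear_rename] klinear_rename
      | simp add: S_map_def)+

lemma S_map_compose:
  assumes "klinear \<phi>"
  shows "S_map \<phi> (S_map \<psi> p) = S_map (\<lambda>x. \<phi> (\<psi> x)) p"
proof (rule klinear_ext[of "\<lambda>p. S_map \<phi> (S_map \<psi> p)" "S_map (\<lambda>x. \<phi> (\<psi> x))"])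
  have bas: "S_map \<chi> (bas M) = (\<Prod>b\<in>#M. rename (\<lambda>c. {#c#}) (\<chi> (bas b)))"
    for \<chi> :: "('b \<Rightarrow>\<^sub>0 'a) \<Rightarrow> ('b \<Rightarrow>\<^sub>0 'a)" and M
    by (simp add: S_map_def)
  show "S_map \<phi> (S_map \<psi> (bas M)) = S_map (\<lambda>x. \<phi> (\<psi> x)) (bas M)" for M
    unfolding bas
    by (induction M) (simp_all add: S_map_mult S_map_gen assms S_map_one)
qed (intro klinear_compose[OF klinear_S_map] klinear_S_map)+

lemma S_map_ident:
  fixes p :: "'b multiset \<Rightarrow>\<^sub>0 'k::field_char_0"
  shows "S_map (\<lambda>x. x) p = p"
proof (rule klinear_ext[of "S_map (\<lambda>x. x)" "\<lambda>p. p"])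
  have "(\<Prod>b\<in>#M. bas {#b#}) = (bas M :: 'b multiset \<Rightarrow>\<^sub>0 'k)" for M
    by (induction M) (simp_all add: bas_empty bas_add)
  then show "S_map (\<lambda>x. x) (bas M) = (bas M :: 'b multiset \<Rightarrow>\<^sub>0 'k)" for M
    by (simp add: S_map_def)
qed (simp_all add: klinear_id)

section \<open>Twisting a Lie bialgebra\<close>

lemma klinear_tens_bracket [simp]: "klinear (\<lambda>t. tens_bracket L t x)"
  by (simp add: tens_bracket_def)

lemma tens_bracket_tens:
  assumes "\<And>y. klinear (\<lambda>x. lbr L x y)"
  shows "tens_bracket L (tens p q) x = tens (lbr L p x) q + tens p (lbr L q x)"
  by (rule bilinear_ext[of "\<lambda>p q. tens_bracket L (tens p q) x"
        "\<lambda>p q. tens (lbr L p x) q + tens p (lbr L q x)"])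
    (intro klinear_compose[OF klinear_tens_bracket] klinear_intros assms
      | simp add: tens_bracket_def)+

text \<open>Twisting leaves the bracket unchanged, so \<open>ad(t)\<close> is the same map before
  and after twisting by \<open>s\<close>.\<close>

lemma twisted_twisted: "twisted (twisted L s) t = twisted L (s + t)"
proof -
  have "tens_bracket (twisted L s) = tens_bracket L"
    by (intro ext) (simp add: tens_bracket_def twisted_def)
  then show ?thesis
    by (simp add: twisted_def klinear_add[OF klinear_tens_bracket] add.assoc)
qed

lemma klinear_cyc_sum [simp]: "klinear cyc_sum"
  unfolding cyc_sum_def by (intro klinear_intros)

lemma klinear_tmap_comp: "klinear f \<Longrightarrow> klinear (\<lambda>x. tmap p q (f x))"
  by (rule klinear_compose[OF klinear_tmap])

lemma cyc_sum_tmap: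
  assumes "klinear \<phi>"
  shows "cyc_sum (tmap (tmap \<phi> \<phi>) \<phi> t) = tmap (tmap \<phi> \<phi>) \<phi> (cyc_sum t)"
proof -
  have rot1: "rename (\<lambda>((x, y), z). ((y, z), x)) (tens (tens p q) r) = tens (tens q r) p"
    for p q r :: "'z \<Rightarrow>\<^sub>0 'a::field_char_0"
    by (rule trilinear_ext[of "\<lambda>p q r. rename (\<lambda>((x, y), z). ((y, z), x)) (tens (tens p q) r)"
        "\<lambda>p q r. tens (tens q r) p"]) (intro klinear_intros | simp)+
  have rot2: "rename (\<lambda>((x, y), z). ((z, x), y)) (tens (tens p q) r) = tens (tens r p) q"
    for p q r :: "'z \<Rightarrow>\<^sub>0 'a::field_char_0"
    by (rule trilinear_ext[of "\<lambda>p q r. rename (\<lambda>((x, y), z). ((z, x), y)) (tens (tens p q) r)"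
        "\<lambda>p q r. tens (tens r p) q"]) (intro klinear_intros | simp)+
  show ?thesis
    by (rule tens_ext3[of "\<lambda>t. cyc_sum (tmap (tmap \<phi> \<phi>) \<phi> t)" "\<lambda>t. tmap (tmap \<phi> \<phi>) \<phi> (cyc_sum t)"])
      (intro klinear_compose[OF klinear_cyc_sum] klinear_tmap_comp klinear_tmap klinear_cyc_sum
        | simp add: cyc_sum_def rot1 rot2 tmap_tens assms klinear_add[OF klinear_tmap])+
qed

lemma klinear_inv: "klinear f \<Longrightarrow> bij f \<Longrightarrow> klinear (inv f)"
  by (rule klinearI; rule injD[OF bij_is_inj[of f]])
    (simp_all add: klinear_add klinear_scl surj_f_inv_f bij_is_surj)

lemma hlinear_inv: "hlinear f \<Longrightarrow> bij f \<Longrightarrow> hlinear (inv f)"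
  by (rule hlinearI; rule injD[OF bij_is_inj[of f]])
    (simp_all add: hlinear_add hlinear_hscl surj_f_inv_f bij_is_surj)

lemma inv_htmap:
  assumes "hlinear i" "bij i"
  shows "inv (htmap i i) = htmap (inv i) (inv i)" and "bij (htmap i i)"
proof -
  have 1: "htmap i i (htmap (inv i) (inv i) s) = s" "htmap (inv i) (inv i) (htmap i i t) = t" for s t
    using assms by (simp_all add: htmap_htmap hlinear_inv surj_f_inv_f bij_is_surj bij_is_inj)
  show "inv (htmap i i) = htmap (inv i) (inv i)"
    by (rule inv_equality) (simp_all add: 1)
  show "bij (htmap i i)"
    by (rule o_bij[of "htmap (inv i) (inv i)"]) (simp_all add: 1 fun_eq_iff)
qed

text \<open>Lie bialgebras and twists are transported along isomorphisms; this is how \<open>a\<^sub>f\<close> is seen to be a Lie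
  bialgebra when \<open>f\<close> comes from a \<open>\<Gamma>\<close>-Lie bialgebra.\<close>

locale lie_transport =
  fixes L L' :: "('b, 'k::field_char_0) lie_bialg" and \<phi>
  assumes lie: "lie_bialgebra L" and iso: "lie_bialg_iso L L' \<phi>" and lbr: "lbr L' = lbr L"
begin

lemma lin: "klinear \<phi>" and bij: "bij \<phi>" and bracket: "\<phi> (lbr L x y) = lbr L (\<phi> x) (\<phi> y)"
  and cobracket: "tmap \<phi> \<phi> (lcob L x) = lcob L' (\<phi> x)"
  using iso by (auto simp: lie_bialg_iso_def lbr)

lemma lie_linear: "klinear (lbr L x)" "klinear (\<lambda>x. lbr L x y)" "klinear (lcob L)"
  using lie unfolding lie_bialgebra_def by blast+

lemma inv_simp [simp]: "inv \<phi> (\<phi> x) = x" "\<phi> (inv \<phi> x) = x"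
  using bij by (simp_all add: bij_is_inj bij_is_surj surj_f_inv_f)

lemma lin_cobracket': "klinear (lcob L')"
proof -
  have "lcob L' = (\<lambda>x. tmap \<phi> \<phi> (lcob L (inv \<phi> x)))" by (simp add: cobracket)
  then show ?thesis
    by (simp add: klinear_compose[OF klinear_tmap] klinear_compose[OF lie_linear(3)] klinear_inv lin bij)
qed

lemma cobracket_left:
  "tmap (lcob L') id (tmap \<phi> \<phi> t) = tmap (tmap \<phi> \<phi>) \<phi> (tmap (lcob L) id t)"
  by (simp add: tmap_tmap lin lie_linear lin_cobracket' klinear_id cobracket id_def)

lemma tens_bracket_transport:
  "tens_bracket L' (tmap \<phi> \<phi> t) (\<phi> x) = tmap \<phi> \<phi> (tens_bracket L t x)"
proof -
  have eq: "tens_bracket L' = tens_bracket L" by (intro ext) (simp add: tens_bracket_def lbr)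
  show ?thesis unfolding eq
    by (rule tens_ext[of "\<lambda>t. tens_bracket L (tmap \<phi> \<phi> t) (\<phi> x)" "\<lambda>t. tmap \<phi> \<phi> (tens_bracket L t x)"])
      (intro klinear_compose[OF klinear_tens_bracket] klinear_tmap_comp klinear_tmap klinear_tens_bracket
        | simp add: tens_bracket_tens tmap_tens lin lie_linear bracket klinear_add[OF klinear_tmap])+
qed

lemma bracket_13_23_transport:
  "bracket_13_23 L' (tmap \<phi> \<phi> t) = tmap (tmap \<phi> \<phi>) \<phi> (bracket_13_23 L t)"
proof -
  \<comment> \<open>\<open>bracket_13_23\<close> is quadratic in the tensor. Its polarization
    \<open>B\<close> is linear in each slot, so it can be compared on pure tensors before setting
    \<open>s = t\<close>.\<close>
  define B where "B s t = lext (\<lambda>((a, b), (c, d)). tens (bas (a, c)) (lbr L (bas b) (bas d))) (tens s t)"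
    for s t :: "'b \<times> 'b \<Rightarrow>\<^sub>0 'k"
  have "klinear (\<lambda>s. B s t)" "klinear (\<lambda>s. B t s)" for t
    unfolding B_def by (intro klinear_intros)+
  note B_lin = klinear_compose[OF this(1)] klinear_compose[OF this(2)]
  note lbr_lin = klinear_compose[OF lie_linear(1)] klinear_compose[OF lie_linear(2)]
  have B_tens: "B (tens a b) (tens c d) = tens (tens a c) (lbr L b d)" for a b c d
  proof (rule bilinear_ext[of "\<lambda>a b. B (tens a b) (tens c d)" "\<lambda>a b. tens (tens a c) (lbr L b d)"])
    show "B (tens (bas x) (bas y)) (tens c d) = tens (tens (bas x) c) (lbr L (bas y) d)" for x y
      by (rule bilinear_ext[of "\<lambda>c d. B (tens (bas x) (bas y)) (tens c d)"
            "\<lambda>c d. tens (tens (bas x) c) (lbr L (bas y) d)"])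
        (intro B_lin klinear_intros lie_linear lbr_lin | simp add: B_def)+
  qed (intro B_lin klinear_intros lie_linear lbr_lin)+
  have "B (tmap \<phi> \<phi> s) (tmap \<phi> \<phi> t) = tmap (tmap \<phi> \<phi>) \<phi> (B s t)" for s t
  proof (rule tens_ext[of "\<lambda>s. B (tmap \<phi> \<phi> s) (tmap \<phi> \<phi> t)" "\<lambda>s. tmap (tmap \<phi> \<phi>) \<phi> (B s t)"])
    show "B (tmap \<phi> \<phi> (tens a b)) (tmap \<phi> \<phi> t) = tmap (tmap \<phi> \<phi>) \<phi> (B (tens a b) t)" for a b
      by (rule tens_ext[of "\<lambda>t. B (tmap \<phi> \<phi> (tens a b)) (tmap \<phi> \<phi> t)"
            "\<lambda>t. tmap (tmap \<phi> \<phi>) \<phi> (B (tens a b) t)"])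
        (intro B_lin klinear_tmap_comp klinear_tmap klinear_id
          | simp add: B_tens tmap_tens lin bracket)+
  qed (intro B_lin klinear_tmap_comp klinear_tmap klinear_id)+
  then show ?thesis by (simp add: bracket_13_23_def B_def lbr)
qed

lemma lie_bialgebra_transport: "lie_bialgebra L'"
proof -
  have 1: "swap_tens (lcob L' (\<phi> x)) = - lcob L' (\<phi> x)" for x
  proof -
    have "swap_tens (lcob L x) = - lcob L x" using lie unfolding lie_bialgebra_def by blast
    then show ?thesis
      by (simp add: swap_tens_tmap lin klinear_neg[OF klinear_tmap] flip: cobracket)
  qed
  have 2: "cyc_sum (tmap (lcob L') id (lcob L' (\<phi> x))) = 0" for x
  proof -
    have "cyc_sum (tmap (lcob L) id (lcob L x)) = 0" using lie unfolding lie_bialgebra_def by blast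
    then show ?thesis
      unfolding cobracket[symmetric] cobracket_left cyc_sum_tmap[OF lin]
      by (simp add: klinear_0[OF klinear_tmap])
  qed
  have 3: "lcob L' (lbr L' (\<phi> x) (\<phi> y)) =
      tens_bracket L' (lcob L' (\<phi> x)) (\<phi> y) - tens_bracket L' (lcob L' (\<phi> y)) (\<phi> x)" for x y
  proof -
    have "lcob L (lbr L x y) = tens_bracket L (lcob L x) y - tens_bracket L (lcob L y) x"
      using lie unfolding lie_bialgebra_def by blast
    then show ?thesis
      by (simp add: lbr tens_bracket_transport klinear_diff[OF klinear_tmap] flip: cobracket bracket)
  qed
  \<comment> \<open>Surjectivity of \<phi>: an axiom for \<open>L'\<close> need only be checked at
    vectors \<open>\<phi> x\<close>, where it is the image of the axiom for
    \<open>L\<close>.\<close>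
  have all: "(\<forall>x. P x) \<longleftrightarrow> (\<forall>x. P (\<phi> x))" for P
    by (metis inv_simp(2))
  have "\<forall>x. swap_tens (lcob L' x) = - lcob L' x" by (subst all) (simp add: 1)
  moreover have "\<forall>x. cyc_sum (tmap (lcob L') id (lcob L' x)) = 0" by (subst all) (simp add: 2)
  moreover have "lcob L' (lbr L' x y) = tens_bracket L' (lcob L' x) y - tens_bracket L' (lcob L' y) x" for x y
    using 3[of "inv \<phi> x" "inv \<phi> y"] by simp
  ultimately show ?thesis
    using lie lin_cobracket' unfolding lie_bialgebra_def lbr by blast
qed

lemma is_twist_transport: "is_twist L t \<Longrightarrow> is_twist L' (tmap \<phi> \<phi> t)"
  unfolding is_twist_def cobracket_left bracket_13_23_transport
  by (simp add: swap_tens_tmap lin klinear_neg[OF klinear_tmap] cyc_sum_tmap klinear_0[OF klinear_tmap]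
      flip: klinear_add[OF klinear_tmap])

end

section \<open>The crossed product of an Etingof--Kazhdan quantization\<close>

locale gamma_ek =
  fixes E :: "'k::field_char_0 ek_data"
    and L :: "('b, 'k) lie_bialg"
    and \<theta> :: "'g::group_add \<Rightarrow> ('b \<Rightarrow>\<^sub>0 'k) \<Rightarrow> ('b \<Rightarrow>\<^sub>0 'k)"
    and f :: "'g \<Rightarrow> ('b \<times> 'b \<Rightarrow>\<^sub>0 'k)"
  assumes ek: "ek_quantization TYPE('b) E"
    and gamma: "Gamma_lie_bialgebra L \<theta> f"
begin

abbreviation "Q \<equiv> ek_Q E L"
abbreviation "\<theta>2 g \<equiv> tmap (\<theta> g) (\<theta> g)"
abbreviation "\<Theta> g \<equiv> hmap (S_map (\<theta> g))"

section \<open>Consequences of the axioms of a \<Gamma>-Lie bialgebra\<close>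

lemma lie: "lie_bialgebra L"
  and aut: "lie_automorphism L (\<theta> g)"
  and \<theta>_add: "\<theta> (g + h) x = \<theta> g (\<theta> h x)"
  and f_swap: "swap_tens (f g) = - f g"
  and f_cobracket: "\<theta>2 g (lcob L (inv (\<theta> g) x)) = lcob L x + tens_bracket L (f g) x"
  and f_add: "f (g + h) = f g + \<theta>2 g (f h)"
  and f_cyc: "cyc_sum (tmap (lcob L) id (f g) + bracket_13_23 L (f g)) = 0"
  using gamma unfolding Gamma_lie_bialgebra_def by auto

lemma \<theta>_lin: "klinear (\<theta> g)" and \<theta>_bij: "bij (\<theta> g)"
  and \<theta>_bracket: "\<theta> g (lbr L x y) = lbr L (\<theta> g x) (\<theta> g y)"
  using aut[of g] unfolding lie_automorphism_def by auto

text \<open>The morphism law makes \<open>\<theta> 0\<close> idempotent, and an injective idempotent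
  map is the identity.\<close>

lemma \<theta>_zero: "\<theta> 0 x = x"
proof -
  have "\<theta> 0 (\<theta> 0 x) = \<theta> 0 x" using \<theta>_add[of 0 0 x] by simp
  then show ?thesis using \<theta>_bij[of 0] by (simp add: bij_is_inj inj_eq)
qed

lemma \<theta>2_add: "\<theta>2 (g + h) t = \<theta>2 g (\<theta>2 h t)"
  by (simp add: tmap_tmap \<theta>_lin \<theta>_add[abs_def])

lemma \<theta>2_zero: "\<theta>2 0 t = t"
  by (simp add: \<theta>_zero[abs_def])

lemma f_zero: "f 0 = 0"
  using f_add[of 0 0] by (simp add: \<theta>2_zero)

text \<open>Axiom (a) at the point \<open>\<theta> g x\<close> says exactly that
  \<open>\<theta> g\<close> intertwines the cobrackets of \<open>a\<close> and of its twist by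
  \<open>f g\<close>.\<close>

lemma iso: "lie_bialg_iso L (twisted L (f g)) (\<theta> g)"
proof -
  have "\<theta>2 g (lcob L x) = lcob (twisted L (f g)) (\<theta> g x)" for x
    using f_cobracket[of g "\<theta> g x"] \<theta>_bij[of g] by (simp add: twisted_def bij_is_inj)
  then show ?thesis
    by (simp add: lie_bialg_iso_def \<theta>_lin \<theta>_bij \<theta>_bracket twisted_def)
qed

lemma transport: "lie_transport L (twisted L (f g)) (\<theta> g)"
  by (simp add: lie_transport_def lie iso) (simp add: twisted_def)

lemma lie_twisted: "lie_bialgebra (twisted L (f g))"
  by (rule lie_transport.lie_bialgebra_transport[OF transport])

lemma twist: "is_twist L (f g)"
  by (simp add: is_twist_def f_swap f_cyc)

lemma twist_twisted: "is_twist (twisted L (f g)) (\<theta>2 g (f h))"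
  by (rule lie_transport.is_twist_transport[OF transport twist])

text \<open>The cocycle property of \<open>f\<close> makes this an equality of Lie bialgebras, not
  only an isomorphism, so the quantization data of both sides coincide.\<close>

lemma twisted_f_add: "twisted (twisted L (f g)) (\<theta>2 g (f h)) = twisted L (f (g + h))"
  by (simp add: twisted_twisted f_add)

lemma quantization_Q: "quantization (U_presentation L) U_identification Q"
  using ek lie unfolding ek_quantization_def by blast

lemma bialg_Q: "bialg Q"
  using quantization_Q unfolding quantization_def bialg_def by blast

sublocale bialg Q by (rule bialg_Q)

notation mul (infixl "\<odot>" 70) and mul2 (infixl "\<odot>\<^sub>2" 70) and mul3 (infixl "\<odot>\<^sub>3" 70)

definition "i g = itw E L (f g)"
definition "F g = Ftw E L (f g)"
definition "v g h = vtw E L (f g) (\<theta>2 g (f h))"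
definition "w g h = hinv Q (v g h)"
definition "G g = hinv2 Q (F g)"
definition "\<alpha> g x = inv (i g) (\<Theta> g x)"

section \<open>The Etingof--Kazhdan data at the twists of the \<Gamma>-structure\<close>

lemma invertible:
  assumes "lie_bialgebra (L' :: ('b, 'k) lie_bialg)" "is_twist L' s" "is_twist (twisted L' s) t"
  shows "\<exists>G. is_inverse (hmul2 (ek_Q E L')) (hunit2 (ek_Q E L')) (Ftw E L' s) G"
    and "bij (itw E L' s)"
    and "\<exists>w. is_inverse (hmul (ek_Q E L')) (hunit (ek_Q E L')) (vtw E L' s t) w"
  using ek assms unfolding ek_quantization_def ek_invertible_def by blast+

lemma F_inv: "is_inverse mul2 (hunit2 Q) (F g) (G g)"
proof -
  obtain G' where "is_inverse mul2 (hunit2 Q) (F g) G'"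
    using invertible(1)[OF lie twist twist_twisted] unfolding F_def by blast
  then show ?thesis unfolding G_def using hinv2_eqI by metis
qed

lemma v_inv: "is_inverse mul one (v g h) (w g h)"
proof -
  obtain w' where "is_inverse mul one (v g h) w'"
    using invertible(3)[OF lie twist twist_twisted] unfolding v_def by blast
  then show ?thesis unfolding w_def using hinv_eqI by metis
qed

lemma i_bij: "bij (i g)"
  unfolding i_def by (rule invertible(2)[OF lie twist twist_twisted])

lemma i'_bij: "bij (itw E (twisted L (f g)) (\<theta>2 g (f h)))"
  \<comment> \<open>Invertibility is assumed for pairs of composable twists, so a second twist must
    be supplied. \<open>\<theta>2 (g + h) (f 0)\<close> is one, by \<open>twist_twisted\<close> and
    \<open>twisted_f_add\<close>.\<close>
  by (rule invertible(2)[OF lie_twisted twist_twisted, of g h "\<theta>2 (g + h) (f 0)"])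
    (simp only: twisted_f_add twist_twisted)

lemma i_lin: "hlinear (i g)"
  by (simp add: i_def itw_def)

lemma \<Theta>_lin: "hlinear (\<Theta> g)"
  by (simp add: hlinear_hmap)

lemma \<alpha>_lin: "hlinear (\<alpha> g)"
  unfolding \<alpha>_def[abs_def] by (intro hlinear_compose[OF hlinear_inv] i_lin i_bij \<Theta>_lin)

lemma i_\<alpha>: "i g (\<alpha> g x) = \<Theta> g x"
  using i_bij by (simp add: \<alpha>_def bij_is_surj surj_f_inv_f)

lemma \<alpha>2: "inv (htmap (i g) (i g)) (htmap (\<Theta> g) (\<Theta> g) t) = htmap (\<alpha> g) (\<alpha> g) t"
  by (simp add: inv_htmap i_lin i_bij htmap_htmap hlinear_inv \<Theta>_lin \<alpha>_def[abs_def])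

lemma normalized:
  assumes "is_twist L s" "is_twist (twisted L s) t"
  shows "Ftw E L 0 = hunit2 Q" "itw E L 0 = id" "vtw E L 0 s = one" "vtw E L s 0 = one"
    "fps_nth (Ftw E L s) 0 = fps_nth (hunit2 Q) 0" "fps_nth (itw E L s x) 0 = fps_nth x 0"
    "fps_nth (vtw E L s t) 0 = fps_nth one 0"
    "fps_nth (Ftw E L s - hmap swap_tens (Ftw E L s)) 1 = rename (\<lambda>(b, c). ({#b#}, {#c#})) s"
  using ek lie assms unfolding ek_quantization_def ek_normalized_def by blast+

lemmas normalized_f = normalized[OF twist twist_twisted]

text \<open>Naturality under \<open>\<theta> g\<close> expresses all data of the twisted Lie
  bialgebra through data of \<open>a\<close>. This is how the composition identities become
  identities inside the single algebra \<open>Q\<close>.\<close>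

lemma natural:
  shows "\<Theta> g (hmult Q t) = hmult (ek_Q E (twisted L (f g))) (htmap (\<Theta> g) (\<Theta> g) t)"
    and "htmap (\<Theta> g) (\<Theta> g) (\<Delta> x) = hcomult (ek_Q E (twisted L (f g))) (\<Theta> g x)"
    and "htmap (\<Theta> g) (\<Theta> g) (F h) = Ftw E (twisted L (f g)) (\<theta>2 g (f h))"
    and "\<Theta> g (i h x) = itw E (twisted L (f g)) (\<theta>2 g (f h)) (\<Theta> g x)"
    and "\<Theta> g (v h k) = vtw E (twisted L (f g)) (\<theta>2 g (f h)) (\<theta>2 g (\<theta>2 h (f k)))"
proof -
  have nat: "ek_natural TYPE('b) E" using ek by (simp add: ek_quantization_def)
  show "\<Theta> g (hmult Q t) = hmult (ek_Q E (twisted L (f g))) (htmap (\<Theta> g) (\<Theta> g) t)"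
    "htmap (\<Theta> g) (\<Theta> g) (\<Delta> x) = hcomult (ek_Q E (twisted L (f g))) (\<Theta> g x)"
    "htmap (\<Theta> g) (\<Theta> g) (F h) = Ftw E (twisted L (f g)) (\<theta>2 g (f h))"
    "\<Theta> g (i h x) = itw E (twisted L (f g)) (\<theta>2 g (f h)) (\<Theta> g x)"
    "\<Theta> g (v h k) = vtw E (twisted L (f g)) (\<theta>2 g (f h)) (\<theta>2 g (\<theta>2 h (f k)))"
    using nat[unfolded ek_natural_def Let_def, rule_format, OF lie lie_twisted iso twist twist_twisted,
        of g h k]
    by (simp_all add: fun_eq_iff F_def i_def v_def)
qed

lemma twist_identities:
  shows "hmult (ek_Q E (twisted L (f g))) t = i g (hmult Q (inv (htmap (i g) (i g)) t))"
    and "hcomult (ek_Q E (twisted L (f g))) x =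
      htmap (i g) (i g) (F g \<odot>\<^sub>2 \<Delta> (inv (i g) x) \<odot>\<^sub>2 G g)"
    and "htens (F g) one \<odot>\<^sub>3 htmap \<Delta> (\<lambda>x. x) (F g) =
      hmap (rename unassoc) (htens one (F g)) \<odot>\<^sub>3 hmap (rename unassoc) (htmap (\<lambda>x. x) \<Delta> (F g))"
    and "hcontract_left \<epsilon> (F g) = one" "hcontract_right \<epsilon> (F g) = one"
proof -
  have "ek_twist_identities TYPE('b) E" using ek by (simp add: ek_quantization_def)
  note * = this[unfolded ek_twist_identities_def Let_def, rule_format, OF lie twist[of g],
      folded F_def i_def, unfolded id_def]
  show "hmult (ek_Q E (twisted L (f g))) t = i g (hmult Q (inv (htmap (i g) (i g)) t))"
    using * by simp
  show "hcomult (ek_Q E (twisted L (f g))) x =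
      htmap (i g) (i g) (F g \<odot>\<^sub>2 \<Delta> (inv (i g) x) \<odot>\<^sub>2 G g)"
    using * by (simp add: hAd2_def G_def)
  show "htens (F g) one \<odot>\<^sub>3 htmap \<Delta> (\<lambda>x. x) (F g) =
      hmap (rename unassoc) (htens one (F g)) \<odot>\<^sub>3 hmap (rename unassoc) (htmap (\<lambda>x. x) \<Delta> (F g))"
    using * by blast
  show "hcontract_left \<epsilon> (F g) = one" "hcontract_right \<epsilon> (F g) = one"
    using * by blast+
qed

lemma composition_identities:
  shows "F (g + h) = htens (v g h) (v g h) \<odot>\<^sub>2 htmap (\<alpha> g) (\<alpha> g) (F h) \<odot>\<^sub>2 F g \<odot>\<^sub>2 hinv2 Q (\<Delta> (v g h))"
    and "i (g + h) x = itw E (twisted L (f g)) (\<theta>2 g (f h)) (i g (hAd Q (w g h) x))"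
    and "v (g + h) k \<odot> v g h = v g (h + k) \<odot> \<alpha> g (v h k)"
proof -
  have "ek_composition_identities TYPE('b) E" using ek by (simp add: ek_quantization_def)
  note * = this[unfolded ek_composition_identities_def Let_def, rule_format, OF lie twist[of g]
      twist_twisted[of g h], folded f_add v_def F_def i_def w_def natural]
  show "F (g + h) = htens (v g h) (v g h) \<odot>\<^sub>2 htmap (\<alpha> g) (\<alpha> g) (F h) \<odot>\<^sub>2 F g \<odot>\<^sub>2 hinv2 Q (\<Delta> (v g h))"
    using * by (simp add: \<alpha>2)
  show "i (g + h) x = itw E (twisted L (f g)) (\<theta>2 g (f h)) (i g (hAd Q (w g h) x))"
    using * by (simp add: w_def)
  \<comment> \<open>For the third composition identity \<open>f''\<close> is
    \<open>\<theta>2 (g + h) (f k)\<close>. The cocycle property of \<open>f\<close> combines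
    \<open>f' + f''\<close> into the twist that defines \<open>v g (h + k)\<close>.\<close>
  have "\<theta>2 g (f h) + \<theta>2 (g + h) (f k) = \<theta>2 g (f (h + k))"
    by (simp add: f_add \<theta>2_add klinear_add[OF klinear_tmap])
  moreover have "hmul Q (vtw E L (f (g + h)) (\<theta>2 (g + h) (f k))) (v g h) =
      hmul Q (vtw E L (f g) (\<theta>2 g (f h) + \<theta>2 (g + h) (f k)))
        (inv (i g) (vtw E (twisted L (f g)) (\<theta>2 g (f h)) (\<theta>2 (g + h) (f k))))"
    using * twist_twisted[of "g + h" k] by blast
  ultimately show "v (g + h) k \<odot> v g h = v g (h + k) \<odot> \<alpha> g (v h k)"
    by (simp add: \<alpha>_def natural \<theta>2_add) (simp add: v_def \<theta>2_add)
qed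

lemma \<Theta>_add: "\<Theta> (g + h) x = \<Theta> g (\<Theta> h x)"
  by (rule fps_ext) (simp add: S_map_compose \<theta>_lin \<theta>_add[abs_def])

lemma \<alpha>_zero: "\<alpha> 0 x = x"
proof -
  have "i 0 = id" by (simp add: i_def f_zero normalized_f)
  moreover have "\<Theta> 0 x = x"
    by (rule fps_ext) (simp add: \<theta>_zero[abs_def] S_map_ident)
  ultimately show ?thesis by (simp add: \<alpha>_def)
qed

lemma vw: "v g h \<odot> w g h = one" "w g h \<odot> v g h = one"
  using v_inv by (auto simp: is_inverse_def)

lemma FG: "F g \<odot>\<^sub>2 G g = hunit2 Q" "G g \<odot>\<^sub>2 F g = hunit2 Q"
  using F_inv by (auto simp: is_inverse_def)

text \<open>Two expressions for \<open>\<Theta> (g + h) x\<close> are compared: one from the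
  composition law for \<open>i (g + h)\<close>, the other from naturality of \<open>i h\<close>
  under \<open>\<Theta> g\<close>. Cancelling the bijections \<open>?i'\<close> and
  \<open>i g\<close> leaves the conjugation by \<open>v\<close>.\<close>

lemma \<alpha>_add: "\<alpha> (g + h) x \<odot> v g h = v g h \<odot> \<alpha> g (\<alpha> h x)"
proof -
  let ?i' = "itw E (twisted L (f g)) (\<theta>2 g (f h))" and ?y = "\<alpha> (g + h) x"
  have hinv_w: "hinv Q (w g h) = v g h"
    by (rule hinv_eqI[OF is_inverse_sym[OF v_inv]])
  have "?i' (i g (w g h \<odot> ?y \<odot> v g h)) = \<Theta> g (\<Theta> h x)"
    using composition_identities(2)[of g h ?y] by (simp add: i_\<alpha> \<Theta>_add hAd_def hinv_w)
  also have "\<dots> = ?i' (\<Theta> g (\<alpha> h x))"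
    by (simp add: i_\<alpha> flip: natural(4))
  finally have "i g (w g h \<odot> ?y \<odot> v g h) = \<Theta> g (\<alpha> h x)"
    using i'_bij by (simp add: bij_is_inj inj_eq)
  then have "i g (w g h \<odot> ?y \<odot> v g h) = i g (\<alpha> g (\<alpha> h x))"
    by (simp add: i_\<alpha>)
  then have *: "w g h \<odot> ?y \<odot> v g h = \<alpha> g (\<alpha> h x)"
    using i_bij by (simp add: bij_is_inj inj_eq)
  show ?thesis
    unfolding *[symmetric] m1.assoc[symmetric] vw m1.left_neutral ..
qed

text \<open>\<open>\<Theta> g\<close> and \<open>i g\<close> are both algebra morphisms from
  \<open>Q(a)\<close> to the quantization of the twisted Lie bialgebra, the former by naturality and
  the latter by the twist identities.\<close>

lemma \<alpha>_mul: "\<alpha> g (x \<odot> y) = \<alpha> g x \<odot> \<alpha> g y"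
proof -
  have "\<alpha> g (hmult Q t) = hmult Q (htmap (\<alpha> g) (\<alpha> g) t)" for t
    using i_bij[of g]
    by (simp add: \<alpha>_def[of g "hmult Q t"] natural twist_identities bij_is_inj \<alpha>2)
  then show ?thesis by (simp add: hmul_def htmap_htens \<alpha>_lin)
qed

text \<open>\<open>\<Theta> g\<close> respects the coproducts, whereas \<open>i g\<close> respects
  them only after conjugation by \<open>F g\<close>; the quotient of the two maps inherits this
  defect.\<close>

lemma \<alpha>_comult: "htmap (\<alpha> g) (\<alpha> g) (\<Delta> x) \<odot>\<^sub>2 F g = F g \<odot>\<^sub>2 \<Delta> (\<alpha> g x)"
proof -
  have "htmap (\<alpha> g) (\<alpha> g) (\<Delta> x) = inv (htmap (i g) (i g)) (htmap (\<Theta> g) (\<Theta> g) (\<Delta> x))"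
    by (simp only: \<alpha>2)
  also have "\<dots> = inv (htmap (i g) (i g)) (htmap (i g) (i g) (F g \<odot>\<^sub>2 \<Delta> (\<alpha> g x) \<odot>\<^sub>2 G g))"
    by (simp only: natural twist_identities \<alpha>_def)
  also have "\<dots> = F g \<odot>\<^sub>2 \<Delta> (\<alpha> g x) \<odot>\<^sub>2 G g"
    by (simp add: inv_f_f bij_is_inj[OF inv_htmap(2)] i_lin i_bij)
  finally show ?thesis by (simp add: m2.assoc FG)
qed

lemma F_add: "F (g + h) \<odot>\<^sub>2 \<Delta> (v g h) =
  htens (v g h) (v g h) \<odot>\<^sub>2 htmap (\<alpha> g) (\<alpha> g) (F h) \<odot>\<^sub>2 F g"
proof -
  have "hinv2 Q (\<Delta> (v g h)) = \<Delta> (w g h)"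
    by (rule hinv2_eqI) (simp add: is_inverse_def vw comult_one flip: comult_mul)
  then show ?thesis
    by (simp add: composition_identities(1) m2.assoc vw comult_one flip: comult_mul)
qed

lemma v_zero: "v 0 g = one" "v g 0 = one"
  by (simp_all add: v_def f_zero \<theta>2_zero klinear_0[OF klinear_tmap] normalized_f)

lemma F_zero: "F 0 = hunit2 Q"
  by (simp add: F_def f_zero normalized_f)

lemma crossed: "crossed Q \<alpha> v w F G"
  by (intro crossed.intro crossed_axioms.intro bialg_Q) (rule \<alpha>_lin \<alpha>_mul \<alpha>_zero v_inv F_inv \<alpha>_add composition_identities(3) v_zero
      \<alpha>_comult twist_identities(3-5) F_zero F_add)+

sublocale crossed Q \<alpha> v w F G by (rule crossed)

lemma cross_quantization_eq: "cross_quantization E L \<theta> f = A"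
  by (simp add: cross_quantization_def A_def Let_def \<alpha>_def i_def w_def v_def G_def F_def)

end

section \<open>Classical limits\<close>

definition cl :: "(('x \<Rightarrow>\<^sub>0 'k::field_char_0) fps \<Rightarrow> ('y \<Rightarrow>\<^sub>0 'k) fps) \<Rightarrow> ('x \<Rightarrow>\<^sub>0 'k) \<Rightarrow> ('y \<Rightarrow>\<^sub>0 'k)" where
  "cl f x = fps_nth (f (fps_const x)) 0"

text \<open>A linear map preserves multiples of \<open>h\<close>, so it descends to
  \<open>V[[h]]/h = V\<close>, and \<open>cl f\<close> is this reduction.\<close>

lemma hlinear_nth_0: "hlinear f \<Longrightarrow> fps_nth (f v) 0 = cl f (fps_nth v 0)"
  using arg_cong[OF fps_split_const[of v], of "\<lambda>v. fps_nth (f v) 0"]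
  by (simp add: cl_def hlinear_add hlinear_hscl hscl_X_nth)

lemma hscl_nth_0: "fps_nth (hscl c v) 0 = scl (fps_nth c 0) (fps_nth v 0)"
  by (simp add: hscl_def)

lemma klinear_cl:
  assumes "hlinear f"
  shows "klinear (cl f)"
proof (rule klinearI)
  show "cl f (x + y) = cl f x + cl f y" for x y
    using hlinear_nth_0[OF assms, of "fps_const x + fps_const y"]
    by (simp add: hlinear_add[OF assms] cl_def del: fps_const_add)
  show "cl f (scl c x) = scl c (cl f x)" for c x
    using hlinear_nth_0[OF assms, of "hscl (fps_const c) (fps_const x)"]
    by (simp add: hlinear_hscl[OF assms] hscl_nth_0 cl_def)
qed

lemma cl_compose: "hlinear f \<Longrightarrow> cl f (cl g x) = cl (\<lambda>x. f (g x)) x"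
  unfolding cl_def[of g] cl_def[of "\<lambda>x. f (g x)"] by (rule hlinear_nth_0[symmetric])

lemma hbas_nth_0: "fps_nth (hbas x) 0 = bas x"
  by (simp add: hbas_def)

lemma cl_bas: "cl f (bas x) = fps_nth (f (hbas x)) 0"
  by (simp add: cl_def hbas_def)

lemma cl_htmap:
  assumes "hlinear f" "hlinear g"
  shows "cl (htmap f g) t = tmap (cl f) (cl g) t"
  by (rule klinear_ext[of "cl (htmap f g)" "tmap (cl f) (cl g)"])
    (simp_all add: klinear_cl cl_bas htmap_def tmap_def case_prod_beta)

lemma cl_id [simp]: "cl (\<lambda>x. x) = (\<lambda>x. x)"
  by (simp add: cl_def fun_eq_iff)

lemma klinear_mod_ext:
  assumes "klinear d" "\<And>x. d (bas x) \<in> module.span scl S"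
  shows "d t \<in> module.span scl S"
  unfolding klinear_eq_lext[OF assms(1), of t] lext_def
  by (intro scl.span_sum scl.span_scale assms(2))

lemma klinear_span_0:
  assumes "klinear f" "\<And>x. x \<in> S \<Longrightarrow> f x = 0" "x \<in> module.span scl S"
  shows "f x = 0"
  using assms(3) by (induction rule: scl.span_induct_alt)
    (simp_all add: klinear_0 klinear_add klinear_scl assms(1,2))

lemma hlinear_swap: "hlinear (hmap swap_tens)"
  by (simp add: hlinear_hmap)

lemma hswap_htens: "hmap swap_tens (htens v w) = htens w v"
  unfolding swap_tens_def
  by (rule hbilinear_ext[of "\<lambda>v w. hmap (rename prod.swap) (htens v w)" "\<lambda>v w. htens w v"])
    (intro hlinear_intros htens_left htens_right | simp)+

lemma hrename_id: "hmap (rename (\<lambda>x. x)) t = t"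
  by (rule hlinear_ext[of "hmap (rename (\<lambda>x. x))" "\<lambda>x. x"]) (simp_all add: hlinear_id)

lemma htmap_diff_left:
  assumes "hlinear f" "hlinear f'" "hlinear g"
  shows "htmap (\<lambda>x. f x - f' x) g t = htmap f g t - htmap f' g t"
  by (rule htens_ext[of "htmap (\<lambda>x. f x - f' x) g" "\<lambda>t. htmap f g t - htmap f' g t"])
    (simp_all add: hlinear_minus htmap_htens assms htens_simps)

lemma htmap_diff_right:
  assumes "hlinear f" "hlinear g" "hlinear g'"
  shows "htmap f (\<lambda>x. g x - g' x) t = htmap f g t - htmap f g' t"
  by (rule htens_ext[of "htmap f (\<lambda>x. g x - g' x)" "\<lambda>t. htmap f g t - htmap f g' t"])
    (simp_all add: hlinear_minus htmap_htens assms htens_simps)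

lemma htmap_X_left:
  assumes "hlinear f" "hlinear g"
  shows "htmap (\<lambda>x. hscl c (f x)) g t = hscl c (htmap f g t)"
  by (rule htens_ext[of "htmap (\<lambda>x. hscl c (f x)) g" "\<lambda>t. hscl c (htmap f g t)"])
    (simp_all add: hlinear_scale htmap_htens assms htens_simps)

lemma htmap_X_right:
  assumes "hlinear f" "hlinear g"
  shows "htmap f (\<lambda>x. hscl c (g x)) t = hscl c (htmap f g t)"
  by (rule htens_ext[of "htmap f (\<lambda>x. hscl c (g x))" "\<lambda>t. hscl c (htmap f g t)"])
    (simp_all add: hlinear_scale htmap_htens assms htens_simps)

abbreviation "rot \<equiv> hmap (rename (\<lambda>((a, b), c). ((b, c), a)))"
abbreviation "rot' \<equiv> hmap (rename (\<lambda>((a, b), c). ((c, a), b)))"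
abbreviation "swap12 \<equiv> hmap (rename (\<lambda>((a, b), c). ((b, a), c)))"

lemma htrilinear_ext:
  assumes "\<And>b c. hlinear (\<lambda>a. H a b c)" "\<And>a c. hlinear (\<lambda>b. H a b c)" "\<And>a b. hlinear (H a b)"
    and "\<And>b c. hlinear (\<lambda>a. K a b c)" "\<And>a c. hlinear (\<lambda>b. K a b c)" "\<And>a b. hlinear (K a b)"
    and "\<And>x y z. H (hbas x) (hbas y) (hbas z) = K (hbas x) (hbas y) (hbas z)"
  shows "H a b c = K a b c"
proof (rule hlinear_ext[of "\<lambda>a. H a b c" "\<lambda>a. K a b c"])
  show "H (hbas x) b c = K (hbas x) b c" for x
    by (rule hbilinear_ext[of "H (hbas x)" "K (hbas x)"]) (use assms in auto)
qed (use assms in auto)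

lemma rot_htens: "rot (htens (htens a b) c) = htens (htens b c) a"
  by (rule htrilinear_ext[of "\<lambda>a b c. rot (htens (htens a b) c)" "\<lambda>a b c. htens (htens b c) a"])
    (intro hlinear_intros htens_left htens_right | simp)+

lemma rot'_htens: "rot' (htens (htens a b) c) = htens (htens c a) b"
  by (rule htrilinear_ext[of "\<lambda>a b c. rot' (htens (htens a b) c)" "\<lambda>a b c. htens (htens c a) b"])
    (intro hlinear_intros htens_left htens_right | simp)+

lemma swap12_htens: "swap12 (htens (htens a b) c) = htens (htens b a) c"
  by (rule htrilinear_ext[of "\<lambda>a b c. swap12 (htens (htens a b) c)" "\<lambda>a b c. htens (htens b a) c"])
    (intro hlinear_intros htens_left htens_right | simp)+

lemma swap12_unassoc_htens:
  "hmap (rename (\<lambda>(a, b, c). ((b, a), c))) (htens a (htens b c)) = htens (htens b a) c"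
  by (rule htrilinear_ext[of "\<lambda>a b c. hmap (rename (\<lambda>(a, b, c). ((b, a), c))) (htens a (htens b c))"
        "\<lambda>a b c. htens (htens b a) c"])
    (intro hlinear_intros htens_left htens_right | simp)+

lemma swap12_unassoc:
  "hmap (rename (\<lambda>(a, b, c). ((b, a), c))) t = swap12 (hmap (rename unassoc) t)"
  by (simp add: hmap_rename_rename unassoc_def split_def)

lemmas htens3_rename = rot_htens rot'_htens swap12_htens swap12_unassoc_htens

text \<open>The semiclassical identities hold for \<open>D = \<Delta> - \<Delta>\<^sup>o\<^sup>p\<close> over \<open>k[[h]]\<close>; when \<open>D\<close> is divisible by
  \<open>h\<close>, dividing them by powers of \<open>h\<close> gives the identities for \<open>\<delta>\<close>.\<close>

locale cocomm_bialg = bialg Q for Q :: "('x, 'k::field_char_0) hbialg" +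
  assumes cocomm: "fps_nth (\<Delta> (fps_const x) - hmap swap_tens (\<Delta> (fps_const x))) 0 = 0"
begin

definition "D x = \<Delta> x - hmap swap_tens (\<Delta> x)"
definition "D' x = fps_shift 1 (D x)"
definition "mul0 x y = fps_nth (fps_const x \<odot> fps_const y) 0"
definition "mul20 s t = fps_nth (fps_const s \<odot>\<^sub>2 fps_const t) 0"
definition "one0 = fps_nth one 0"
definition "\<Delta>0 = cl \<Delta>"
definition "\<delta> = cl D'"
definition "\<epsilon>0 x = fps_nth (\<epsilon> (fps_const x)) 0"
definition "contract0 = cl (hcontract_left \<epsilon>)"

section \<open>Division of the antisymmetrized coproduct by \<open>h\<close>\<close>

lemma hlinear_opcomult: "hlinear (\<lambda>x. hmap swap_tens (\<Delta> x))"
  by (rule hlinear_compose[OF hlinear_swap hlinear_comult])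

lemma hlinear_D: "hlinear D"
  unfolding D_def[abs_def] by (rule hlinear_minus[OF hlinear_comult hlinear_opcomult])

lemma D_eq: "D x = hscl fps_X (D' x)"
proof -
  have "fps_nth (D x) 0 = cl D (fps_nth x 0)" by (rule hlinear_nth_0[OF hlinear_D])
  also have "\<dots> = 0" using cocomm by (simp add: cl_def D_def)
  finally show ?thesis using fps_split_const[of "D x"] by (simp add: D'_def)
qed

text \<open>Linearity of \<open>D\<close> is divided by \<open>h\<close>, using that multiplication
  by \<open>h\<close> is injective.\<close>

lemma hlinear_D': "hlinear D'"
proof (rule hlinearI)
  show "D' (x + y) = D' x + D' y" for x y
  proof -
    have "hscl fps_X (D' (x + y)) = hscl fps_X (D' x + D' y)"
      by (simp only: hscl.scale_right_distrib D_eq[symmetric] hlinear_add[OF hlinear_D])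
    then show ?thesis by (simp only: hscl_X_cancel)
  qed
  show "D' (hscl c x) = hscl c (D' x)" for c x
  proof -
    have "hscl fps_X (D' (hscl c x)) = hscl c (hscl fps_X (D' x))"
      by (simp only: D_eq[symmetric] hlinear_hscl[OF hlinear_D])
    then have "hscl fps_X (D' (hscl c x)) = hscl fps_X (hscl c (D' x))"
      by (simp add: mult.commute)
    then show ?thesis by (simp only: hscl_X_cancel)
  qed
qed

lemma klinear_\<Delta>0: "klinear \<Delta>0" and klinear_\<delta>: "klinear \<delta>" and klinear_contract0: "klinear contract0"
  by (simp_all add: \<Delta>0_def \<delta>_def contract0_def klinear_cl hlinear_comult hlinear_D')

lemma comult_nth_0: "fps_nth (\<Delta> v) 0 = \<Delta>0 (fps_nth v 0)"
  by (simp add: \<Delta>0_def hlinear_nth_0 hlinear_comult)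

lemma D'_nth_0: "fps_nth (D' v) 0 = \<delta> (fps_nth v 0)"
  by (simp add: \<delta>_def hlinear_nth_0 hlinear_D')

lemma \<delta>_eq: "\<delta> x = fps_nth (D (fps_const x)) 1"
  by (simp add: \<delta>_def cl_def D'_def)

lemma mul0_eq: "mul0 x y = cl (hmult Q) (tens x y)"
  by (simp add: mul0_def hmul_def htens_const cl_def)

lemma mul20_eq: "mul20 s t = cl (prod_mult (hmult Q) (hmult Q)) (tens s t)"
  by (simp add: mul20_def hmul2_def htens_const cl_def)

lemma mul_nth_0: "fps_nth (v \<odot> w) 0 = mul0 (fps_nth v 0) (fps_nth w 0)"
  by (simp add: mul0_eq hmul_def hlinear_nth_0 hlinear_mult)

lemma mul2_nth_0: "fps_nth (s \<odot>\<^sub>2 t) 0 = mul20 (fps_nth s 0) (fps_nth t 0)"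
  by (simp add: mul20_eq hmul2_def hlinear_nth_0)

lemma klinear_mul0: "klinear (\<lambda>x. mul0 x y)" "klinear (\<lambda>y. mul0 x y)"
  unfolding mul0_eq by (intro klinear_compose[OF klinear_cl[OF hlinear_mult]] tens_left tens_right)+

lemma klinear_mul20: "klinear (\<lambda>s. mul20 s t)" "klinear (\<lambda>t. mul20 s t)"
  unfolding mul20_eq by (intro klinear_compose[OF klinear_cl[OF hlinear_prod_mult]] tens_left tens_right)+

lemma mul0_assoc: "mul0 (mul0 x y) z = mul0 x (mul0 y z)"
  using arg_cong[OF m1.assoc[of "fps_const x" "fps_const y" "fps_const z"], of "\<lambda>v. fps_nth v 0"]
  by (simp add: mul_nth_0)

lemma mul0_one: "mul0 one0 x = x" "mul0 x one0 = x"
  using mul_nth_0[of one "fps_const x"] mul_nth_0[of "fps_const x" one] by (simp_all add: one0_def)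

lemma mul20_tens: "mul20 (tens a b) (tens c d) = tens (mul0 a c) (mul0 b d)"
  using arg_cong[OF mul2_htens[of "fps_const a" "fps_const b" "fps_const c" "fps_const d"],
      of "\<lambda>v. fps_nth v 0"]
  by (simp add: mul_nth_0 mul2_nth_0)

lemma mul20_one: "mul20 (tens one0 one0) t = t" "mul20 t (tens one0 one0) = t"
proof -
  have "fps_nth (hunit2 Q) 0 = tens one0 one0" by (simp add: hunit2_def one0_def)
  then show "mul20 (tens one0 one0) t = t" "mul20 t (tens one0 one0) = t"
    using mul2_nth_0[of "hunit2 Q" "fps_const t"] mul2_nth_0[of "fps_const t" "hunit2 Q"]
    by simp_all
qed

lemma \<Delta>0_mul: "\<Delta>0 (mul0 x y) = mul20 (\<Delta>0 x) (\<Delta>0 y)"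
  using arg_cong[OF comult_mul[of "fps_const x" "fps_const y"], of "\<lambda>v. fps_nth v 0"]
  by (simp add: comult_nth_0 mul_nth_0 mul2_nth_0)

lemma \<Delta>0_one: "\<Delta>0 one0 = tens one0 one0"
  using arg_cong[OF comult_one, of "\<lambda>v. fps_nth v 0"]
  by (simp add: comult_nth_0 one0_def hunit2_def)

lemma \<epsilon>_nth_0: "fps_nth (\<epsilon> v) 0 = \<epsilon>0 (fps_nth v 0)"
  using arg_cong[OF fps_split_const[of v], of "\<lambda>v. fps_nth (\<epsilon> v) 0"]
  by (simp add: \<epsilon>0_def hfunctional_add[OF hfunctional_counit] hfunctional_hscl[OF hfunctional_counit])

lemma \<epsilon>0_mul: "\<epsilon>0 (mul0 x y) = \<epsilon>0 x * \<epsilon>0 y"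
  using arg_cong[OF counit_mul[of "fps_const x" "fps_const y"], of "\<lambda>v. fps_nth v 0"]
  by (simp add: \<epsilon>_nth_0 mul_nth_0)

lemma \<epsilon>0_one: "\<epsilon>0 one0 = 1"
  using arg_cong[OF counit_one, of "\<lambda>v. fps_nth v 0"] by (simp add: \<epsilon>_nth_0 one0_def)

lemma \<epsilon>0_add: "\<epsilon>0 (x + y) = \<epsilon>0 x + \<epsilon>0 y"
  using \<epsilon>_nth_0[of "fps_const x + fps_const y"]
  by (simp add: \<epsilon>0_def hfunctional_add[OF hfunctional_counit] del: fps_const_add)

lemma \<epsilon>0_scl: "\<epsilon>0 (scl c x) = c * \<epsilon>0 x"
  using \<epsilon>_nth_0[of "hscl (fps_const c) (fps_const x)"]
  by (simp add: \<epsilon>0_def hfunctional_hscl[OF hfunctional_counit] hscl_nth_0)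

lemma contract0_tens: "contract0 (tens a b) = scl (\<epsilon>0 a) b"
proof -
  have "contract0 (tens a b) = fps_nth (hcontract_left \<epsilon> (htens (fps_const a) (fps_const b))) 0"
    by (simp add: contract0_def hlinear_nth_0)
  then show ?thesis
    by (simp add: hcontract_left_htens hfunctional_counit hscl_nth_0 \<epsilon>_nth_0)
qed

lemma contract0_\<Delta>0: "contract0 (\<Delta>0 x) = x"
  by (simp add: contract0_def \<Delta>0_def cl_compose counit_left)

lemma \<Delta>0_coassoc: "rename unassoc (tmap (\<lambda>x. x) \<Delta>0 (\<Delta>0 x)) = tmap \<Delta>0 (\<lambda>x. x) (\<Delta>0 x)"
  using arg_cong[OF coassoc[of "fps_const x"], of "\<lambda>v. fps_nth v 0"]
  by (simp add: hlinear_nth_0 cl_htmap hlinear_id hlinear_comult \<Delta>0_def)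

lemma \<Delta>0_cocomm: "swap_tens (\<Delta>0 x) = \<Delta>0 x"
  using cocomm[of x] by (simp add: \<Delta>0_def cl_def)

lemma hswap_mul2: "hmap swap_tens (s \<odot>\<^sub>2 t) = hmap swap_tens s \<odot>\<^sub>2 hmap swap_tens t"
  by (rule htens_ext2[of "\<lambda>s t. hmap swap_tens (s \<odot>\<^sub>2 t)" "\<lambda>s t. hmap swap_tens s \<odot>\<^sub>2 hmap swap_tens t"])
    (intro lin_intros hlinear_compose[OF hlinear_swap] hlinear_swap
      | simp add: mul2_htens hswap_htens)+

lemma \<delta>_mul: "\<delta> (mul0 x y) = mul20 (\<delta> x) (\<Delta>0 y) + mul20 (\<Delta>0 x) (\<delta> y)"
proof -
  let ?x = "fps_const x" and ?y = "fps_const y"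
  let ?o = "hmap swap_tens (\<Delta> ?x)"
  note diff = hlinear_diff[OF mul2_left[OF hlinear_id]] hlinear_diff[OF mul2_right[OF hlinear_id]]
  note hs = hlinear_hscl[OF mul2_left[OF hlinear_id]] hlinear_hscl[OF mul2_right[OF hlinear_id]]
  \<comment> \<open>The mixed term, opposite coproduct of \<open>?x\<close> times coproduct of
    \<open>?y\<close>, is added and subtracted. After division by \<open>h\<close> the opposite
    coproduct may be replaced by \<Delta>, as they agree modulo \<open>h\<close>.\<close>
  have "D (?x \<odot> ?y) = D ?x \<odot>\<^sub>2 \<Delta> ?y + ?o \<odot>\<^sub>2 D ?y"
    by (simp add: D_def comult_mul hswap_mul2 diff)
  then have "hscl fps_X (D' (?x \<odot> ?y)) = hscl fps_X (D' ?x \<odot>\<^sub>2 \<Delta> ?y + ?o \<odot>\<^sub>2 D' ?y)"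
    by (simp only: D_eq hs hscl.scale_right_distrib)
  then have "fps_nth (D' (?x \<odot> ?y)) 0 = fps_nth (D' ?x \<odot>\<^sub>2 \<Delta> ?y + ?o \<odot>\<^sub>2 D' ?y) 0"
    by (simp only: hscl_X_cancel)
  then show ?thesis
    by (simp add: D'_nth_0 mul_nth_0 mul2_nth_0 comult_nth_0 \<Delta>0_cocomm)
qed

lemma \<delta>_one: "\<delta> one0 = 0"
proof -
  have "D one = 0" by (simp add: D_def comult_one hunit2_def hswap_htens)
  then have "hscl fps_X (D' one) = hscl fps_X 0" by (simp flip: D_eq)
  then show ?thesis using D'_nth_0[of one] by (simp only: hscl_X_cancel one0_def) simp
qed

lemma \<delta>_antisym: "swap_tens (\<delta> x) = - \<delta> x"
proof -
  have swap_swap: "swap_tens (swap_tens t) = t" for t :: "'x \<times> 'x \<Rightarrow>\<^sub>0 'k"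
    by (rule tens_ext[of "\<lambda>t. swap_tens (swap_tens t)" "\<lambda>t. t"])
      (simp_all add: klinear_compose klinear_id swap_tens_tens)
  show ?thesis
    by (simp add: \<delta>_eq D_def klinear_diff[OF klinear_swap_tens] swap_swap)
qed

text \<open>By coassociativity, every iterate of \<Delta> and its opposite on three legs is a leg
  permutation of this tensor. The coderivation property and co-Jacobi thus become cancellations
  between permutations of \<open>T x\<close>.\<close>

abbreviation "T x \<equiv> htmap \<Delta> (\<lambda>x. x) (\<Delta> x)"
lemma id_comult_swap: "hmap (rename unassoc) (htmap (\<lambda>x. x) \<Delta> (hmap swap_tens t)) = rot' (htmap \<Delta> (\<lambda>x. x) t)"
proof (rule htens_ext[of "\<lambda>t. hmap (rename unassoc) (htmap (\<lambda>x. x) \<Delta> (hmap swap_tens t))"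
      "\<lambda>t. rot' (htmap \<Delta> (\<lambda>x. x) t)"])
  have *: "hmap (rename unassoc) (htens w s) = rot' (htens s w)" for s w
    by (rule htens_ext[of "\<lambda>s. hmap (rename unassoc) (htens w s)" "\<lambda>s. rot' (htens s w)"])
      (intro hlinear_intros | simp add: unassoc_htens htens3_rename)+
  show "hmap (rename unassoc) (htmap (\<lambda>x. x) \<Delta> (hmap swap_tens (htens v w))) =
      rot' (htmap \<Delta> (\<lambda>x. x) (htens v w))" for v w
    by (simp add: hswap_htens htmap_htens hlinear_id hlinear_comult *)
qed (intro lin_intros hlinear_swap hlinear_htmap | simp)+

lemma comult_id_swap:
  "htmap \<Delta> (\<lambda>x. x) (hmap swap_tens t) = rot (hmap (rename unassoc) (htmap (\<lambda>x. x) \<Delta> t))"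
proof (rule htens_ext[of "\<lambda>t. htmap \<Delta> (\<lambda>x. x) (hmap swap_tens t)"
      "\<lambda>t. rot (hmap (rename unassoc) (htmap (\<lambda>x. x) \<Delta> t))"])
  have *: "htens s w = rot (hmap (rename unassoc) (htens w s))" for s w
    by (rule htens_ext[of "\<lambda>s. htens s w" "\<lambda>s. rot (hmap (rename unassoc) (htens w s))"])
      (intro hlinear_intros htens_left | simp add: unassoc_htens htens3_rename)+
  show "htmap \<Delta> (\<lambda>x. x) (hmap swap_tens (htens v w)) =
      rot (hmap (rename unassoc) (htmap (\<lambda>x. x) \<Delta> (htens v w)))" for v w
    by (simp add: hswap_htens htmap_htens hlinear_id hlinear_comult flip: *)
qed (intro lin_intros hlinear_swap hlinear_htmap | simp)+

lemma opcomult_id: "htmap (\<lambda>x. hmap swap_tens (\<Delta> x)) (\<lambda>x. x) t = swap12 (htmap \<Delta> (\<lambda>x. x) t)"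
proof (rule htens_ext[of "htmap (\<lambda>x. hmap swap_tens (\<Delta> x)) (\<lambda>x. x)"
      "\<lambda>t. swap12 (htmap \<Delta> (\<lambda>x. x) t)"])
  have *: "htens (hmap swap_tens s) w = swap12 (htens s w)" for s w
    by (rule htens_ext[of "\<lambda>s. htens (hmap swap_tens s) w" "\<lambda>s. swap12 (htens s w)"])
      (intro hlinear_intros hlinear_swap | simp add: hswap_htens htens3_rename)+
  show "htmap (\<lambda>x. hmap swap_tens (\<Delta> x)) (\<lambda>x. x) (htens v w) = swap12 (htmap \<Delta> (\<lambda>x. x) (htens v w))" for v w
    by (simp add: htmap_htens hlinear_id hlinear_comult hlinear_opcomult *)
qed (intro lin_intros hlinear_htmap | simp)+

lemma D_id: "htmap D (\<lambda>x. x) t = htmap \<Delta> (\<lambda>x. x) t - swap12 (htmap \<Delta> (\<lambda>x. x) t)"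
  unfolding D_def[abs_def]
  by (simp add: htmap_diff_left hlinear_comult hlinear_opcomult hlinear_id opcomult_id)

lemma id_D:
  "hmap (rename (\<lambda>(a, b, c). ((b, a), c))) (htmap (\<lambda>x. x) D t) =
    swap12 (hmap (rename unassoc) (htmap (\<lambda>x. x) \<Delta> t)) -
    rot' (hmap (rename unassoc) (htmap (\<lambda>x. x) \<Delta> t))"
proof -
  let ?\<sigma> = "hmap (rename (\<lambda>(a, b, c). ((b, a), c)))"
  have 2: "?\<sigma> (htens v (hmap swap_tens s)) = rot' (hmap (rename unassoc) (htens v s))" for v s
    by (rule htens_ext[of "\<lambda>s. ?\<sigma> (htens v (hmap swap_tens s))"
          "\<lambda>s. rot' (hmap (rename unassoc) (htens v s))"])
      (intro hlinear_intros hlinear_swap | simp add: hswap_htens unassoc_htens htens3_rename)+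
  have 3: "?\<sigma> (htmap (\<lambda>x. x) (\<lambda>x. hmap swap_tens (\<Delta> x)) t) =
      rot' (hmap (rename unassoc) (htmap (\<lambda>x. x) \<Delta> t))" for t
    by (rule htens_ext[of "\<lambda>t. ?\<sigma> (htmap (\<lambda>x. x) (\<lambda>x. hmap swap_tens (\<Delta> x)) t)"
          "\<lambda>t. rot' (hmap (rename unassoc) (htmap (\<lambda>x. x) \<Delta> t))"])
      (intro lin_intros hlinear_htmap
        | simp add: htmap_htens hlinear_id hlinear_comult hlinear_opcomult 2)+
  show ?thesis
    unfolding D_def[abs_def]
    by (simp add: htmap_diff_right hlinear_comult hlinear_opcomult hlinear_id hlinear_diff[OF hlinear_rename] 3)
      (rule swap12_unassoc)
qed

text \<open>With \<open>T\<close> for the iterated coproduct, the identity before division by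
  \<open>h\<close> is \<open>T - rot' T = (T - swap12 T) + (swap12 T - rot' T)\<close>.\<close>

lemma \<delta>_coderivation:
  "rename unassoc (tmap (\<lambda>x. x) \<Delta>0 (\<delta> x)) =
    tmap \<delta> (\<lambda>x. x) (\<Delta>0 x) + rename (\<lambda>(x, y, z). ((y, x), z)) (tmap (\<lambda>x. x) \<delta> (\<Delta>0 x))"
proof -
  let ?x = "fps_const x" and ?U = "hmap (rename unassoc)" and ?\<sigma> = "hmap (rename (\<lambda>(a, b, c). ((b, a), c)))"
  have "?U (htmap (\<lambda>x. x) \<Delta> (D ?x)) = T ?x - rot' (T ?x)"
    unfolding D_def
    by (simp add: hlinear_diff[OF hlinear_htmap] hlinear_diff[OF hlinear_rename] id_comult_swap coassoc)
  also have "\<dots> = htmap D (\<lambda>x. x) (\<Delta> ?x) + ?\<sigma> (htmap (\<lambda>x. x) D (\<Delta> ?x))"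
    by (simp add: D_id id_D coassoc)
  finally have "?U (htmap (\<lambda>x. x) \<Delta> (hscl fps_X (D' ?x))) =
      htmap (\<lambda>x. hscl fps_X (D' x)) (\<lambda>x. x) (\<Delta> ?x) + ?\<sigma> (htmap (\<lambda>x. x) (\<lambda>x. hscl fps_X (D' x)) (\<Delta> ?x))"
    by (simp only: D_eq[abs_def])
  then have "hscl fps_X (?U (htmap (\<lambda>x. x) \<Delta> (D' ?x))) =
      hscl fps_X (htmap D' (\<lambda>x. x) (\<Delta> ?x) + ?\<sigma> (htmap (\<lambda>x. x) D' (\<Delta> ?x)))"
    by (simp add: htmap_X_left htmap_X_right hlinear_D' hlinear_id hlinear_hscl[OF hlinear_htmap]
        hlinear_hscl[OF hlinear_rename] hscl.scale_right_distrib)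
  then have "?U (htmap (\<lambda>x. x) \<Delta> (D' ?x)) =
      htmap D' (\<lambda>x. x) (\<Delta> ?x) + ?\<sigma> (htmap (\<lambda>x. x) D' (\<Delta> ?x))"
    by (simp only: hscl_X_cancel)
  from arg_cong[OF this, of "\<lambda>v. fps_nth v 0"] show ?thesis
    by (simp add: hlinear_nth_0[OF hlinear_htmap] cl_htmap hlinear_id hlinear_comult hlinear_D'
        comult_nth_0 D'_nth_0 flip: \<Delta>0_def \<delta>_def)
qed

text \<open>Before division by \<open>h^2\<close> the tensor is
  \<open>T - rot T - (swap12 T - swap12 (rot T))\<close>. Cyclic summation forgets
  \<open>rot\<close>, also under \<open>swap12\<close>, since a transposition normalizes the cyclic
  group.\<close>

lemma \<delta>_coJacobi: "cyc_sum (tmap \<delta> (\<lambda>x. x) (\<delta> x)) = 0"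
proof -
  let ?x = "fps_const x"
  let ?J = "htmap D (\<lambda>x. x) (D ?x)"
  have J: "?J = T ?x - rot (T ?x) - (swap12 (T ?x) - swap12 (rot (T ?x)))"
    by (simp add: D_id D_def[of ?x] hlinear_diff[OF hlinear_htmap] hlinear_diff[OF hlinear_rename]
        comult_id_swap coassoc)
  have cyc: "hmap cyc_sum t = t + rot t + rot' t" for t :: "(('x \<times> 'x) \<times> 'x \<Rightarrow>\<^sub>0 'k) fps"
    by (rule fps_ext) (simp add: cyc_sum_def)
  have "hmap cyc_sum ?J = 0"
    unfolding J cyc
    by (simp add: hlinear_diff[OF hlinear_rename] hmap_rename_rename split_def hrename_id)
  moreover have "?J = hscl fps_X (hscl fps_X (htmap D' (\<lambda>x. x) (D' ?x)))"
    by (simp add: D_eq[abs_def] htmap_X_left hlinear_D' hlinear_id hlinear_hscl[OF hlinear_htmap])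
  ultimately have "hscl fps_X (hscl fps_X (hmap cyc_sum (htmap D' (\<lambda>x. x) (D' ?x)))) = hscl fps_X (hscl fps_X 0)"
    by (simp add: hlinear_hscl[OF hlinear_hmap[OF klinear_cyc_sum]])
  then have "hmap cyc_sum (htmap D' (\<lambda>x. x) (D' ?x)) = 0"
    by (simp only: hscl_X_cancel)
  from arg_cong[OF this, of "\<lambda>v. fps_nth v 0"] show ?thesis
    by (simp add: hlinear_nth_0[OF hlinear_htmap] cl_htmap hlinear_id hlinear_D' D'_nth_0 flip: \<delta>_def)
qed

end

section \<open>Quantizations of presented co-Poisson bialgebras\<close>

lemma fmul_bas [simp]: "fmul (bas u) (bas v) = bas (u @ v)"
  by (simp add: fmul_def)

lemma klinear_fmul: "klinear (\<lambda>p. fmul p q)" "klinear (\<lambda>q. fmul p q)"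
  unfolding fmul_def by (intro klinear_intros)+

lemma fmul2_bas [simp]: "fmul2 (bas (u, v)) (bas (u', v')) = bas (u @ u', v @ v')"
  by (simp add: fmul2_def)

lemma klinear_fmul2: "klinear (\<lambda>s. fmul2 s t)" "klinear (\<lambda>t. fmul2 s t)"
  unfolding fmul2_def by (intro klinear_intros)+

lemma klinear_pcomult [simp]: "klinear (pcomult P)" and klinear_pcobracket [simp]: "klinear (pcobracket P)"
  by (simp_all add: pcomult_def pcobracket_def)

lemma fmul2_assoc: "fmul2 (fmul2 s t) u = fmul2 s (fmul2 t u)"
proof (rule trilinear_ext[of "\<lambda>s t u. fmul2 (fmul2 s t) u" "\<lambda>s t u. fmul2 s (fmul2 t u)"])
  show "fmul2 (fmul2 (bas x) (bas y)) (bas z) = fmul2 (bas x) (fmul2 (bas y) (bas z))"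
    for x y z :: "'a list \<times> 'a list"
    by (cases x; cases y; cases z) simp
qed (intro klinear_compose[OF klinear_fmul2(1)] klinear_compose[OF klinear_fmul2(2)] klinear_fmul2 klinear_id)+

lemma word_comult_append: "word_comult P (u @ v) = fmul2 (word_comult P u) (word_comult P v)"
proof (induction u)
  case Nil
  have "fmul2 (bas ([], [])) t = t" for t :: "'a list \<times> 'a list \<Rightarrow>\<^sub>0 'b"
    by (rule klinear_ext[of "\<lambda>t. fmul2 (bas ([], [])) t" "\<lambda>t. t"])
      (auto intro: klinear_fmul2 klinear_id)
  then show ?case by simp
qed (simp add: fmul2_assoc)

lemma word_cobracket_append: "word_cobracket P (u @ v) =
    fmul2 (word_cobracket P u) (word_comult P v) + fmul2 (word_comult P u) (word_cobracket P v)"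
proof (induction u)
  case Nil
  have "fmul2 (bas ([], [])) t = t" for t :: "'a list \<times> 'a list \<Rightarrow>\<^sub>0 'b"
    by (rule klinear_ext[of "\<lambda>t. fmul2 (bas ([], [])) t" "\<lambda>t. t"])
      (auto intro: klinear_fmul2 klinear_id)
  then show ?case by (simp add: klinear_0[OF klinear_fmul2(1)])
qed (simp add: fmul2_assoc word_comult_append klinear_add[OF klinear_fmul2(1)]
    klinear_add[OF klinear_fmul2(2)])

lemma pcobracket_fmul:
  "pcobracket P (fmul s t) = fmul2 (pcobracket P s) (pcomult P t) + fmul2 (pcomult P s) (pcobracket P t)"
  by (rule bilinear_ext[of "\<lambda>s t. pcobracket P (fmul s t)"
        "\<lambda>s t. fmul2 (pcobracket P s) (pcomult P t) + fmul2 (pcomult P s) (pcobracket P t)"])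
    (intro klinear_compose[OF klinear_pcobracket] klinear_compose[OF klinear_fmul2(1)] klinear_plus
      klinear_compose[OF klinear_fmul2(2)] klinear_fmul klinear_pcomult klinear_pcobracket
      | simp add: pcomult_def pcobracket_def word_cobracket_append)+

lemma pideal_sandwich: "r \<in> rels P \<Longrightarrow> fmul (fmul a r) b \<in> pideal P"
  unfolding pideal_def by (intro scl.span_base) blast

lemma rename_unassoc_tens: "rename unassoc (tens a (tens b c)) = tens (tens a b) c"
  by (rule trilinear_ext[of "\<lambda>a b c. rename unassoc (tens a (tens b c))" "\<lambda>a b c. tens (tens a b) c"])
    (intro klinear_intros | simp add: unassoc_def)+

lemma rename_flip12_tens: "rename (\<lambda>(x, y, z). ((y, x), z)) (tens a (tens b c)) = tens (tens b a) c"
  by (rule trilinear_ext[of "\<lambda>a b c. rename (\<lambda>(x, y, z). ((y, x), z)) (tens a (tens b c))"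
        "\<lambda>a b c. tens (tens b a) c"])
    (intro klinear_intros | simp)+

lemma tens_ext_right:
  assumes "klinear F" "klinear G" "\<And>a b c. F (tens a (tens b c)) = G (tens a (tens b c))"
  shows "F t = G t"
  using assms(1,2)
proof (rule klinear_ext)
  show "F (bas x) = G (bas x)" for x
    using assms(3)[of "bas (fst x)" "bas (fst (snd x))" "bas (snd (snd x))"] by simp
qed

lemma tmap_unassoc:
  assumes "klinear f"
  shows "tmap (tmap f f) f (rename unassoc t) = rename unassoc (tmap f (tmap f f) t)"
  by (rule tens_ext_right[of "\<lambda>t. tmap (tmap f f) f (rename unassoc t)"
        "\<lambda>t. rename unassoc (tmap f (tmap f f) t)"])
    (intro klinear_tmap_comp klinear_compose[OF klinear_rename] klinear_rename klinear_tmap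
      | simp add: tmap_tens assms rename_unassoc_tens)+

lemma tmap_flip12:
  assumes "klinear f"
  shows "tmap (tmap f f) f (rename (\<lambda>(x, y, z). ((y, x), z)) t) =
    rename (\<lambda>(x, y, z). ((y, x), z)) (tmap f (tmap f f) t)"
  by (rule tens_ext_right[of "\<lambda>t. tmap (tmap f f) f (rename (\<lambda>(x, y, z). ((y, x), z)) t)"
        "\<lambda>t. rename (\<lambda>(x, y, z). ((y, x), z)) (tmap f (tmap f f) t)"])
    (intro klinear_tmap_comp klinear_compose[OF klinear_rename] klinear_rename klinear_tmap
      | simp add: tmap_tens assms rename_flip12_tens)+

context cocomm_bialg
begin

text \<open>The algebra morphism from the free algebra to the classical limit of \<open>Q\<close>
  determined by images \<open>r\<close> of the generators.\<close>

definition eval :: "('g \<Rightarrow> ('x \<Rightarrow>\<^sub>0 'k)) \<Rightarrow> ('g list \<Rightarrow>\<^sub>0 'k) \<Rightarrow> ('x \<Rightarrow>\<^sub>0 'k)" where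
  "eval r = lext (\<lambda>w. foldr (\<lambda>s. mul0 (r s)) w one0)"

lemma klinear_eval [simp]: "klinear (eval r)"
  by (simp add: eval_def)

lemma eval_Nil: "eval r (bas []) = one0"
  by (simp add: eval_def)

lemma eval_Cons: "eval r (bas (s # w)) = mul0 (r s) (eval r (bas w))"
  by (simp add: eval_def)

lemma eval_gen: "eval r (bas [s]) = r s"
  by (simp add: eval_Cons eval_Nil mul0_one)

lemma eval_append: "eval r (bas (u @ v)) = mul0 (eval r (bas u)) (eval r (bas v))"
  by (induction u) (simp_all add: eval_Nil eval_Cons mul0_one mul0_assoc)

lemma eval_fmul: "eval r (fmul s t) = mul0 (eval r s) (eval r t)"
  by (rule bilinear_ext[of "\<lambda>s t. eval r (fmul s t)" "\<lambda>s t. mul0 (eval r s) (eval r t)"])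
    (intro klinear_compose[OF klinear_eval] klinear_compose[OF klinear_mul0(1)]
      klinear_compose[OF klinear_mul0(2)] klinear_fmul klinear_eval
      | simp add: eval_append)+

lemma eval2_fmul2:
  "tmap (eval r) (eval r) (fmul2 s t) = mul20 (tmap (eval r) (eval r) s) (tmap (eval r) (eval r) t)"
proof (rule bilinear_ext[of "\<lambda>s t. tmap (eval r) (eval r) (fmul2 s t)"
      "\<lambda>s t. mul20 (tmap (eval r) (eval r) s) (tmap (eval r) (eval r) t)"])
  have tb: "tmap (eval r) (eval r) (bas (u, v)) = tens (eval r (bas u)) (eval r (bas v))" for u v
    by (simp add: tmap_def)
  show "tmap (eval r) (eval r) (fmul2 (bas x) (bas y)) =
      mul20 (tmap (eval r) (eval r) (bas x)) (tmap (eval r) (eval r) (bas y))" for x y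
    by (cases x; cases y) (simp add: tb mul20_tens eval_append)
qed (intro klinear_tmap_comp klinear_compose[OF klinear_mul20(1)]
      klinear_compose[OF klinear_mul20(2)] klinear_fmul2 klinear_tmap)+

end

text \<open>The normal form map \<open>\<phi>\<close> is a section of the evaluation of words in the classical limit of \<open>Q\<close>, so
  that the ideals \<open>pideal P\<close>, \<open>pnull2 P\<close> and \<open>pnull3 P\<close> are the kernels of this evaluation.\<close>

locale presented = cocomm_bialg Q for Q :: "('x, 'k::field_char_0) hbialg" +
  fixes P :: "('g, 'k) presentation"
    and \<phi> :: "('x \<Rightarrow>\<^sub>0 'k) \<Rightarrow> ('g list \<Rightarrow>\<^sub>0 'k)"
    and r :: "'g \<Rightarrow> ('x \<Rightarrow>\<^sub>0 'k)"
  assumes \<phi>_lin: "klinear \<phi>"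
    and rels: "s \<in> rels P \<Longrightarrow> eval r s = 0"
    and eval_\<phi>: "eval r (\<phi> x) = x"
    and surj: "\<exists>x. \<phi> x - bas u \<in> pideal P"
    and gen_comult: "\<Delta>0 (r a) = tmap (eval r) (eval r) (gen_comult P a)"
    and gen_counit: "\<epsilon>0 (r a) = gen_counit P a"
    and gen_cobracket: "\<delta> (r a) = tmap (eval r) (eval r) (gen_cobracket P a)"
begin

abbreviation "\<rho> \<equiv> eval r"
abbreviation "\<rho>2 \<equiv> tmap \<rho> \<rho>"
abbreviation "\<rho>3 \<equiv> tmap \<rho>2 \<rho>"

lemma \<rho>_pideal: "t \<in> pideal P \<Longrightarrow> \<rho> t = 0"
  unfolding pideal_def
  by (rule klinear_span_0[OF klinear_eval])
    (auto simp: eval_fmul rels klinear_0[OF klinear_mul0(1)] klinear_0[OF klinear_mul0(2)])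

lemma \<phi>\<rho>: "\<phi> (\<rho> t) - t \<in> pideal P"
  unfolding pideal_def
proof (rule klinear_mod_ext[where d = "\<lambda>t. \<phi> (\<rho> t) - t"])
  fix u
  \<comment> \<open>Surjectivity provides some normal form of the word; applying \<rho> to the
    congruence identifies it as \<open>\<phi> (\<rho> (bas u))\<close>.\<close>
  obtain x where x: "\<phi> x - bas u \<in> pideal P" using surj by blast
  then have "x = \<rho> (bas u)"
    using \<rho>_pideal[OF x] by (simp add: klinear_diff[OF klinear_eval] eval_\<phi>)
  then show "\<phi> (\<rho> (bas u)) - bas u \<in> module.span scl {fmul (fmul a r) b |a r b. r \<in> rels P}"
    using x by (simp add: pideal_def)
qed (intro klinear_minus klinear_compose[OF \<phi>_lin] klinear_eval klinear_id)

lemma pideal_iff: "t \<in> pideal P \<longleftrightarrow> \<rho> t = 0"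
proof
  assume "\<rho> t = 0"
  then have "- t \<in> pideal P" using \<phi>\<rho>[of t] by (simp add: klinear_0[OF \<phi>_lin])
  then show "t \<in> pideal P" unfolding pideal_def using scl.span_neg by fastforce
qed (rule \<rho>_pideal)

lemma pideal_dual: "t - \<phi> (\<rho> t) \<in> pideal P"
  by (simp add: pideal_iff klinear_diff[OF klinear_eval] eval_\<phi>)

text \<open>One leg is replaced at a time, each replacement costing a tensor with one factor in the
  ideal.\<close>

lemma pnull2_step: "tens p q - tens (\<phi> (\<rho> p)) (\<phi> (\<rho> q)) \<in> pnull2 P"
proof -
  have "tens p q - tens (\<phi> (\<rho> p)) (\<phi> (\<rho> q)) =
      tens (p - \<phi> (\<rho> p)) q + tens (\<phi> (\<rho> p)) (q - \<phi> (\<rho> q))"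
    by (simp add: tens_simps)
  moreover have "tens (p - \<phi> (\<rho> p)) q \<in> pnull2 P" "tens (\<phi> (\<rho> p)) (q - \<phi> (\<rho> q)) \<in> pnull2 P"
    unfolding pnull2_def using pideal_dual by (blast intro: scl.span_base)+
  ultimately show ?thesis unfolding pnull2_def by (simp add: scl.span_add)
qed

lemma pnull3_step:
  "tens (tens p q) s - tens (tens (\<phi> (\<rho> p)) (\<phi> (\<rho> q))) (\<phi> (\<rho> s)) \<in> pnull3 P"
proof -
  let ?p = "\<phi> (\<rho> p)" and ?q = "\<phi> (\<rho> q)" and ?s = "\<phi> (\<rho> s)"
  have "tens (tens p q) s - tens (tens ?p ?q) ?s =
      tens (tens (p - ?p) q) s + tens (tens ?p (q - ?q)) s + tens (tens ?p ?q) (s - ?s)"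
    by (simp add: tens_simps)
  moreover have "tens (tens (p - ?p) q) s \<in> pnull3 P" "tens (tens ?p (q - ?q)) s \<in> pnull3 P"
    "tens (tens ?p ?q) (s - ?s) \<in> pnull3 P"
    unfolding pnull3_def using pideal_dual by (blast intro: scl.span_base)+
  ultimately show ?thesis unfolding pnull3_def by (simp add: scl.span_add)
qed

text \<open>The kernel of \<open>\<rho> \<otimes> \<rho>\<close> lies in
  \<open>I \<otimes> T + T \<otimes> I\<close>: modulo the latter, \<open>t\<close> equals its
  normal form, which depends only on \<open>\<rho>2 t\<close>.\<close>

lemma pnull2I:
  assumes "\<rho>2 t = 0"
  shows "t \<in> pnull2 P"
proof -
  have \<phi>\<rho>_lin: "klinear (\<lambda>x. \<phi> (\<rho> x))" by (rule klinear_compose[OF \<phi>_lin klinear_eval])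
  have "t - tmap (\<lambda>x. \<phi> (\<rho> x)) (\<lambda>x. \<phi> (\<rho> x)) t \<in> pnull2 P"
    unfolding pnull2_def
  proof (rule klinear_mod_ext[where d = "\<lambda>t. t - tmap (\<lambda>x. \<phi> (\<rho> x)) (\<lambda>x. \<phi> (\<rho> x)) t"])
    show "bas x - tmap (\<lambda>x. \<phi> (\<rho> x)) (\<lambda>x. \<phi> (\<rho> x)) (bas x) \<in>
        module.span scl {tens a b |a b. a \<in> pideal P \<or> b \<in> pideal P}" for x
      using pnull2_step[of "bas (fst x)" "bas (snd x)"]
      by (simp add: pnull2_def tmap_def case_prod_beta)
  qed (intro klinear_minus klinear_id klinear_tmap)
  moreover have "tmap (\<lambda>x. \<phi> (\<rho> x)) (\<lambda>x. \<phi> (\<rho> x)) t = tmap \<phi> \<phi> (\<rho>2 t)"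
    by (simp add: tmap_tmap \<phi>_lin)
  ultimately show ?thesis by (simp add: assms klinear_0[OF klinear_tmap])
qed

lemma pnull3I:
  assumes "\<rho>3 t = 0"
  shows "t \<in> pnull3 P"
proof -
  let ?n = "\<lambda>x. \<phi> (\<rho> x)"
  have n_lin: "klinear ?n" by (rule klinear_compose[OF \<phi>_lin klinear_eval])
  have "t - tmap (tmap ?n ?n) ?n t \<in> pnull3 P"
    unfolding pnull3_def
  proof (rule klinear_mod_ext[where d = "\<lambda>t. t - tmap (tmap ?n ?n) ?n t"])
    show "bas x - tmap (tmap ?n ?n) ?n (bas x) \<in>
        module.span scl {tens (tens a b) c |a b c. a \<in> pideal P \<or> b \<in> pideal P \<or> c \<in> pideal P}" for x
      using pnull3_step[of "bas (fst (fst x))" "bas (snd (fst x))" "bas (snd x)"]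
      by (simp add: pnull3_def tmap_def case_prod_beta)
  qed (intro klinear_minus klinear_id klinear_tmap)
  moreover have "tmap (tmap ?n ?n) ?n t = tmap (tmap \<phi> \<phi>) \<phi> (\<rho>3 t)"
    by (simp add: tmap_tmap \<phi>_lin)
  ultimately show ?thesis by (simp add: assms klinear_0[OF klinear_tmap])
qed

lemma \<rho>2_pcomult: "\<rho>2 (pcomult P t) = \<Delta>0 (\<rho> t)"
proof (rule klinear_ext[of "\<lambda>t. \<rho>2 (pcomult P t)" "\<lambda>t. \<Delta>0 (\<rho> t)"])
  have "\<rho>2 (word_comult P u) = \<Delta>0 (\<rho> (bas u))" for u
    by (induction u)
      (simp_all add: tmap_def eval_Nil \<Delta>0_one eval_Cons \<Delta>0_mul gen_comult eval2_fmul2[unfolded tmap_def])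
  then show "\<rho>2 (pcomult P (bas u)) = \<Delta>0 (\<rho> (bas u))" for u
    by (simp add: pcomult_def)
qed (intro klinear_tmap_comp klinear_compose[OF klinear_\<Delta>0] klinear_eval klinear_pcomult)+

text \<open>Both sides are derivations along the coproduct, so agreement on generators
  suffices.\<close>

lemma \<rho>2_pcobracket: "\<rho>2 (pcobracket P t) = \<delta> (\<rho> t)"
proof (rule klinear_ext[of "\<lambda>t. \<rho>2 (pcobracket P t)" "\<lambda>t. \<delta> (\<rho> t)"])
  have \<Delta>: "\<rho>2 (word_comult P u) = \<Delta>0 (\<rho> (bas u))" for u
    using \<rho>2_pcomult[of "bas u"] by (simp add: pcomult_def)
  have "\<rho>2 (word_cobracket P u) = \<delta> (\<rho> (bas u))" for u
    by (induction u)
      (simp_all add: klinear_0[OF klinear_tmap] eval_Nil \<delta>_one eval_Cons \<delta>_mul gen_comult gen_cobracket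
        eval2_fmul2 klinear_add[OF klinear_tmap] \<Delta>)
  then show "\<rho>2 (pcobracket P (bas u)) = \<delta> (\<rho> (bas u))" for u
    by (simp add: pcobracket_def)
qed (intro klinear_tmap_comp klinear_compose[OF klinear_\<delta>] klinear_eval klinear_pcobracket)+

lemma pcounit_eq: "pcounit P t = \<epsilon>0 (\<rho> t)"
proof -
  have word: "prod_list (map (presentation.gen_counit P) u) = \<epsilon>0 (\<rho> (bas u))" for u
    by (induction u) (simp_all add: eval_Nil eval_Cons \<epsilon>0_one \<epsilon>0_mul gen_counit)
  have \<epsilon>_sum: "\<epsilon>0 (sum h A) = (\<Sum>a\<in>A. \<epsilon>0 (h a))" for h :: "'g list \<Rightarrow> ('x \<Rightarrow>\<^sub>0 'k)" and A
    using \<epsilon>0_scl[of 0 0] by (induction A rule: infinite_finite_induct) (simp_all add: \<epsilon>0_add)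
  have "\<rho> t = (\<Sum>u\<in>Poly_Mapping.keys t. scl (Poly_Mapping.lookup t u) (\<rho> (bas u)))"
    using klinear_eq_lext[OF klinear_eval, of r t] by (simp add: lext_def)
  then show ?thesis by (simp add: pcounit_def word \<epsilon>_sum \<epsilon>0_scl)
qed

lemma \<rho>_pcounit_left: "\<rho> (pcounit_left P t) = contract0 (\<rho>2 t)"
proof (rule tens_ext[of "\<lambda>t. \<rho> (pcounit_left P t)" "\<lambda>t. contract0 (\<rho>2 t)"])
  show "\<rho> (pcounit_left P (tens p q)) = contract0 (\<rho>2 (tens p q))" for p q
  proof (rule bilinear_ext[of "\<lambda>p q. \<rho> (pcounit_left P (tens p q))" "\<lambda>p q. contract0 (\<rho>2 (tens p q))"])
    have word: "prod_list (map (presentation.gen_counit P) u) = \<epsilon>0 (\<rho> (bas u))" for u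
      by (induction u) (simp_all add: eval_Nil eval_Cons \<epsilon>0_one \<epsilon>0_mul gen_counit)
    show "\<rho> (pcounit_left P (tens (bas u) (bas v))) = contract0 (\<rho>2 (tens (bas u) (bas v)))" for u v
      unfolding tmap_tens[OF klinear_eval klinear_eval] contract0_tens
      by (simp add: pcounit_left_def word klinear_scl[OF klinear_eval])
  qed (unfold pcounit_left_def, (intro klinear_compose[OF klinear_eval] klinear_intros
      klinear_compose[OF klinear_contract0] klinear_tmap_comp)+)
qed (unfold pcounit_left_def, (intro klinear_compose[OF klinear_eval] klinear_lext
      klinear_compose[OF klinear_contract0] klinear_tmap)+)

lemma \<rho>3_left:
  assumes "klinear d" "klinear d'" "\<And>t. \<rho>2 (d t) = d' (\<rho> t)"
  shows "\<rho>3 (tmap d (\<lambda>x. x) t) = tmap d' (\<lambda>x. x) (\<rho>2 t)"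
  by (simp add: tmap_tmap assms klinear_id)

lemma \<rho>3_right:
  assumes "klinear d" "klinear d'" "\<And>t. \<rho>2 (d t) = d' (\<rho> t)"
  shows "tmap \<rho> \<rho>2 (tmap (\<lambda>x. x) d t) = tmap (\<lambda>x. x) d' (\<rho>2 t)"
  by (simp add: tmap_tmap assms klinear_id)

text \<open>Under \<rho>, \<open>\<rho>2\<close> or \<open>\<rho>3\<close> each axiom becomes the
  corresponding identity in the classical limit of \<open>Q\<close>.\<close>

lemma co_Poisson: "co_Poisson_bialgebra P"
  unfolding co_Poisson_bialgebra_def id_def
proof (intro conjI allI ballI)
  note \<rho>3 = \<rho>3_left[OF klinear_pcomult klinear_\<Delta>0 \<rho>2_pcomult] \<rho>2_pcomult
    \<rho>3_right[OF klinear_pcomult klinear_\<Delta>0 \<rho>2_pcomult] \<rho>2_pcobracket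
    \<rho>3_left[OF klinear_pcobracket klinear_\<delta> \<rho>2_pcobracket]
    \<rho>3_right[OF klinear_pcobracket klinear_\<delta> \<rho>2_pcobracket]
  note diff = klinear_diff[OF klinear_tmap] klinear_add[OF klinear_tmap]
  fix t
  show "pcomult P t \<in> pnull2 P" if "t \<in> pideal P"
    using that by (intro pnull2I) (simp add: \<rho>2_pcomult pideal_iff klinear_0[OF klinear_\<Delta>0])
  show "pcounit P t = 0" if "t \<in> pideal P"
    using that \<epsilon>0_scl[of 0 0] by (simp add: pcounit_eq pideal_iff)
  show "pcobracket P t \<in> pnull2 P" if "t \<in> pideal P"
    using that by (intro pnull2I) (simp add: \<rho>2_pcobracket pideal_iff klinear_0[OF klinear_\<delta>])
  show "tmap (pcomult P) (\<lambda>x. x) (pcomult P t) -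
      rename unassoc (tmap (\<lambda>x. x) (pcomult P) (pcomult P t)) \<in> pnull3 P"
    by (rule pnull3I) (simp add: diff \<rho>3 tmap_unassoc \<Delta>0_coassoc)
  show "pcounit_left P (pcomult P t) - t \<in> pideal P"
    by (simp add: pideal_iff klinear_diff[OF klinear_eval] \<rho>_pcounit_left \<rho>2_pcomult contract0_\<Delta>0)
  show "swap_tens (pcomult P t) - pcomult P t \<in> pnull2 P"
    by (rule pnull2I) (simp add: diff \<rho>2_pcomult \<Delta>0_cocomm flip: swap_tens_tmap)
  show "swap_tens (pcobracket P t) + pcobracket P t \<in> pnull2 P"
    by (rule pnull2I) (simp add: diff \<rho>2_pcobracket \<delta>_antisym flip: swap_tens_tmap)
  show "pcobracket P (fmul t s) -
      (fmul2 (pcobracket P t) (pcomult P s) + fmul2 (pcomult P t) (pcobracket P s)) \<in> pnull2 P" for s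
    by (rule pnull2I) (simp add: pcobracket_fmul klinear_0[OF klinear_tmap])
  show "rename unassoc (tmap (\<lambda>x. x) (pcomult P) (pcobracket P t)) -
      (tmap (pcobracket P) (\<lambda>x. x) (pcomult P t) +
       rename (\<lambda>(x, y, z). ((y, x), z)) (tmap (\<lambda>x. x) (pcobracket P) (pcomult P t))) \<in> pnull3 P"
    by (rule pnull3I) (simp add: diff \<rho>3 tmap_unassoc tmap_flip12 \<delta>_coderivation)
  show "cyc_sum (tmap (pcobracket P) (\<lambda>x. x) (pcobracket P t)) \<in> pnull3 P"
    by (rule pnull3I) (simp add: \<rho>3 \<delta>_coJacobi flip: cyc_sum_tmap)
qed

theorem quantization_presented: "quantization P \<phi> Q"
  unfolding quantization_def Let_def
proof (intro conjI allI impI)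
  have \<rho>2_\<phi>: "\<rho>2 (tmap \<phi> \<phi> t) = t" for t
    by (simp add: tmap_tmap \<phi>_lin eval_\<phi>)
  fix x
  show "\<phi> x \<in> pideal P \<Longrightarrow> x = 0"
    by (simp add: pideal_iff eval_\<phi>)
  show "\<exists>x. \<phi> x - t \<in> pideal P" for t
    using \<phi>\<rho> by blast
  show "\<phi> (fps_nth (fps_const x \<odot> fps_const y) 0) - fmul (\<phi> x) (\<phi> y) \<in> pideal P" for y
    by (simp add: pideal_iff klinear_diff[OF klinear_eval] eval_\<phi> eval_fmul mul0_def)
  show "tmap \<phi> \<phi> (fps_nth (\<Delta> (fps_const x)) 0) - pcomult P (\<phi> x) \<in> pnull2 P"
    by (rule pnull2I)
      (simp add: klinear_diff[OF klinear_tmap] \<rho>2_\<phi> \<rho>2_pcomult eval_\<phi> comult_nth_0)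
  show "fps_nth (\<Delta> (fps_const x) - hmap swap_tens (\<Delta> (fps_const x))) 0 = 0"
    by (rule cocomm)
  show "tmap \<phi> \<phi> (fps_nth (\<Delta> (fps_const x) - hmap swap_tens (\<Delta> (fps_const x))) 1) -
      pcobracket P (\<phi> x) \<in> pnull2 P"
    by (rule pnull2I)
      (simp only: klinear_diff[OF klinear_tmap] \<rho>2_\<phi> \<rho>2_pcobracket eval_\<phi> \<delta>_eq D_def diff_self)
qed (rule co_Poisson hbialgebra \<phi>_lin)+

end

section \<open>The quantization of the crossed product\<close>

lemma
  shows pideal_add: "s \<in> pideal P \<Longrightarrow> t \<in> pideal P \<Longrightarrow> s + t \<in> pideal P"
    and pideal_diff: "s \<in> pideal P \<Longrightarrow> t \<in> pideal P \<Longrightarrow> s - t \<in> pideal P"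
    and pideal_zero: "0 \<in> pideal P"
  unfolding pideal_def by (simp_all add: scl.span_add scl.span_diff scl.span_zero)

lemma fmul_assoc: "fmul (fmul a b) c = fmul a (fmul b c)"
  by (rule trilinear_ext[of "\<lambda>a b c. fmul (fmul a b) c" "\<lambda>a b c. fmul a (fmul b c)"])
    (intro klinear_compose[OF klinear_fmul(1)] klinear_compose[OF klinear_fmul(2)] klinear_fmul klinear_id
      | simp)+

lemma fmul_one: "fmul (bas []) t = t" "fmul t (bas []) = t"
  by (rule klinear_ext[of "\<lambda>t. fmul (bas []) t" "\<lambda>t. t"]; simp add: klinear_fmul klinear_id)
    (rule klinear_ext[of "\<lambda>t. fmul t (bas [])" "\<lambda>t. t"]; simp add: klinear_fmul klinear_id)

lemma pideal_rel: "s \<in> rels P \<Longrightarrow> s \<in> pideal P"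
  using pideal_sandwich[of s P "bas []" "bas []"] by (simp add: fmul_one)

lemma pideal_span_closed:
  assumes "klinear h" "\<And>a s b. s \<in> rels P \<Longrightarrow> h (fmul (fmul a s) b) \<in> pideal P'"
    and "t \<in> pideal P"
  shows "h t \<in> pideal P'"
  using assms(3) unfolding pideal_def[of P]
proof (induction rule: scl.span_induct_alt)
  case base
  show ?case by (simp add: klinear_0[OF assms(1)] pideal_zero)
next
  case (step c x y)
  then have "h x \<in> pideal P'" using assms(2) by auto
  with step show ?case
    unfolding klinear_add[OF assms(1)] klinear_scl[OF assms(1)]
    by (intro pideal_add) (simp_all add: pideal_def scl.span_scale)
qed

lemma pideal_fmul_left: "t \<in> pideal P \<Longrightarrow> fmul a t \<in> pideal P"
  by (rule pideal_span_closed[of "fmul a"])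
    (simp_all add: klinear_fmul pideal_sandwich flip: fmul_assoc)

lemma pideal_fmul_right: "t \<in> pideal P \<Longrightarrow> fmul t a \<in> pideal P"
proof (rule pideal_span_closed[of "\<lambda>t. fmul t a"])
  show "fmul (fmul (fmul b s) c) a \<in> pideal P" if "s \<in> rels P" for b s c
    unfolding fmul_assoc[of "fmul b s"] by (rule pideal_sandwich[OF that])
qed (simp_all add: klinear_fmul)

definition pcong :: "('x, 'k::field_char_0) presentation \<Rightarrow> ('x list \<Rightarrow>\<^sub>0 'k) \<Rightarrow> ('x list \<Rightarrow>\<^sub>0 'k) \<Rightarrow> bool" where
  "pcong P s t \<longleftrightarrow> s - t \<in> pideal P"

lemma pcong_refl: "pcong P t t"
  by (simp add: pcong_def pideal_zero)

lemma pcong_trans [trans]: "pcong P s t \<Longrightarrow> pcong P t u \<Longrightarrow> pcong P s u"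
  using pideal_add[of "s - t" P "t - u"] by (simp add: pcong_def)

lemma pcong_sym: "pcong P s t \<Longrightarrow> pcong P t s"
  using pideal_diff[OF pideal_zero, of "s - t" P] by (simp add: pcong_def)

lemma pcong_add: "pcong P s t \<Longrightarrow> pcong P s' t' \<Longrightarrow> pcong P (s + s') (t + t')"
  using pideal_add[of "s - t" P "s' - t'"] by (simp add: pcong_def algebra_simps)

lemma pcong_scl: "pcong P s t \<Longrightarrow> pcong P (scl c s) (scl c t)"
  unfolding pcong_def scl.scale_right_diff_distrib[symmetric] pideal_def by (rule scl.span_scale)

lemma pcong_fmul: "pcong P s t \<Longrightarrow> pcong P s' t' \<Longrightarrow> pcong P (fmul s s') (fmul t t')"
proof -
  assume "pcong P s t" "pcong P s' t'"
  then have "fmul (s - t) s' + fmul t (s' - t') \<in> pideal P"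
    unfolding pcong_def by (intro pideal_add pideal_fmul_left pideal_fmul_right)
  then show ?thesis
    by (simp add: pcong_def klinear_diff[OF klinear_fmul(1)] klinear_diff[OF klinear_fmul(2)])
qed

lemma pcong_rel: "s - t \<in> rels P \<Longrightarrow> pcong P s t"
  by (simp add: pcong_def pideal_rel)

lemma pcong_ext:
  assumes "klinear h" "klinear h'" "\<And>x. pcong P (h (bas x)) (h' (bas x))"
  shows "pcong P (h t) (h' t)"
  using klinear_mod_ext[where d = "\<lambda>t. h t - h' t", OF klinear_minus[OF assms(1,2)]] assms(3)
  unfolding pcong_def pideal_def by blast

text \<open>The presentations have one generator for every vector, but the identifications use basis
  vectors only. The linearity relations bridge the two.\<close>

lemma pcong_linear:
  assumes add: "\<And>x y. pcong P (g (x + y)) (g x + g y)"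
    and scl: "\<And>c x. pcong P (g (scl c x)) (scl c (g x))"
  shows "pcong P (lext (\<lambda>b. g (bas b)) x) (g x)"
proof -
  \<comment> \<open>As an element of the free algebra \<open>g 0\<close> need not vanish; the scalar
    relation with scalar 0 makes it congruent to 0.\<close>
  have zero: "pcong P 0 (g 0)"
    using pcong_sym[OF scl[of 0 0]] by simp
  have "pcong P (\<Sum>b\<in>B. scl (h b) (g (bas b))) (g (\<Sum>b\<in>B. scl (h b) (bas b)))" if "finite B" for B and h
    using that
  proof (induction B rule: finite_induct)
    case (insert b B)
    have "pcong P (scl (h b) (g (bas b)) + (\<Sum>b\<in>B. scl (h b) (g (bas b))))
        (g (scl (h b) (bas b)) + g (\<Sum>b\<in>B. scl (h b) (bas b)))"
      by (intro pcong_add insert.IH pcong_sym[OF scl])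
    also have "pcong P \<dots> (g (scl (h b) (bas b) + (\<Sum>b\<in>B. scl (h b) (bas b))))"
      by (rule pcong_sym[OF add])
    finally show ?case using insert by simp
  qed (simp add: zero)
  from this[of "Poly_Mapping.keys x" "Poly_Mapping.lookup x"] show ?thesis
    using lext_basis[of x] by (simp add: lext_def)
qed

lemma pnull2_kernel:
  assumes "klinear \<rho>" "\<And>t. t \<in> pideal P \<Longrightarrow> \<rho> t = 0" "t \<in> pnull2 P"
  shows "tmap \<rho> \<rho> t = 0"
  using assms(3) unfolding pnull2_def
  by (rule klinear_span_0[OF klinear_tmap, rotated])
    (auto simp: tmap_tens assms(1,2) tens_simps)

lemma symmetrize_empty: "symmetrize {#} = bas []"
  by (simp add: symmetrize_def)

lemma symmetrize_single: "symmetrize {#b#} = bas [b]"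
  by (simp add: symmetrize_def permutations_of_multiset_nonempty)

lemma klinear_U_identification [simp]: "klinear U_identification"
  by (simp add: U_identification_def)

lemma klinear_cross_identification [simp]: "klinear cross_identification"
  by (simp add: cross_identification_def)

lemma rename_Prim_Grp:
  "rename (\<lambda>w. map (\<lambda>b. Prim (bas b)) w @ [Grp g]) p =
    fmul (rename (map Prim) (rename (map bas) p)) (bas [Grp g])"
  by (rule klinear_ext[of "rename (\<lambda>w. map (\<lambda>b. Prim (bas b)) w @ [Grp g])"
        "\<lambda>p. fmul (rename (map Prim) (rename (map bas) p)) (bas [Grp g])"])
    (simp_all add: klinear_compose[OF klinear_fmul(1)] klinear_compose[OF klinear_rename] comp_def)

context gamma_ek
begin

section \<open>The classical limit of \<open>Q(a)\<close> as the enveloping algebra\<close>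

abbreviation "PU \<equiv> U_presentation L"
abbreviation "PX \<equiv> cross_presentation L \<theta> f"

definition "gen x = rename (\<lambda>b. {#b#}) x"

lemma klinear_gen: "klinear gen"
  by (simp add: gen_def[abs_def])

lemma gen_bas: "gen (bas b) = bas {#b#}"
  by (simp add: gen_def)

lemma cocomm_Q: "cocomm_bialg Q"
  using quantization_Q unfolding quantization_def Let_def
  by (intro cocomm_bialg.intro cocomm_bialg_axioms.intro bialg_Q) blast

sublocale cocomm_bialg Q by (rule cocomm_Q)

lemma Q_unit: "one = hbas {#}" and Q_counit: "\<epsilon> = hfext (\<lambda>M. if M = {#} then 1 else 0)"
  by (simp_all add: ek_Q_def)

lemma one0_eq: "one0 = bas {#}"
  by (simp add: one0_def Q_unit hbas_nth_0)

lemma quantization_U: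
  shows "U_identification x \<in> pideal PU \<Longrightarrow> x = 0"
    and "\<exists>x. U_identification x - t \<in> pideal PU"
    and "U_identification (mul0 x y) - fmul (U_identification x) (U_identification y) \<in> pideal PU"
    and "tmap U_identification U_identification (\<Delta>0 x) - pcomult PU (U_identification x) \<in> pnull2 PU"
    and "tmap U_identification U_identification (\<delta> x) - pcobracket PU (U_identification x) \<in> pnull2 PU"
  using quantization_Q
  unfolding quantization_def Let_def mul0_def \<Delta>0_def cl_def \<delta>_eq D_def by blast+

lemma co_Poisson_U: "t \<in> pideal PU \<Longrightarrow> pcomult PU t \<in> pnull2 PU"
  "t \<in> pideal PU \<Longrightarrow> pcobracket PU t \<in> pnull2 PU"
  using quantization_Q unfolding quantization_def co_Poisson_bialgebra_def by blast+

lemma U_add: "pcong PU (bas [x + y]) (bas [x] + bas [y])"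
  by (rule pcong_rel) (auto simp: U_presentation_def algebra_simps)

lemma U_scl: "pcong PU (bas [scl c x]) (scl c (bas [x]))"
  by (rule pcong_rel) (auto simp: U_presentation_def)

lemma U_gen: "pcong PU (U_identification (gen x)) (bas [x])"
proof -
  have "U_identification (gen x) = lext (\<lambda>b. bas [bas b]) x"
    unfolding klinear_eq_lext[OF klinear_compose[OF klinear_U_identification klinear_gen], of x]
    by (simp add: gen_bas U_identification_def symmetrize_single)
  then show ?thesis using pcong_linear[of PU "\<lambda>x. bas [x]", OF U_add U_scl] by simp
qed

text \<open>Symmetrization is multiplicative modulo the ideal for the classical product and fixes
  degree one, so evaluating a word and symmetrizing the result returns the word modulo the
  ideal.\<close>

lemma U_eval: "pcong PU (U_identification (eval gen t)) t"
proof (rule pcong_ext[of "\<lambda>t. U_identification (eval gen t)" "\<lambda>t. t"])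
  show "pcong PU (U_identification (eval gen (bas u))) (bas u)" for u
  proof (induction u)
    case Nil
    show ?case
      by (simp add: eval_Nil one0_eq U_identification_def symmetrize_empty pcong_refl)
  next
    case (Cons x u)
    have "pcong PU (U_identification (eval gen (bas (x # u))))
        (fmul (U_identification (gen x)) (U_identification (eval gen (bas u))))"
      unfolding eval_Cons pcong_def by (rule quantization_U)
    also have "pcong PU \<dots> (fmul (bas [x]) (bas u))"
      by (intro pcong_fmul U_gen Cons.IH)
    finally show ?case by simp
  qed
qed (simp_all add: klinear_compose klinear_id)

text \<open>The point where PBW enters: the symmetrized value lies in the ideal, and symmetrization
  is injective modulo the ideal.\<close>

lemma eval_pideal: "t \<in> pideal PU \<Longrightarrow> eval gen t = 0"
proof (rule quantization_U(1))
  assume "t \<in> pideal PU"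
  then have "(U_identification (eval gen t) - t) + t \<in> pideal PU"
    using U_eval[of t] unfolding pcong_def by (intro pideal_add)
  then show "U_identification (eval gen t) \<in> pideal PU" by simp
qed

lemma eval_U: "eval gen (U_identification x) = x"
proof -
  have "U_identification (eval gen (U_identification x) - x) \<in> pideal PU"
    using U_eval[of "U_identification x"]
    by (simp add: pcong_def klinear_diff[OF klinear_U_identification])
  then show ?thesis using quantization_U(1) by fastforce
qed

abbreviation "eval2 \<equiv> tmap (eval gen) (eval gen)"

lemma eval2_pnull2: "t \<in> pnull2 PU \<Longrightarrow> eval2 t = 0"
  by (rule pnull2_kernel[OF klinear_eval eval_pideal])

lemma eval2_U: "eval2 (tmap U_identification U_identification t) = t"
  by (simp add: tmap_tmap eval_U)

lemma \<Delta>0_gen: "\<Delta>0 (gen x) = tens (gen x) one0 + tens one0 (gen x)"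
proof -
  have "\<Delta>0 (gen x) = eval2 (pcomult PU (U_identification (gen x)))"
    using eval2_pnull2[OF quantization_U(4)[of "gen x"]]
    by (simp add: klinear_diff[OF klinear_tmap] eval2_U)
  also have "\<dots> = eval2 (pcomult PU (bas [x]))"
    using eval2_pnull2[OF co_Poisson_U(1)[OF U_gen[unfolded pcong_def]], of x]
    by (simp add: klinear_diff[OF klinear_tmap] klinear_diff[OF klinear_pcomult])
  also have "\<dots> = tens (gen x) one0 + tens one0 (gen x)"
    by (simp add: pcomult_def U_presentation_def klinear_add[OF klinear_fmul2(1)]
        klinear_add[OF klinear_tmap]) (simp add: tmap_def eval_gen eval_Nil)
  finally show ?thesis .
qed

definition "pair t = rename (\<lambda>(b, c). ({#b#}, {#c#})) t"

text \<open>The quantization property determines \<delta> only modulo the null space of the tensor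
  square. Evaluation kills that null space and turns the congruence into an equation in
  \<open>S(a) \<otimes> S(a)\<close>.\<close>

lemma \<delta>_gen: "\<delta> (gen x) = pair (lcob L x)"
proof -
  have "\<delta> (gen x) = eval2 (pcobracket PU (U_identification (gen x)))"
    using eval2_pnull2[OF quantization_U(5)[of "gen x"]]
    by (simp add: klinear_diff[OF klinear_tmap] eval2_U)
  also have "\<dots> = eval2 (pcobracket PU (bas [x]))"
    using eval2_pnull2[OF co_Poisson_U(2)[OF U_gen[unfolded pcong_def]], of x]
    by (simp add: klinear_diff[OF klinear_tmap] klinear_diff[OF klinear_pcobracket])
  also have "\<dots> = eval2 (rename (\<lambda>(b, c). ([bas b], [bas c])) (lcob L x))"
    by (simp add: pcobracket_def U_presentation_def eval2_fmul2 klinear_0[OF klinear_fmul2(2)])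
      (simp add: tmap_def eval_Nil mul20_one)
  also have "\<dots> = pair (lcob L x)"
    unfolding pair_def
    by (rule klinear_ext[of "\<lambda>t. eval2 (rename (\<lambda>(b, c). ([bas b], [bas c])) t)"
          "rename (\<lambda>(b, c). ({#b#}, {#c#}))"])
      (simp_all add: klinear_compose case_prod_beta tmap_def eval_gen gen_bas)
  finally show ?thesis .
qed

lemma \<epsilon>0_gen: "\<epsilon>0 (gen x) = 0"
proof -
  have \<epsilon>0_bas: "\<epsilon>0 (bas {#b#}) = 0" for b
    by (simp add: \<epsilon>0_def Q_counit flip: hbas_def)
  have \<epsilon>_sum: "\<epsilon>0 (sum h B) = (\<Sum>a\<in>B. \<epsilon>0 (h a))" for h :: "'b \<Rightarrow> ('b multiset \<Rightarrow>\<^sub>0 'k)" and B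
    using \<epsilon>0_scl[of 0 0] by (induction B rule: infinite_finite_induct) (simp_all add: \<epsilon>0_add)
  show ?thesis
    unfolding klinear_eq_lext[OF klinear_gen, of x] lext_def
    by (simp add: \<epsilon>_sum \<epsilon>0_scl gen_bas \<epsilon>0_bas)
qed

lemma gen_commutator: "mul0 (gen x) (gen y) - mul0 (gen y) (gen x) = gen (lbr L x y)"
proof -
  have "bas [x, y] - bas [y, x] - bas [lbr L x y] \<in> pideal PU"
    by (rule pideal_rel) (auto simp: U_presentation_def)
  from eval_pideal[OF this] show ?thesis
    by (simp add: klinear_diff[OF klinear_eval] eval_Cons eval_Nil mul0_one)
qed

lemma S_map_gen': "S_map (\<theta> g) (gen x) = gen (\<theta> g x)"
  unfolding gen_def by (rule S_map_gen[OF \<theta>_lin])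

lemma S_map_one0: "S_map (\<theta> g) one0 = one0"
  by (simp add: one0_eq bas_empty S_map_one)

section \<open>The classical limit of the crossed product\<close>

definition "at0 g x = rename (\<lambda>M. (M, g)) x"
definition "at20 g h t = rename (\<lambda>(M, N). ((M, g), (N, h))) t"

lemma klinear_at0: "klinear (at0 g)" and klinear_at20: "klinear (at20 g h)"
  by (simp_all add: at0_def[abs_def] at20_def[abs_def])

lemma at0_bas: "at0 g (bas M) = bas (M, g)"
  by (simp add: at0_def)

lemma at20_tens: "at20 g h (tens x y) = tens (at0 g x) (at0 h y)"
  unfolding at20_def at0_def by (rule rename_tens_map)

lemma swap_at20: "swap_tens (at20 g g t) = at20 g g (swap_tens t)"
  unfolding at20_def swap_tens_def by (simp add: rename_rename split_def)

lemma at_group_nth: "fps_nth (at_group g x) n = at0 g (fps_nth x n)"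
  by (simp add: at_group_def at0_def)

lemma at_group2_nth: "fps_nth (at_group2 g h t) n = at20 g h (fps_nth t n)"
  by (simp add: at_group2_def at20_def)

lemma at_group_const: "at_group g (fps_const x) = fps_const (at0 g x)"
  by (rule fps_ext) (simp add: at_group_nth klinear_0[OF klinear_at0])

text \<open>\<open>i g\<close> is the identity modulo \<open>h\<close>, so only
  \<open>\<theta> g\<close> remains; the classical product of \<open>A\<close> is the untwisted
  crossed product.\<close>

lemma \<alpha>_nth_0: "fps_nth (\<alpha> g x) 0 = S_map (\<theta> g) (fps_nth x 0)"
  using arg_cong[OF i_\<alpha>[of g x], of "\<lambda>v. fps_nth v 0"] by (simp add: i_def normalized_f)

lemma w_nth_0: "fps_nth (w g h) 0 = one0"
proof -
  have "fps_nth (v g h) 0 = one0"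
    unfolding v_def one0_def by (rule normalized(7)[OF twist twist_twisted])
  then show ?thesis
    using arg_cong[OF vw(1)[of g h], of "\<lambda>v. fps_nth v 0"]
    by (simp add: mul_nth_0 mul0_one one0_def[symmetric])
qed

lemma F_nth_0: "fps_nth (F g) 0 = tens one0 one0"
  by (simp add: F_def normalized_f hunit2_def one0_def)

lemma G_nth_0: "fps_nth (G g) 0 = tens one0 one0"
  using arg_cong[OF FG(1)[of g], of "\<lambda>v. fps_nth v 0"]
  by (simp add: mul2_nth_0 F_nth_0 mul20_one) (simp add: hunit2_def one0_def)

lemma hswap_at_group2: "hmap swap_tens (at_group2 g g t) = at_group2 g g (hmap swap_tens t)"
  unfolding at_group2_def swap_tens_def by (simp add: hmap_rename_rename split_def)

lemma A_comult_nth_0: "fps_nth (hcomult A (fps_const (at0 g x))) 0 = at20 g g (\<Delta>0 x)"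
  by (simp add: A_comult at_group2_nth mul2_nth_0 comult_nth_0 G_nth_0 mul20_one flip: at_group_const)

lemma bialg_A: "bialg A"
  by (rule bialg.intro[OF hbialgebra_A])

lemma cocomm_A: "cocomm_bialg A"
proof (intro cocomm_bialg.intro cocomm_bialg_axioms.intro bialg_A)
  fix a
  have lin: "klinear (cl (hcomult A))" by (rule klinear_cl[OF hlinear_A_comult])
  have "swap_tens (cl (hcomult A) a) = cl (hcomult A) a"
  proof (rule klinear_ext[of "\<lambda>a. swap_tens (cl (hcomult A) a)" "cl (hcomult A)"])
    fix x :: "'b multiset \<times> 'g"
    show "swap_tens (cl (hcomult A) (bas x)) = cl (hcomult A) (bas x)"
      using A_comult_nth_0[of "snd x" "bas (fst x)"]
      by (simp add: cl_def at0_bas \<Delta>0_cocomm swap_at20)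
  qed (intro klinear_compose[OF klinear_swap_tens] lin)+
  then show "fps_nth (hcomult A (fps_const a) - hmap swap_tens (hcomult A (fps_const a))) 0 = 0"
    by (simp add: cl_def)
qed

sublocale Ac: cocomm_bialg A by (rule cocomm_A)

lemma A_mul0: "Ac.mul0 (at0 g x) (at0 h y) = at0 (g + h) (mul0 x (S_map (\<theta> g) y))"
  by (simp add: Ac.mul0_def A_mult at_group_nth mul_nth_0 \<alpha>_nth_0 w_nth_0 mul0_one flip: at_group_const)

lemma A_one0: "Ac.one0 = at0 0 one0"
  by (simp add: Ac.one0_def A_unit at_group_nth one0_def)

lemma A_\<Delta>0: "Ac.\<Delta>0 (at0 g x) = at20 g g (\<Delta>0 x)"
  by (simp add: Ac.\<Delta>0_def cl_def A_comult_nth_0)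

lemma A_\<epsilon>0: "Ac.\<epsilon>0 (at0 g x) = \<epsilon>0 x"
  by (simp add: Ac.\<epsilon>0_def \<epsilon>0_def A_counit flip: at_group_const)

text \<open>The identity \<open>F * G = 1\<close> minus its flipped version reads
  \<open>?K * G + F^op * ?E = 0\<close>. Both antisymmetrizations are divisible by \<open>h\<close>,
  and the coefficient of \<open>h\<close> gives \<open>?E = - ?K\<close> there, while
  \<open>?K\<close> contributes the twist by normalization.\<close>

lemma G_antisym: "fps_nth (G g - hmap swap_tens (G g)) 1 = - pair (f g)"
proof -
  let ?s = "hmap swap_tens"
  let ?K = "F g - ?s (F g)" and ?E = "G g - ?s (G g)"
  have swap_one: "swap_tens (tens one0 one0) = tens one0 one0" by (simp add: swap_tens_tens)
  note diff = hlinear_diff[OF mul2_left[OF hlinear_id]] hlinear_diff[OF mul2_right[OF hlinear_id]]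
  note hs = hlinear_hscl[OF mul2_left[OF hlinear_id]] hlinear_hscl[OF mul2_right[OF hlinear_id]]
  have X: "t = hscl fps_X (fps_shift 1 t)" if "fps_nth t 0 = 0"
    for t :: "('b multiset \<times> 'b multiset \<Rightarrow>\<^sub>0 'k) fps"
    using fps_split_const[of t] that by simp
  have K: "?K = hscl fps_X (fps_shift 1 ?K)" and E: "?E = hscl fps_X (fps_shift 1 ?E)"
    by (rule X; simp add: F_nth_0 G_nth_0 swap_one)+
  have "?s (F g) \<odot>\<^sub>2 ?s (G g) = hunit2 Q"
    by (simp add: FG hunit2_def hswap_htens flip: hswap_mul2)
  then have "?K \<odot>\<^sub>2 G g + ?s (F g) \<odot>\<^sub>2 ?E = 0"
    by (simp add: diff FG)
  then have "hscl fps_X (fps_shift 1 ?K \<odot>\<^sub>2 G g + ?s (F g) \<odot>\<^sub>2 fps_shift 1 ?E) = hscl fps_X 0"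
    by (subst (asm) K, subst (asm) E) (simp add: hs hscl.scale_right_distrib)
  then have "fps_nth (fps_shift 1 ?K \<odot>\<^sub>2 G g + ?s (F g) \<odot>\<^sub>2 fps_shift 1 ?E) 0 = 0"
    by (simp only: hscl_X_cancel fps_zero_nth)
  then have "fps_nth ?K 1 + fps_nth ?E 1 = 0"
    by (simp add: mul2_nth_0 G_nth_0 F_nth_0 swap_one mul20_one del: fps_sub_nth)
  moreover have "fps_nth ?K 1 = pair (f g)"
    unfolding pair_def F_def by (rule normalized_f)
  ultimately show ?thesis by (simp add: eq_neg_iff_add_eq_0 add.commute del: fps_sub_nth)
qed

text \<open>The mixed-term splitting of a difference of products separates the contribution of
  \<Delta>, which is \<delta>, from that of \<open>G g\<close>, which \<open>G_antisym\<close>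
  evaluates.\<close>

lemma A_\<delta>: "Ac.\<delta> (at0 g x) = at20 g g (\<delta> x - mul20 (\<Delta>0 x) (pair (f g)))"
proof -
  let ?s = "hmap swap_tens" and ?x = "fps_const x"
  let ?E = "G g - ?s (G g)"
  note diff = hlinear_diff[OF mul2_left[OF hlinear_id]] hlinear_diff[OF mul2_right[OF hlinear_id]]
  note hs = hlinear_hscl[OF mul2_left[OF hlinear_id]] hlinear_hscl[OF mul2_right[OF hlinear_id]]
  have E: "?E = hscl fps_X (fps_shift 1 ?E)"
    using fps_split_const[of ?E] by (simp add: G_nth_0 swap_tens_tens)
  have "Ac.D (at_group g ?x) = at_group2 g g (\<Delta> ?x \<odot>\<^sub>2 G g - ?s (\<Delta> ?x) \<odot>\<^sub>2 ?s (G g))"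
    by (simp add: Ac.D_def A_comult hswap_at_group2 hswap_mul2 hlinear_diff[OF at_group2_lin[OF hlinear_id]])
  also have "\<Delta> ?x \<odot>\<^sub>2 G g - ?s (\<Delta> ?x) \<odot>\<^sub>2 ?s (G g) = D ?x \<odot>\<^sub>2 G g + ?s (\<Delta> ?x) \<odot>\<^sub>2 ?E"
    by (simp add: D_def diff)
  also have "\<dots> = hscl fps_X (D' ?x \<odot>\<^sub>2 G g + ?s (\<Delta> ?x) \<odot>\<^sub>2 fps_shift 1 ?E)"
    by (subst E) (simp add: D_eq hs hscl.scale_right_distrib)
  finally have "Ac.\<delta> (at0 g x) = at20 g g (fps_nth (D' ?x \<odot>\<^sub>2 G g + ?s (\<Delta> ?x) \<odot>\<^sub>2 fps_shift 1 ?E) 0)"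
    by (simp add: Ac.\<delta>_eq at_group2_nth hscl_X_nth flip: at_group_const)
  also have "fps_nth (D' ?x \<odot>\<^sub>2 G g + ?s (\<Delta> ?x) \<odot>\<^sub>2 fps_shift 1 ?E) 0 =
      \<delta> x - mul20 (\<Delta>0 x) (pair (f g))"
    using G_antisym[of g]
    by (simp add: mul2_nth_0 D'_nth_0 comult_nth_0 \<Delta>0_cocomm G_nth_0 mul20_one
        klinear_neg[OF klinear_mul20(2)] del: fps_sub_nth)
  finally show ?thesis .
qed

definition "r s = (case s of Prim x \<Rightarrow> at0 0 (gen x) | Grp g \<Rightarrow> at0 g one0)"

lemma r_simps [simp]: "r (Prim x) = at0 0 (gen x)" "r (Grp g) = at0 g one0"
  by (simp_all add: r_def)

section \<open>Normal forms in the presented crossed product\<close>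

abbreviation "j \<equiv> rename (map Prim)"

lemma A_mul0_zero: "Ac.mul0 (at0 0 x) (at0 g y) = at0 g (mul0 x y)"
  by (simp add: A_mul0 \<theta>_zero[abs_def] S_map_ident)

lemma eval_j: "Ac.eval r (j t) = at0 0 (eval gen t)"
proof (rule klinear_ext[of "\<lambda>t. Ac.eval r (j t)" "\<lambda>t. at0 0 (eval gen t)"])
  show "Ac.eval r (j (bas u)) = at0 0 (eval gen (bas u))" for u
    by (induction u) (simp_all add: Ac.eval_Nil eval_Nil A_one0 Ac.eval_Cons eval_Cons A_mul0_zero)
qed (simp_all add: klinear_compose klinear_at0)

lemma cross_identification_at0:
  "cross_identification (at0 g x) = fmul (j (U_identification x)) (bas [Grp g])"
proof (rule klinear_ext[of "\<lambda>x. cross_identification (at0 g x)"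
      "\<lambda>x. fmul (j (U_identification x)) (bas [Grp g])"])
  fix M
  show "cross_identification (at0 g (bas M)) = fmul (j (U_identification (bas M))) (bas [Grp g])"
    by (simp add: at0_bas cross_identification_def U_identification_def rename_Prim_Grp)
qed (intro klinear_compose[OF klinear_cross_identification] klinear_compose[OF klinear_fmul(1)]
    klinear_compose[OF klinear_rename] klinear_at0 klinear_U_identification)+

lemma X_rels:
  "pcong PX (bas [Prim (x + y)]) (bas [Prim x] + bas [Prim y])"
  "pcong PX (bas [Prim (scl c x)]) (scl c (bas [Prim x]))"
  "pcong PX (bas [Prim x, Prim y] - bas [Prim y, Prim x]) (bas [Prim (lbr L x y)])"
  "pcong PX (bas [Grp g, Grp h]) (bas [Grp (g + h)])"
  "pcong PX (bas [Grp 0]) (bas [])"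
  "pcong PX (bas [Grp g, Prim x, Grp (- g)]) (bas [Prim (\<theta> g x)])"
proof -
  note rel = pcong_rel[where P = PX, unfolded cross_presentation_def presentation.simps,
      folded cross_presentation_def]
  show "pcong PX (bas [Prim (x + y)]) (bas [Prim x] + bas [Prim y])"
    unfolding diff_diff_eq[symmetric] by (rule rel, rule UnI1, rule UnI1, rule UnI1, rule UnI1, rule UnI1)
      (auto simp: diff_diff_eq)
  show "pcong PX (bas [Prim (scl c x)]) (scl c (bas [Prim x]))"
    by (rule rel, rule UnI1, rule UnI1, rule UnI1, rule UnI1, rule UnI2) auto
  show "pcong PX (bas [Prim x, Prim y] - bas [Prim y, Prim x]) (bas [Prim (lbr L x y)])"
    by (rule rel, rule UnI1, rule UnI1, rule UnI1, rule UnI2) auto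
  show "pcong PX (bas [Grp g, Grp h]) (bas [Grp (g + h)])"
    by (rule rel, rule UnI1, rule UnI1, rule UnI2) auto
  show "pcong PX (bas [Grp 0]) (bas [])"
    by (rule rel, rule UnI1, rule UnI2) auto
  show "pcong PX (bas [Grp g, Prim x, Grp (- g)]) (bas [Prim (\<theta> g x)])"
    by (rule rel, rule UnI2) auto
qed

lemma j_fmul: "j (fmul s t) = fmul (j s) (j t)"
  by (rule bilinear_ext[of "\<lambda>s t. j (fmul s t)" "\<lambda>s t. fmul (j s) (j t)"])
    (intro klinear_compose[OF klinear_rename] klinear_compose[OF klinear_fmul(1)]
      klinear_compose[OF klinear_fmul(2)] klinear_fmul klinear_rename | simp)+

text \<open>The relations of \<open>U(a)\<close> are the first three families of relations of the
  crossed product, so normal forms for \<open>U(a)\<close> can be used there.\<close>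

lemma j_pideal: "t \<in> pideal PU \<Longrightarrow> j t \<in> pideal PX"
proof (rule pideal_span_closed[of j])
  fix a s b assume "s \<in> rels PU"
  then have "j s \<in> pideal PX"
    using X_rels(1-3) unfolding pcong_def
    by (auto simp: U_presentation_def klinear_diff[OF klinear_rename] klinear_scl[OF klinear_rename]
        klinear_add[OF klinear_rename] diff_diff_eq)
  then show "j (fmul (fmul a s) b) \<in> pideal PX"
    by (simp add: j_fmul pideal_fmul_left pideal_fmul_right)
qed simp_all

lemma j_pcong: "pcong PU s t \<Longrightarrow> pcong PX (j s) (j t)"
  using j_pideal[of "s - t"] by (simp add: pcong_def klinear_diff[OF klinear_rename])

lemma U_normal_form: "\<exists>x. pcong PU (U_identification x) t"
  using quantization_U(2) by (simp add: pcong_def)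

lemma j_normal_form: "\<exists>a. pcong PX (cross_identification a) (fmul (j t) (bas [Grp g]))"
proof -
  obtain x where "pcong PU (U_identification x) t" using U_normal_form by blast
  then have "pcong PX (cross_identification (at0 g x)) (fmul (j t) (bas [Grp g]))"
    unfolding cross_identification_at0 by (intro pcong_fmul j_pcong pcong_refl)
  then show ?thesis by blast
qed

text \<open>The conjugation relation is turned into a commutation rule by appending the letters
  \<open>- h\<close> and \<open>h\<close>, whose product is congruent to the empty word.\<close>

lemma Grp_Prim: "pcong PX (bas [Grp h, Prim x]) (bas [Prim (\<theta> h x), Grp h])"
proof -
  have "pcong PX (bas [Grp (- h), Grp h]) (bas [Grp (- h + h)])" by (rule X_rels)
  also have "pcong PX (bas [Grp (- h + h)]) (bas [])" using X_rels(5) by simp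
  finally have "pcong PX (fmul (bas [Grp h, Prim x]) (bas [])) (fmul (bas [Grp h, Prim x]) (bas [Grp (- h), Grp h]))"
    by (rule pcong_fmul[OF pcong_refl pcong_sym])
  also have "fmul (bas [Grp h, Prim x]) (bas [Grp (- h), Grp h]) =
      fmul (bas [Grp h, Prim x, Grp (- h)]) (bas [Grp h])" by simp
  also have "pcong PX \<dots> (fmul (bas [Prim (\<theta> h x)]) (bas [Grp h]))"
    by (intro pcong_fmul X_rels pcong_refl)
  finally show ?thesis by simp
qed

lemma Grp_j: "pcong PX (fmul (bas [Grp h]) (j t)) (fmul (j (rename (map (\<theta> h)) t)) (bas [Grp h]))"
proof (rule pcong_ext[of "\<lambda>t. fmul (bas [Grp h]) (j t)" "\<lambda>t. fmul (j (rename (map (\<theta> h)) t)) (bas [Grp h])"])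
  show "pcong PX (fmul (bas [Grp h]) (j (bas u))) (fmul (j (rename (map (\<theta> h)) (bas u))) (bas [Grp h]))" for u
  proof (induction u)
    case (Cons x u)
    have "fmul (bas [Grp h]) (j (bas (x # u))) = fmul (bas [Grp h, Prim x]) (j (bas u))" by simp
    also have "pcong PX \<dots> (fmul (bas [Prim (\<theta> h x), Grp h]) (j (bas u)))"
      by (intro pcong_fmul Grp_Prim pcong_refl)
    also have "\<dots> = fmul (bas [Prim (\<theta> h x)]) (fmul (bas [Grp h]) (j (bas u)))" by simp
    also have "pcong PX \<dots> (fmul (bas [Prim (\<theta> h x)]) (fmul (j (rename (map (\<theta> h)) (bas u))) (bas [Grp h])))"
      by (intro pcong_fmul Cons.IH pcong_refl)
    finally show ?case by simp
  qed (simp add: pcong_refl)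
qed (intro klinear_compose[OF klinear_fmul(1)] klinear_compose[OF klinear_fmul(2)]
    klinear_compose[OF klinear_rename] klinear_rename)+

text \<open>The preimage in the free algebra of the image of the identification. It contains all
  words because it contains the empty word and is stable under left multiplication by
  letters.\<close>

definition "normal = {t. \<exists>a. pcong PX (cross_identification a) t}"

lemma normal_linear:
  assumes "klinear h" "\<And>x. h (bas x) \<in> normal"
  shows "h t \<in> normal"
proof -
  have "scl.subspace normal"
    unfolding scl.subspace_def normal_def
    using pcong_refl[of PX 0] pcong_add[of PX] pcong_scl[of PX]
    by (auto simp: klinear_0[OF klinear_cross_identification]
        simp flip: klinear_add[OF klinear_cross_identification] klinear_scl[OF klinear_cross_identification])
      (metis klinear_0[OF klinear_cross_identification] klinear_add[OF klinear_cross_identification]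
        klinear_scl[OF klinear_cross_identification])+
  then show ?thesis
    unfolding klinear_eq_lext[OF assms(1), of t] lext_def
    by (intro scl.subspace_sum scl.subspace_scale assms(2))
qed

lemma normal_pcong: "pcong PX s t \<Longrightarrow> s \<in> normal \<Longrightarrow> t \<in> normal"
  unfolding normal_def using pcong_trans by blast

text \<open>A primitive letter is absorbed into the part from \<open>U(a)\<close>, which is then put
  into normal form again. A group letter is moved through that part by \<theta> and merged with the
  final group letter.\<close>

lemma normal_Cons: "fmul (bas [s]) (cross_identification a) \<in> normal"
proof (rule normal_linear[of "\<lambda>a. fmul (bas [s]) (cross_identification a)"])
  fix x :: "'b multiset \<times> 'g"
  define g where "g = snd x"
  define t :: "('b \<Rightarrow>\<^sub>0 'k) list \<Rightarrow>\<^sub>0 'k" where "t = U_identification (bas (fst x))"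
  have x: "cross_identification (bas x) = fmul (j t) (bas [Grp g])"
    using cross_identification_at0[of g "bas (fst x)"] by (simp add: at0_bas g_def t_def)
  show "fmul (bas [s]) (cross_identification (bas x)) \<in> normal"
  proof (cases s)
    case (Prim y)
    have "fmul (bas [s]) (cross_identification (bas x)) = fmul (j (fmul (bas [y]) t)) (bas [Grp g])"
      by (simp add: x Prim j_fmul fmul_assoc)
    then show ?thesis using j_normal_form by (simp add: normal_def)
  next
    case (Grp h)
    have "fmul (bas [s]) (cross_identification (bas x)) = fmul (fmul (bas [Grp h]) (j t)) (bas [Grp g])"
      by (simp add: x Grp fmul_assoc)
    also have "pcong PX \<dots> (fmul (fmul (j (rename (map (\<theta> h)) t)) (bas [Grp h])) (bas [Grp g]))"
      by (intro pcong_fmul Grp_j pcong_refl)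
    also have "\<dots> = fmul (j (rename (map (\<theta> h)) t)) (bas [Grp h, Grp g])"
      by (simp add: fmul_assoc)
    also have "pcong PX \<dots> (fmul (j (rename (map (\<theta> h)) t)) (bas [Grp (h + g)]))"
      by (intro pcong_fmul X_rels pcong_refl)
    finally have "pcong PX (fmul (bas [s]) (cross_identification (bas x)))
      (fmul (j (rename (map (\<theta> h)) t)) (bas [Grp (h + g)]))" .
    then show ?thesis
      by (rule normal_pcong[OF pcong_sym]) (use j_normal_form in \<open>simp add: normal_def\<close>)
  qed
qed (intro klinear_compose[OF klinear_fmul(2)] klinear_cross_identification)

lemma normal_word: "bas u \<in> normal"
proof (induction u)
  case Nil
  \<comment> \<open>Normal forms always end in a group letter, so the empty word is represented by
    the letter of the neutral element.\<close>
  have "bas [Grp 0] \<in> normal"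
    using j_normal_form[of "bas []" 0] by (simp add: normal_def)
  then show ?case by (rule normal_pcong[OF X_rels(5)])
next
  case (Cons s u)
  then obtain a where "pcong PX (cross_identification a) (bas u)" by (auto simp: normal_def)
  then have "pcong PX (fmul (bas [s]) (cross_identification a)) (fmul (bas [s]) (bas u))"
    by (intro pcong_fmul pcong_refl)
  then show ?case using normal_pcong normal_Cons by fastforce
qed

text \<open>Killing the relations, undoing the identification and reaching every word make the
  classical limit of \<open>A\<close> the presented algebra. The structure maps then need comparison
  on generators only.\<close>

lemma presented_A: "presented A PX cross_identification r"
proof (intro presented.intro presented_axioms.intro cocomm_A)
  show "klinear cross_identification" by simp
  note diff = klinear_diff[OF Ac.klinear_eval] klinear_scl[OF Ac.klinear_eval]
  note word = Ac.eval_Cons Ac.eval_Nil Ac.mul0_one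
  show "Ac.eval r s = 0" if "s \<in> rels PX" for s
  proof -
    have 1: "gen (x + y) = gen x + gen y" "gen (scl c x) = scl c (gen x)" for x y c
      by (simp_all add: klinear_add klinear_scl klinear_gen)
    have 2: "at0 0 (mul0 (gen x) (gen y)) - at0 0 (mul0 (gen y) (gen x)) = at0 0 (gen (lbr L x y))" for x y
      by (simp only: gen_commutator flip: klinear_diff[OF klinear_at0])
    from that show ?thesis
      by (auto simp: cross_presentation_def diff word 1 2 A_mul0 S_map_one0 S_map_gen' mul0_one
          \<theta>_zero klinear_add[OF klinear_at0] klinear_scl[OF klinear_at0] simp flip: A_one0)
  qed
  show "Ac.eval r (cross_identification x) = x" for x
  proof (rule klinear_ext[of "\<lambda>x. Ac.eval r (cross_identification x)" "\<lambda>x. x"])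
    fix x
    have "Ac.eval r (cross_identification (at0 (snd x) (bas (fst x)))) = at0 (snd x) (bas (fst x))"
      by (simp add: cross_identification_at0 Ac.eval_fmul eval_j eval_U Ac.eval_gen A_mul0_zero mul0_one)
    then show "Ac.eval r (cross_identification (bas x)) = bas x"
      by (simp add: at0_bas)
  qed (simp_all add: klinear_compose klinear_id)
  show "\<exists>x. cross_identification x - bas u \<in> pideal PX" for u
    using normal_word[of u] by (simp add: normal_def pcong_def)
  have tb: "tmap (Ac.eval r) (Ac.eval r) (bas (u, v)) = tens (Ac.eval r (bas u)) (Ac.eval r (bas v))" for u v
    by (simp add: tmap_def)
  have lin_ext: "at20 g h (pair t) = tmap (Ac.eval r) (Ac.eval r) (rename (\<lambda>(b, c). (k b, k' c)) t)"
    if "\<And>b. Ac.eval r (bas (k b)) = at0 g (bas {#b#})" "\<And>b. Ac.eval r (bas (k' b)) = at0 h (bas {#b#})"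
    for g h k k' t
    unfolding pair_def
    by (rule klinear_ext[of "\<lambda>t. at20 g h (rename (\<lambda>(b, c). ({#b#}, {#c#})) t)"
          "\<lambda>t. tmap (Ac.eval r) (Ac.eval r) (rename (\<lambda>(b, c). (k b, k' c)) t)"])
      (intro klinear_compose[OF klinear_at20] klinear_tmap_comp klinear_rename
        | simp add: split_def tb that at20_def at0_bas)+
  show "Ac.\<Delta>0 (r s) = tmap (Ac.eval r) (Ac.eval r) (gen_comult PX s)" for s
    by (cases s) (simp_all add: A_\<Delta>0 cross_presentation_def \<Delta>0_gen \<Delta>0_one klinear_add[OF klinear_at20]
        at20_tens klinear_add[OF klinear_tmap] tb Ac.eval_gen Ac.eval_Nil A_one0)
  show "Ac.\<epsilon>0 (r s) = gen_counit PX s" for s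
    by (cases s) (simp_all add: A_\<epsilon>0 cross_presentation_def \<epsilon>0_gen \<epsilon>0_one)
  show "Ac.\<delta> (r s) = tmap (Ac.eval r) (Ac.eval r) (gen_cobracket PX s)" for s
  proof (cases s)
    case (Prim x)
    \<comment> \<open>Primitive generators sit over the neutral element, where the twist vanishes,
      so only the cobracket of \<open>a\<close> survives in \<open>A_\<delta>\<close>.\<close>
    have "pair (f 0) = 0" by (simp add: pair_def f_zero klinear_0[OF klinear_rename])
    then show ?thesis
      by (simp add: Prim A_\<delta> \<delta>_gen klinear_0[OF klinear_mul20(2)] cross_presentation_def)
        (rule lin_ext; simp add: Ac.eval_gen gen_bas)
  next
    case (Grp g)
    \<comment> \<open>Over \<open>g\<close> the element is the unit, on which \<delta> vanishes;
      what remains of \<open>A_\<delta>\<close> is the term of the twist, with its minus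
      sign.\<close>
    have "at20 g g (pair (f g)) = tmap (Ac.eval r) (Ac.eval r)
        (rename (\<lambda>(b, c). ([Prim (bas b), Grp g], [Prim (bas c), Grp g])) (f g))"
      by (rule lin_ext; simp add: word A_mul0_zero mul0_one gen_bas)
    then show ?thesis
      by (simp add: Grp A_\<delta> \<delta>_one \<Delta>0_one mul20_one klinear_neg[OF klinear_at20] cross_presentation_def
          klinear_neg[OF klinear_tmap])
  qed
qed

end

theorem proposition5p1:
  fixes E :: "'k::field_char_0 ek_data"
    and L :: "('b, 'k) lie_bialg"
    and \<theta> :: "'g::group_add \<Rightarrow> ('b \<Rightarrow>\<^sub>0 'k) \<Rightarrow> ('b \<Rightarrow>\<^sub>0 'k)"
    and f :: "'g \<Rightarrow> ('b \<times> 'b \<Rightarrow>\<^sub>0 'k)"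
  assumes "ek_quantization TYPE('b) E"
    and "Gamma_lie_bialgebra L \<theta> f"
  shows "hbialgebra (cross_quantization E L \<theta> f) \<and>
    quantization (cross_presentation L \<theta> f) cross_identification (cross_quantization E L \<theta> f)"
proof -
  interpret gamma_ek E L \<theta> f using assms by (rule gamma_ek.intro)
  show ?thesis
    unfolding cross_quantization_eq
    using hbialgebra_A presented.quantization_presented[OF presented_A] by blast
qed

end
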